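(* Let $M=\sum_{k=1}^\infty\sigma_kB^{H_k}$ be a multi-mixed fractional Brownian motion with parameters $\sigma_k,H_k$, $k\in\mathbb{N}$, and let $U$ be the multi-mixed fractional Ornstein--Uhlenbeck process with parameter $\lambda>0$ driven by $M$. Then for every $T>0$ both $(M_t)_{0\le t\le T}$ and $(U_t)_{0\le t\le T}$ have conditional full support.
   Context: A two-sided fractional Brownian motion (fBm) with Hurst index $H\in(0,1)$ is a centered Gaussian process $(B^H_t)_{t\in\mathbb{R}}$ with continuous paths and covariance $\mathbb{E}[B^H_tB^H_s]=\frac12\left(|t|^{2H}+|s|^{2H}-|t-s|^{2H}\right)$. Multi-mixed fractional Brownian motion (mmfBm): let $\sigma_k>0$, $k\in\mathbb{N}$, satisfy $\sum_{k=1}^\infty\sigma_k^2<\infty$, and let $H_k\in(0,1)$, $k\in\mathbb{N}$, be pairwise distinct with $\inf_kH_k>0$ and $\sup_kH_k<1$. With independent two-sided fBm's $B^{H_k}$, put $M_t=\sum_{k=1}^\infty\sigma_kB^{H_k}_t$, $t\in\mathbb{R}$, the series converging in $L^2(\Omega)$ for each $t$; $M$ is taken in its continuous version. Multi-mixed fractional Ornstein--Uhlenbeck process (mmfOU) with parameter $\lambda>0$: the stationary solution of $\mathrm{d}U_t=-\lambda U_t\,\mathrm{d}t+\mathrm{d}M_t$, that is, $U_t=\int_{-\infty}^t\mathrm{e}^{-\lambda(t-s)}\,\mathrm{d}M_s=M_t-\lambda\int_{-\infty}^t\mathrm{e}^{-\lambda(t-s)}M_s\,\mathrm{d}s$. Conditional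 full support (CFS): let $X=(X_t)_{0\le t\le T}$ be a continuous process with natural filtration $(\mathcal{F}_t)_{0\le t\le T}$ (each process, $M$ and $U$, is considered with its own natural filtration on $[0,T]$). $X$ has CFS if, for every $(\mathcal{F}_t)$-stopping time $\tau$ with values in $[0,T]$, the conditional law of $(X_u)_{\tau\le u\le T}$ given $\mathcal{F}_\tau$ almost surely has support $C_{X_\tau}[\tau,T]$, where $C_x[s,T]$ denotes the space of continuous functions $f$ on $[s,T]$ with $f(s)=x$, with the sup norm. Equivalently, for every such $\tau$, every continuous $f:[0,T]\to\mathbb{R}$ and every $\varepsilon>0$, almost surely $\mathbb{P}\left(\sup_{\tau\le u\le T}|X_u-X_\tau-(f(u)-f(\tau))|<\varepsilon\,\middle|\,\mathcal{F}_\tau\right)>0$. *)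

theory Defs
  imports "HOL-Probability.Probability"
begin

text \<open>Processes are functions \<open>X t \<omega>\<close> of time and sample point, on a probability space \<open>P\<close>.\<close>

text \<open>The case \<open>X = 0\<close> a.s. is the degenerate normal law, which has no density.\<close>

definition centered_gaussian :: "'a measure \<Rightarrow> ('a \<Rightarrow> real) \<Rightarrow> bool" where
  "centered_gaussian P X \<longleftrightarrow>
     X \<in> borel_measurable P \<and>
     ((AE \<omega> in P. X \<omega> = 0) \<or> (\<exists>s>0. distributed P lborel X (normal_density 0 s)))"

definition centered_gaussian_process :: "'a measure \<Rightarrow> (real \<Rightarrow> 'a \<Rightarrow> real) \<Rightarrow> bool" where
  "centered_gaussian_process P X \<longleftrightarrow>
     (\<forall>F c. finite F \<longrightarrow> centered_gaussian P (\<lambda>\<omega>. \<Sum>t\<in>F. c t * X t \<omega>))"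

definition continuous_paths :: "'a measure \<Rightarrow> (real \<Rightarrow> 'a \<Rightarrow> real) \<Rightarrow> bool" where
  "continuous_paths P X \<longleftrightarrow> (\<forall>\<omega>\<in>space P. continuous_on UNIV (\<lambda>t. X t \<omega>))"

definition fBm :: "'a measure \<Rightarrow> real \<Rightarrow> (real \<Rightarrow> 'a \<Rightarrow> real) \<Rightarrow> bool" where
  "fBm P H B \<longleftrightarrow>
     0 < H \<and> H < 1 \<and>
     centered_gaussian_process P B \<and>
     continuous_paths P B \<and>
     (\<forall>t s. prob_space.expectation P (\<lambda>\<omega>. B t \<omega> * B s \<omega>) =
        (\<bar>t\<bar> powr (2 * H) + \<bar>s\<bar> powr (2 * H) - \<bar>t - s\<bar> powr (2 * H)) / 2)"

text \<open>The index set of the series is \<^typ>\<open>nat\<close>, starting at \<open>0\<close>.\<close>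

definition mmfBm_params :: "(nat \<Rightarrow> real) \<Rightarrow> (nat \<Rightarrow> real) \<Rightarrow> bool" where
  "mmfBm_params \<sigma> H \<longleftrightarrow>
     (\<forall>k. 0 < \<sigma> k) \<and> summable (\<lambda>k. (\<sigma> k)\<^sup>2) \<and>
     (\<forall>k. 0 < H k \<and> H k < 1) \<and> inj H \<and>
     0 < (INF k. H k) \<and> (SUP k. H k) < 1"

text \<open>
  The fractional Brownian motions are independent as random elements of \<open>\<real>\<^sup>\<real>\<close> with its product
  \<open>\<sigma>\<close>-algebra. The \<open>L\<^sup>2\<close> distance is an \<^const>\<open>nn_integral\<close> because the Bochner integral of a
  non-integrable function is \<open>0\<close>.
\<close>

definition mmfBm ::
  "'a measure \<Rightarrow> (nat \<Rightarrow> real) \<Rightarrow> (nat \<Rightarrow> real) \<Rightarrow> (nat \<Rightarrow> real \<Rightarrow> 'a \<Rightarrow> real) \<Rightarrow> (real \<Rightarrow> 'a \<Rightarrow> real) \<Rightarrow> bool"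
  where
  "mmfBm P \<sigma> H B M \<longleftrightarrow>
     mmfBm_params \<sigma> H \<and>
     (\<forall>k. fBm P (H k) (B k)) \<and>
     prob_space.indep_vars P (\<lambda>_. \<Pi>\<^sub>M t\<in>(UNIV :: real set). (borel :: real measure))
       (\<lambda>k \<omega> t. B k t \<omega>) UNIV \<and>
     (\<forall>t. M t \<in> borel_measurable P) \<and>
     continuous_paths P M \<and>
     (\<forall>t. (\<lambda>n. \<integral>\<^sup>+ \<omega>. ennreal ((M t \<omega> - (\<Sum>k<n. \<sigma> k * B k t \<omega>))\<^sup>2) \<partial>P) \<longlonglongrightarrow> 0)"

text \<open>
  A continuous process equal, a.s. at each time, to
  \<open>M\<^sub>t - \<theta> \<integral>\<^sub>-\<^sub>\<infinity>\<^sup>t exp (- \<theta> (t - s)) M\<^sub>s ds\<close>. The integral converges only almost surely, so the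
  equality is not required on all of \<open>space P\<close>.
\<close>

definition mmfOU ::
  "'a measure \<Rightarrow> real \<Rightarrow> (real \<Rightarrow> 'a \<Rightarrow> real) \<Rightarrow> (real \<Rightarrow> 'a \<Rightarrow> real) \<Rightarrow> bool" where
  "mmfOU P \<theta> M U \<longleftrightarrow>
     (\<forall>t. U t \<in> borel_measurable P) \<and>
     continuous_paths P U \<and>
     (\<forall>t. AE \<omega> in P. U t \<omega> = M t \<omega> - \<theta> * (LINT s:{..t}|lborel. exp (- \<theta> * (t - s)) * M s \<omega>))"

text \<open>
  Indexed by all of \<^typ>\<open>real\<close>, trivial for \<open>t < 0\<close>. For times with values in \<open>[0, T]\<close> the
  \<open>\<sigma>\<close>-algebras with \<open>t > T\<close> affect neither the stopping time property nor \<open>\<F>\<^sub>\<tau>\<close>.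
\<close>

definition natural_filtration :: "'a measure \<Rightarrow> (real \<Rightarrow> 'a \<Rightarrow> real) \<Rightarrow> real \<Rightarrow> 'a measure" where
  "natural_filtration P X t =
     sigma (space P) {X s -` A \<inter> space P | s A. 0 \<le> s \<and> s \<le> t \<and> A \<in> sets borel}"

abbreviation stopped_sigma :: "'a measure \<Rightarrow> (real \<Rightarrow> 'a \<Rightarrow> real) \<Rightarrow> ('a \<Rightarrow> real) \<Rightarrow> 'a measure" where
  "stopped_sigma P X \<tau> \<equiv> filtration.pre_sigma (space P) (natural_filtration P X) \<tau>"

text \<open>
  Conditional full support on \<open>[0, T]\<close>: the conditional law of \<open>(X\<^sub>u)\<close>, \<open>\<tau> \<le> u \<le> T\<close>, given
  \<open>\<F>\<^sub>\<tau>\<close> charges every sup-norm ball around a continuous function starting at \<open>X\<^sub>\<tau>\<close>. A centre is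
  given as \<open>X\<^sub>\<tau> + f - f \<tau>\<close> with \<open>f\<close> a continuous function on \<open>[0, T]\<close>.
\<close>

definition conditional_full_support :: "'a measure \<Rightarrow> real \<Rightarrow> (real \<Rightarrow> 'a \<Rightarrow> real) \<Rightarrow> bool" where
  "conditional_full_support P T X \<longleftrightarrow>
     (\<forall>\<tau>. stopping_time (natural_filtration P X) \<tau> \<longrightarrow> (\<forall>\<omega>\<in>space P. \<tau> \<omega> \<in> {0..T}) \<longrightarrow>
       (\<forall>f \<epsilon>. continuous_on {0..T} f \<longrightarrow> 0 < \<epsilon> \<longrightarrow>
         (AE \<omega> in P.
            real_cond_exp P (stopped_sigma P X \<tau>)
              (indicator {\<omega>' \<in> space P.
                 (SUP u\<in>{\<tau> \<omega>'..T}. \<bar>X u \<omega>' - X (\<tau> \<omega>') \<omega>' - (f u - f (\<tau> \<omega>'))\<bar>) < \<epsilon>}) \<omega> > 0)))"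

end

theory Submission
  imports Defs
begin

text \<open>
  Call \<open>h\<close> an admissible shift of \<open>X\<close> if the law of \<open>X\<close> is that of \<open>X - h\<close> under some
  probability measure that is absolutely continuous with respect to \<open>P\<close>. By
  Cameron--Martin every \<open>h\<close> in the reproducing kernel Hilbert space of a Gaussian process is one. If \<open>h\<close>
  vanishes on \<open>[0, q]\<close>, the shift keeps all events of \<open>\<F>\<^sub>q\<close>, so on a non-null event of \<open>\<F>\<^sub>q\<close> the
  increments of \<open>X\<close> after \<open>q\<close> charge either all balls around a countable dense family of such
  \<open>h\<close> or none, and they cannot charge none since these balls cover the path space. No prediction formula
  or spectral density is needed.

  For \<open>M\<close> the kernel space contains that of \<open>\<sigma>\<^sub>0 B\<^sup>H\<^sup>0\<close>, because \<open>Var (\<Sum> c\<^sub>t M\<^sub>t) \<ge> \<sigma>\<^sub>0\<^sup>2 Var (\<Sum> c\<^sub>t B\<^sub>t)\<close>. The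
  Mandelbrot--van Ness kernel shows that the latter contains functions equal to
  \<open>(t - q)\<^sub>+\<^sup>n\<close> for \<open>t \<le> T\<close>, \<open>n \<ge> 1\<close>; these span a dense space by Weierstrass. A shift of \<open>M\<close> by \<open>h\<close> shifts \<open>U\<close> by
  \<open>h(t) - \<theta> \<integral> exp (- \<theta> (t - s)) h(s) ds\<close>, and this map is invertible on continuous functions vanishing at \<open>q\<close>.
\<close>

section \<open>Uniqueness of laws and the Cameron--Martin formula\<close>

text \<open>A conditional probability is almost surely positive exactly if the event meets every
  non-null conditioning event in positive mass, so no conditional law has to be described.
  Membership in the kernel space enters only as an inequality for finite linear combinations; the
  Riesz theorem turns it into a Gaussian variable \<open>\<xi>\<close> with E(\<open>\<xi>\<close>
  M_t) = h(t), and exp(\<open>\<xi>\<close> - E(\<open>\<xi>\<close>^2)/2) is the density of the new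
  measure. The comparison of variances rests on independence: the variances of the summands add, and
  the term of index 0 bounds the sum from below. Two features shape the rest. U_t depends on the
  path of M back to minus infinity, so shifts of M are understood for its law on the whole line, and
  the map from M to U must be measurable for the product sigma-algebra, which sees only countably
  many coordinates at a time. Moreover the shifts are explicit only up to time T, which is enough
  because the map from M to U looks backwards.\<close>

lemma iexp_add: "iexp (x + y) = iexp x * iexp y"
  by (simp add: distrib_left exp_add)

lemma cos_eq_iexp: "complex_of_real (cos x) = (iexp x + iexp (-x)) / 2"
  by (simp add: complex_eq_iff Re_exp Im_exp)

lemma sin_eq_iexp: "complex_of_real (sin x) = (iexp x - iexp (-x)) / (2 * \<i>)"
  by (simp add: complex_eq_iff Re_exp Im_exp)

lemma one_plus_cos_sin_bounds:
  fixes x :: real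
  shows "0 \<le> 1 + cos x" "1 + cos x \<le> 2" "0 \<le> 1 + sin x" "1 + sin x \<le> 2"
  using cos_ge_minus_one[of x] sin_ge_minus_one[of x] sin_le_one[of x] cos_le_one[of x] by linarith+

lemma integral_add_half:
  fixes f g h :: "'a \<Rightarrow> complex"
  assumes "integrable M f" "integrable M g" "integrable M h"
  shows "(\<integral>x. f x + (g x + h x) / 2 \<partial>M) = integral\<^sup>L M f + (integral\<^sup>L M g + integral\<^sup>L M h) / 2"
    and "(\<integral>x. f x + (g x - h x) / (2 * \<i>) \<partial>M) = integral\<^sup>L M f + (integral\<^sup>L M g - integral\<^sup>L M h) / (2 * \<i>)"
  using assms by simp_all

lemma integrable_weight_iexp:
  fixes W X :: "'a \<Rightarrow> real"
  assumes "finite_measure P" "X \<in> borel_measurable P" "W \<in> borel_measurable P"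
    "\<And>\<omega>. \<bar>W \<omega>\<bar> \<le> K"
  shows "integrable P (\<lambda>\<omega>. of_real (W \<omega>) * iexp (u * X \<omega>))"
proof -
  interpret finite_measure P by fact
  have [measurable]: "X \<in> borel_measurable P" "W \<in> borel_measurable P" by fact+
  show ?thesis
    by (rule integrable_const_bound[where B=K]) (use assms(4) in \<open>auto simp: norm_mult\<close>)
qed

text \<open>The value at \<open>u = 0\<close> shows that both weighted measures have the same total
  mass \<open>m\<close>. Division by \<open>m\<close> gives probability laws with equal
  characteristic functions, so Levy's uniqueness theorem applies. Weights allow a bounded factor to
  be carried along under the integral while one coordinate is treated.\<close>

lemma weighted_char_unique:
  fixes X W :: "'a \<Rightarrow> real" and Y V :: "'b \<Rightarrow> real"
  assumes P: "finite_measure P" and Q: "finite_measure Q"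
    and X[measurable]: "X \<in> borel_measurable P" and Y[measurable]: "Y \<in> borel_measurable Q"
    and W[measurable]: "W \<in> borel_measurable P" and V[measurable]: "V \<in> borel_measurable Q"
    and W0: "\<And>\<omega>. 0 \<le> W \<omega>" "\<And>\<omega>. W \<omega> \<le> K" and V0: "\<And>\<omega>. 0 \<le> V \<omega>" "\<And>\<omega>. V \<omega> \<le> L"
    and eq: "\<And>u. (CLINT \<omega>|P. of_real (W \<omega>) * iexp (u * X \<omega>)) = (CLINT \<omega>|Q. of_real (V \<omega>) * iexp (u * Y \<omega>))"
  shows "distr (density P W) borel X = distr (density Q V) borel Y"
proof -
  interpret P: finite_measure P by fact
  interpret Q: finite_measure Q by fact
  have iW: "integrable P W"
    by (rule P.integrable_const_bound[where B=K]) (use W0 in auto)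
  have iV: "integrable Q V"
    by (rule Q.integrable_const_bound[where B=L]) (use V0 in auto)
  define m where "m = (\<integral>\<omega>. W \<omega> \<partial>P)"
  have mV: "m = (\<integral>\<omega>. V \<omega> \<partial>Q)"
  proof -
    have "(CLINT \<omega>|P. of_real (W \<omega>)) = (CLINT \<omega>|Q. of_real (V \<omega>))"
      using eq[of 0] by simp
    then show ?thesis unfolding m_def
      by (metis integral_complex_of_real of_real_eq_iff)
  qed
  have m0: "0 \<le> m" unfolding m_def using W0 by simp
  have nW: "(\<integral>\<^sup>+\<omega>. ennreal (W \<omega>) \<partial>P) = ennreal m"
    unfolding m_def using iW W0 by (intro nn_integral_eq_integral) auto
  have nV: "(\<integral>\<^sup>+\<omega>. ennreal (V \<omega>) \<partial>Q) = ennreal m"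
    unfolding mV using iV V0 by (intro nn_integral_eq_integral) auto
  show ?thesis
  proof (cases "m = 0")
    case True
    have "emeasure (distr (density P W) borel X) A = 0" for A
    proof -
      have "emeasure (distr (density P W) borel X) A \<le> emeasure (distr (density P W) borel X) (space (distr (density P W) borel X))"
        by (rule emeasure_space)
      also have "\<dots> = 0"
        by (simp add: emeasure_distr emeasure_density nW True cong: nn_integral_cong)
      finally show ?thesis by simp
    qed
    moreover have "emeasure (distr (density Q V) borel Y) A = 0" for A
    proof -
      have "emeasure (distr (density Q V) borel Y) A \<le> emeasure (distr (density Q V) borel Y) (space (distr (density Q V) borel Y))"
        by (rule emeasure_space)
      also have "\<dots> = 0"
        by (simp add: emeasure_distr emeasure_density nV True cong: nn_integral_cong)
      finally show ?thesis by simp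
    qed
    ultimately show ?thesis by (intro measure_eqI) auto
  next
    case False
    then have mp: "0 < m" using m0 by simp
    define M1 where "M1 = distr (density P (\<lambda>\<omega>. ennreal (W \<omega> / m))) borel X"
    define M2 where "M2 = distr (density Q (\<lambda>\<omega>. ennreal (V \<omega> / m))) borel Y"
    have "real_distribution M1"
      unfolding M1_def real_distribution_def real_distribution_axioms_def
    proof (intro conjI prob_space.prob_space_distr)
      show "prob_space (density P (\<lambda>\<omega>. ennreal (W \<omega> / m)))"
      proof
        have "(\<integral>\<^sup>+\<omega>. ennreal (W \<omega> / m) \<partial>P) = ennreal (\<integral>\<omega>. W \<omega> / m \<partial>P)"
          using iW W0 m0 by (intro nn_integral_eq_integral) auto
        also have "\<dots> = 1" using mp by (simp add: m_def[symmetric])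
        finally show "emeasure (density P (\<lambda>\<omega>. ennreal (W \<omega> / m))) (space (density P (\<lambda>\<omega>. ennreal (W \<omega> / m)))) = 1"
          by (simp add: emeasure_density cong: nn_integral_cong)
      qed
    qed auto
    moreover have "real_distribution M2"
      unfolding M2_def real_distribution_def real_distribution_axioms_def
    proof (intro conjI prob_space.prob_space_distr)
      show "prob_space (density Q (\<lambda>\<omega>. ennreal (V \<omega> / m)))"
      proof
        have "(\<integral>\<^sup>+\<omega>. ennreal (V \<omega> / m) \<partial>Q) = ennreal (\<integral>\<omega>. V \<omega> / m \<partial>Q)"
          using iV V0 m0 by (intro nn_integral_eq_integral) auto
        also have "\<dots> = 1" using mp by (simp add: mV[symmetric])
        finally show "emeasure (density Q (\<lambda>\<omega>. ennreal (V \<omega> / m))) (space (density Q (\<lambda>\<omega>. ennreal (V \<omega> / m)))) = 1"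
          by (simp add: emeasure_density cong: nn_integral_cong)
      qed
    qed auto
    moreover have "char M1 u = char M2 u" for u
    proof -
      have "char M1 u = (CLINT \<omega>|P. (W \<omega> / m) *\<^sub>R iexp (u * X \<omega>))"
        unfolding char_def M1_def using W0 m0 by (subst integral_distr) (auto simp: integral_density)
      also have "\<dots> = (CLINT \<omega>|P. of_real (W \<omega>) * iexp (u * X \<omega>)) / m"
        by (simp add: scaleR_conv_of_real)
      also have "\<dots> = (CLINT \<omega>|Q. of_real (V \<omega>) * iexp (u * Y \<omega>)) / m" using eq[of u] by simp
      also have "\<dots> = (CLINT \<omega>|Q. (V \<omega> / m) *\<^sub>R iexp (u * Y \<omega>))"
        by (simp add: scaleR_conv_of_real)
      also have "\<dots> = char M2 u"
        unfolding char_def M2_def using V0 m0 by (subst integral_distr) (auto simp: integral_density)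
      finally show ?thesis .
    qed
    ultimately have M12: "M1 = M2" by (intro Levy_uniqueness ext) auto
    have 1: "emeasure (distr (density P W) borel X) A = ennreal m * emeasure M1 A" if "A \<in> sets borel" for A
      using that mp W0 unfolding M1_def
      by (simp add: emeasure_distr emeasure_density nn_integral_cmult[symmetric] mult.assoc[symmetric]
          ennreal_mult[symmetric] del: nn_integral_cmult)
    have 2: "emeasure (distr (density Q V) borel Y) A = ennreal m * emeasure M2 A" if "A \<in> sets borel" for A
      using that mp V0 unfolding M2_def
      by (simp add: emeasure_distr emeasure_density nn_integral_cmult[symmetric] mult.assoc[symmetric]
          ennreal_mult[symmetric] del: nn_integral_cmult)
    show ?thesis
      by (rule measure_eqI) (auto simp: 1 2 M12)
  qed
qed

text \<open>The exponentials are replaced by indicators one coordinate at a time;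
  the weights \<open>1\<close>, \<open>1 + cos S\<close>, \<open>1 + sin S\<close> keep the measures nonnegative.\<close>

lemma cramer_wold_cylinder:
  fixes X :: "'i \<Rightarrow> 'a \<Rightarrow> real" and Y :: "'i \<Rightarrow> 'b \<Rightarrow> real"
  assumes P: "prob_space P" and Q: "prob_space Q"
    and X[measurable]: "\<And>i. i \<in> I \<Longrightarrow> X i \<in> borel_measurable P"
    and Y[measurable]: "\<And>i. i \<in> I \<Longrightarrow> Y i \<in> borel_measurable Q"
    and eq: "\<And>F c. finite F \<Longrightarrow> F \<subseteq> I \<Longrightarrow>
      (CLINT \<omega>|P. iexp (\<Sum>i\<in>F. c i * X i \<omega>)) = (CLINT \<omega>|Q. iexp (\<Sum>i\<in>F. c i * Y i \<omega>))"
    and K: "finite K" "K \<subseteq> I" and A: "\<And>i. i \<in> K \<Longrightarrow> A i \<in> sets borel"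
    and F: "finite F" "F \<subseteq> I" "F \<inter> K = {}"
  shows "(CLINT \<omega>|P. of_real (\<Prod>i\<in>K. indicator (A i) (X i \<omega>)) * iexp (\<Sum>i\<in>F. c i * X i \<omega>)) =
         (CLINT \<omega>|Q. of_real (\<Prod>i\<in>K. indicator (A i) (Y i \<omega>)) * iexp (\<Sum>i\<in>F. c i * Y i \<omega>))"
  using K A F
proof (induction K arbitrary: F c rule: finite_induct)
  case empty
  then show ?case using eq[of F c] by simp
next
  case (insert k K)
  interpret P: prob_space P by fact
  interpret Q: prob_space Q by fact
  define p where "p \<omega> = (\<Prod>i\<in>K. indicator (A i) (X i \<omega>) :: real)" for \<omega>
  define q where "q \<omega> = (\<Prod>i\<in>K. indicator (A i) (Y i \<omega>) :: real)" for \<omega>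
  define S where "S c \<omega> = (\<Sum>i\<in>F. c i * X i \<omega>)" for c \<omega>
  define R where "R c \<omega> = (\<Sum>i\<in>F. c i * Y i \<omega>)" for c \<omega>
  have kI: "k \<in> I" and KI: "K \<subseteq> I" using insert by auto
  have [measurable]: "X k \<in> borel_measurable P" "Y k \<in> borel_measurable Q" using kI by auto
  have [measurable]: "\<And>i. i \<in> insert k K \<Longrightarrow> A i \<in> sets borel" using insert by auto
  have [measurable]: "p \<in> borel_measurable P" "q \<in> borel_measurable Q"
    unfolding p_def q_def using KI
    by (auto intro!: borel_measurable_prod borel_measurable_indicator' intro: measurable_compose[OF X] measurable_compose[OF Y])
  have [measurable]: "S c \<in> borel_measurable P" "R c \<in> borel_measurable Q" for c
    unfolding S_def R_def using insert.prems
    by (auto intro!: borel_measurable_sum borel_measurable_times X Y)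
  have p01: "0 \<le> p \<omega>" "p \<omega> \<le> 1" for \<omega>
    unfolding p_def by (auto intro!: prod_nonneg prod_le_1)
  have q01: "0 \<le> q \<omega>" "q \<omega> \<le> 1" for \<omega>
    unfolding q_def by (auto intro!: prod_nonneg prod_le_1)
  have kF: "k \<notin> F" "k \<notin> K" using insert by auto
  \<comment> \<open>With \<open>k\<close> added to the index set of the exponential, its coefficient
    \<open>u\<close> becomes a free Fourier variable for \<open>X k\<close>, while \<open>p\<close>
    and \<open>S d\<close> can be absorbed into a weight.\<close>
  have IH: "(CLINT \<omega>|P. of_real (p \<omega>) * iexp (S d \<omega> + u * X k \<omega>)) =
      (CLINT \<omega>|Q. of_real (q \<omega>) * iexp (R d \<omega> + u * Y k \<omega>))" for d u
  proof -
    have *: "(\<Sum>i\<in>insert k F. (d(k := u)) i * Z i) = (\<Sum>i\<in>F. d i * Z i) + u * Z k" for Z :: "'i \<Rightarrow> real"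
    proof -
      have "(\<Sum>i\<in>F. (d(k := u)) i * Z i) = (\<Sum>i\<in>F. d i * Z i)"
        by (rule sum.cong) (use kF in auto)
      then show ?thesis using insert.prems kF by simp
    qed
    have "(CLINT \<omega>|P. of_real (p \<omega>) * iexp (\<Sum>i\<in>insert k F. (d(k := u)) i * X i \<omega>)) =
      (CLINT \<omega>|Q. of_real (q \<omega>) * iexp (\<Sum>i\<in>insert k F. (d(k := u)) i * Y i \<omega>))"
      unfolding p_def q_def by (rule insert.IH) (use insert in auto)
    then show ?thesis
      unfolding S_def R_def *[of "\<lambda>i. X i _"] *[of "\<lambda>i. Y i _"] .
  qed
  have intP: "integrable P (\<lambda>\<omega>. of_real (p \<omega>) * iexp (Z \<omega>))" if [measurable]: "Z \<in> borel_measurable P" for Z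
    using integrable_weight_iexp[of P Z p 1 1] P.finite_measure_axioms p01 by (auto simp: abs_le_iff)
  have intQ: "integrable Q (\<lambda>\<omega>. of_real (q \<omega>) * iexp (Z \<omega>))" if [measurable]: "Z \<in> borel_measurable Q" for Z
    using integrable_weight_iexp[of Q Z q 1 1] Q.finite_measure_axioms q01 by (auto simp: abs_le_iff)
  have S0: "S (\<lambda>_. 0) \<omega> = 0" for \<omega> by (simp add: S_def)
  have R0: "R (\<lambda>_. 0) \<omega> = 0" for \<omega> by (simp add: R_def)
  have Sm: "S (\<lambda>i. - c i) \<omega> = - S c \<omega>" for \<omega> by (simp add: S_def sum_negf)
  have Rm: "R (\<lambda>i. - c i) \<omega> = - R c \<omega>" for \<omega> by (simp add: R_def sum_negf)
  have alg1: "r * (1 + (a + b) / 2) * v = r * (1 * v) + (r * (a * v) + r * (b * v)) / 2" for r a b v :: complex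
    by (simp add: field_simps)
  have alg2: "r * (1 + (a - b) / (2 * \<i>)) * v = r * (1 * v) + (r * (a * v) - r * (b * v)) / (2 * \<i>)" for r a b v :: complex
    by (simp add: field_simps)
  have i0: "iexp 0 = 1" by simp
  have cosw: "complex_of_real (r * (1 + cos s)) * iexp v =
      of_real r * iexp (0 + v) + (of_real r * iexp (s + v) + of_real r * iexp (- s + v)) / 2" for r s v
    by (simp only: iexp_add) (simp only: of_real_mult of_real_add of_real_1 cos_eq_iexp i0 alg1)
  have sinw: "complex_of_real (r * (1 + sin s)) * iexp v =
      of_real r * iexp (0 + v) + (of_real r * iexp (s + v) - of_real r * iexp (- s + v)) / (2 * \<i>)" for r s v
    by (simp only: iexp_add) (simp only: of_real_mult of_real_add of_real_1 sin_eq_iexp i0 alg2)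
  have bnd: "0 \<le> r * (1 + cos x)" "r * (1 + cos x) \<le> 2" "0 \<le> r * (1 + sin x)" "r * (1 + sin x) \<le> 2"
    if "0 \<le> r" "r \<le> 1" for r x :: real
  proof -
    note * = one_plus_cos_sin_bounds[of x]
    show "0 \<le> r * (1 + cos x)" "0 \<le> r * (1 + sin x)"
      using that * by (auto intro!: mult_nonneg_nonneg)
    show "r * (1 + cos x) \<le> 2" using mult_mono[of r 1 "1 + cos x" 2] that * by simp
    show "r * (1 + sin x) \<le> 2" using mult_mono[of r 1 "1 + sin x" 2] that * by simp
  qed
  have w1: "distr (density P p) borel (X k) = distr (density Q q) borel (Y k)"
    using IH[of "\<lambda>_. 0"] by (intro weighted_char_unique[where K=1 and L=1])
      (auto simp: p01 q01 S0 R0 P.finite_measure_axioms Q.finite_measure_axioms)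
  have w2: "distr (density P (\<lambda>\<omega>. p \<omega> * (1 + cos (S c \<omega>)))) borel (X k) = distr (density Q (\<lambda>\<omega>. q \<omega> * (1 + cos (R c \<omega>)))) borel (Y k)"
  proof (intro weighted_char_unique[where K=2 and L=2])
    fix u
    have "(CLINT \<omega>|P. of_real (p \<omega> * (1 + cos (S c \<omega>))) * iexp (u * X k \<omega>)) =
      (CLINT \<omega>|P. of_real (p \<omega>) * iexp (S (\<lambda>_. 0) \<omega> + u * X k \<omega>) +
         (of_real (p \<omega>) * iexp (S c \<omega> + u * X k \<omega>) + of_real (p \<omega>) * iexp (S (\<lambda>i. - c i) \<omega> + u * X k \<omega>)) / 2)"
      by (rule Bochner_Integration.integral_cong) (simp_all only: S0 Sm cosw)
    also have "\<dots> = (CLINT \<omega>|Q. of_real (q \<omega>) * iexp (R (\<lambda>_. 0) \<omega> + u * Y k \<omega>) +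
         (of_real (q \<omega>) * iexp (R c \<omega> + u * Y k \<omega>) + of_real (q \<omega>) * iexp (R (\<lambda>i. - c i) \<omega> + u * Y k \<omega>)) / 2)"
      by (subst integral_add_half(1), (rule intP, measurable)+, subst integral_add_half(1), (rule intQ, measurable)+) (simp only: IH)
    also have "\<dots> = (CLINT \<omega>|Q. of_real (q \<omega> * (1 + cos (R c \<omega>))) * iexp (u * Y k \<omega>))"
      by (rule Bochner_Integration.integral_cong) (simp_all only: R0 Rm cosw)
    finally show "(CLINT \<omega>|P. of_real (p \<omega> * (1 + cos (S c \<omega>))) * iexp (u * X k \<omega>)) =
      (CLINT \<omega>|Q. of_real (q \<omega> * (1 + cos (R c \<omega>))) * iexp (u * Y k \<omega>))" .
  qed (simp_all add: bnd p01 q01 P.finite_measure_axioms Q.finite_measure_axioms)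
  have w3: "distr (density P (\<lambda>\<omega>. p \<omega> * (1 + sin (S c \<omega>)))) borel (X k) = distr (density Q (\<lambda>\<omega>. q \<omega> * (1 + sin (R c \<omega>)))) borel (Y k)"
  proof (intro weighted_char_unique[where K=2 and L=2])
    fix u
    have "(CLINT \<omega>|P. of_real (p \<omega> * (1 + sin (S c \<omega>))) * iexp (u * X k \<omega>)) =
      (CLINT \<omega>|P. of_real (p \<omega>) * iexp (S (\<lambda>_. 0) \<omega> + u * X k \<omega>) +
         (of_real (p \<omega>) * iexp (S c \<omega> + u * X k \<omega>) - of_real (p \<omega>) * iexp (S (\<lambda>i. - c i) \<omega> + u * X k \<omega>)) / (2 * \<i>))"
      by (rule Bochner_Integration.integral_cong) (simp_all only: S0 Sm sinw)
    also have "\<dots> = (CLINT \<omega>|Q. of_real (q \<omega>) * iexp (R (\<lambda>_. 0) \<omega> + u * Y k \<omega>) +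
         (of_real (q \<omega>) * iexp (R c \<omega> + u * Y k \<omega>) - of_real (q \<omega>) * iexp (R (\<lambda>i. - c i) \<omega> + u * Y k \<omega>)) / (2 * \<i>))"
      by (subst integral_add_half(2), (rule intP, measurable)+, subst integral_add_half(2), (rule intQ, measurable)+) (simp only: IH)
    also have "\<dots> = (CLINT \<omega>|Q. of_real (q \<omega> * (1 + sin (R c \<omega>))) * iexp (u * Y k \<omega>))"
      by (rule Bochner_Integration.integral_cong) (simp_all only: R0 Rm sinw)
    finally show "(CLINT \<omega>|P. of_real (p \<omega> * (1 + sin (S c \<omega>))) * iexp (u * X k \<omega>)) =
      (CLINT \<omega>|Q. of_real (q \<omega> * (1 + sin (R c \<omega>))) * iexp (u * Y k \<omega>))" .
  qed (simp_all add: bnd p01 q01 P.finite_measure_axioms Q.finite_measure_axioms)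
  have Ak[measurable]: "A k \<in> sets borel" using insert by auto
  \<comment> \<open>Equality of weighted laws is tested on \<open>A k\<close>. Subtracting the
    result for the weight \<open>p\<close> from those with \<open>1 + cos\<close> and
    \<open>1 + sin\<close> leaves the real and imaginary parts of the goal.\<close>
  have ex: "(\<integral>\<omega>. W \<omega> * indicator (A k) (X k \<omega>) \<partial>P) = (\<integral>\<omega>. V \<omega> * indicator (A k) (Y k \<omega>) \<partial>Q)"
    if "distr (density P W) borel (X k) = distr (density Q V) borel (Y k)"
      and [measurable]: "W \<in> borel_measurable P" "V \<in> borel_measurable Q"
      and "\<And>\<omega>. 0 \<le> W \<omega>" "\<And>\<omega>. 0 \<le> V \<omega>" for W V :: "_ \<Rightarrow> real"
  proof -
    have "(\<integral>\<omega>. W \<omega> * indicator (A k) (X k \<omega>) \<partial>P) = (\<integral>x. indicator (A k) x \<partial>distr (density P W) borel (X k))"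
      using that(4) by (subst integral_distr, simp, simp, subst integral_density) auto
    also have "\<dots> = (\<integral>\<omega>. V \<omega> * indicator (A k) (Y k \<omega>) \<partial>Q)"
      unfolding that(1) using that(5) by (subst integral_distr, simp, simp, subst integral_density) auto
    finally show ?thesis .
  qed
  have iP: "integrable P (\<lambda>\<omega>. p \<omega> * f (S c \<omega>) * indicator (A k) (X k \<omega>))"
    if [measurable]: "f \<in> borel_measurable borel" and "\<And>x. \<bar>f x\<bar> \<le> 2" for f :: "real \<Rightarrow> real"
    apply (rule P.integrable_const_bound[where B=2])
    using p01 that mult_mono[of "p _" 1 "\<bar>f _\<bar>" 2, simplified]
    by (auto simp: abs_mult split: split_indicator)
  have iQ: "integrable Q (\<lambda>\<omega>. q \<omega> * f (R c \<omega>) * indicator (A k) (Y k \<omega>))"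
    if [measurable]: "f \<in> borel_measurable borel" and "\<And>x. \<bar>f x\<bar> \<le> 2" for f :: "real \<Rightarrow> real"
    apply (rule Q.integrable_const_bound[where B=2])
    using q01 that mult_mono[of "q _" 1 "\<bar>f _\<bar>" 2, simplified]
    by (auto simp: abs_mult split: split_indicator)
  have e1: "(\<integral>\<omega>. p \<omega> * indicator (A k) (X k \<omega>) \<partial>P) = (\<integral>\<omega>. q \<omega> * indicator (A k) (Y k \<omega>) \<partial>Q)"
    by (rule ex[OF w1]) (auto simp: p01 q01)
  have ip1: "integrable P (\<lambda>\<omega>. p \<omega> * indicator (A k) (X k \<omega>))" using iP[of "\<lambda>_. 1"] by simp
  have iq1: "integrable Q (\<lambda>\<omega>. q \<omega> * indicator (A k) (Y k \<omega>))" using iQ[of "\<lambda>_. 1"] by simp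
  have ipc: "integrable P (\<lambda>\<omega>. p \<omega> * cos (S c \<omega>) * indicator (A k) (X k \<omega>))"
    by (rule iP) (auto intro: order_trans[OF abs_cos_le_one])
  have ips: "integrable P (\<lambda>\<omega>. p \<omega> * sin (S c \<omega>) * indicator (A k) (X k \<omega>))"
    by (rule iP) (auto intro: order_trans[OF abs_sin_le_one])
  have iqc: "integrable Q (\<lambda>\<omega>. q \<omega> * cos (R c \<omega>) * indicator (A k) (Y k \<omega>))"
    by (rule iQ) (auto intro: order_trans[OF abs_cos_le_one])
  have iqs: "integrable Q (\<lambda>\<omega>. q \<omega> * sin (R c \<omega>) * indicator (A k) (Y k \<omega>))"
    by (rule iQ) (auto intro: order_trans[OF abs_sin_le_one])
  have e2: "(\<integral>\<omega>. p \<omega> * cos (S c \<omega>) * indicator (A k) (X k \<omega>) \<partial>P) = (\<integral>\<omega>. q \<omega> * cos (R c \<omega>) * indicator (A k) (Y k \<omega>) \<partial>Q)"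
  proof -
    have "(\<integral>\<omega>. p \<omega> * (1 + cos (S c \<omega>)) * indicator (A k) (X k \<omega>) \<partial>P) = (\<integral>\<omega>. q \<omega> * (1 + cos (R c \<omega>)) * indicator (A k) (Y k \<omega>) \<partial>Q)"
      by (rule ex[OF w2]) (simp_all add: p01 q01 bnd)
    then show ?thesis
      using Bochner_Integration.integral_add[OF ip1 ipc] Bochner_Integration.integral_add[OF iq1 iqc] e1
      by (simp add: algebra_simps)
  qed
  have e3: "(\<integral>\<omega>. p \<omega> * sin (S c \<omega>) * indicator (A k) (X k \<omega>) \<partial>P) = (\<integral>\<omega>. q \<omega> * sin (R c \<omega>) * indicator (A k) (Y k \<omega>) \<partial>Q)"
  proof -
    have "(\<integral>\<omega>. p \<omega> * (1 + sin (S c \<omega>)) * indicator (A k) (X k \<omega>) \<partial>P) = (\<integral>\<omega>. q \<omega> * (1 + sin (R c \<omega>)) * indicator (A k) (Y k \<omega>) \<partial>Q)"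
      by (rule ex[OF w3]) (simp_all add: p01 q01 bnd)
    then show ?thesis
      using Bochner_Integration.integral_add[OF ip1 ips] Bochner_Integration.integral_add[OF iq1 iqs] e1
      by (simp add: algebra_simps)
  qed
  have dec: "complex_of_real (\<Prod>i\<in>insert k K. indicator (A i) (Z i)) * iexp x =
      of_real ((\<Prod>i\<in>K. indicator (A i) (Z i)) * cos x * indicator (A k) (Z k)) + \<i> * of_real ((\<Prod>i\<in>K. indicator (A i) (Z i)) * sin x * indicator (A k) (Z k))"
    for Z and x :: real
    using insert.hyps by (simp add: complex_eq_iff Re_exp Im_exp split: split_indicator)
  show ?case
    unfolding dec p_def[symmetric] q_def[symmetric] S_def[symmetric] R_def[symmetric]
    apply (subst (1 2) Bochner_Integration.integral_add)
    using ipc ips iqc iqs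
    by (auto simp only: integrable_of_real integral_complex_of_real e2 e3 integrable_mult_right integral_mult_right_zero)
qed

text \<open>The cylinder formula with no exponential left shows that both laws agree on
  finite-dimensional boxes, which generate the product sigma-algebra and are closed under
  intersection.\<close>

lemma cramer_wold_process:
  fixes X :: "'i \<Rightarrow> 'a \<Rightarrow> real" and Y :: "'i \<Rightarrow> 'b \<Rightarrow> real"
  assumes P: "prob_space P" and Q: "prob_space Q"
    and X[measurable]: "\<And>i. i \<in> I \<Longrightarrow> X i \<in> borel_measurable P"
    and Y[measurable]: "\<And>i. i \<in> I \<Longrightarrow> Y i \<in> borel_measurable Q"
    and eq: "\<And>F c. finite F \<Longrightarrow> F \<subseteq> I \<Longrightarrow>
      (CLINT \<omega>|P. iexp (\<Sum>i\<in>F. c i * X i \<omega>)) = (CLINT \<omega>|Q. iexp (\<Sum>i\<in>F. c i * Y i \<omega>))"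
  shows "distr P (PiM I (\<lambda>_. borel)) (\<lambda>\<omega>. \<lambda>i\<in>I. X i \<omega>) = distr Q (PiM I (\<lambda>_. borel)) (\<lambda>\<omega>. \<lambda>i\<in>I. Y i \<omega>)"
proof (rule measure_eqI_PiM_infinite)
  interpret P: prob_space P by fact
  interpret Q: prob_space Q by fact
  have mX[measurable]: "(\<lambda>\<omega>. \<lambda>i\<in>I. X i \<omega>) \<in> measurable P (PiM I (\<lambda>_. borel))"
    by (rule measurable_restrict) simp
  have mY[measurable]: "(\<lambda>\<omega>. \<lambda>i\<in>I. Y i \<omega>) \<in> measurable Q (PiM I (\<lambda>_. borel))"
    by (rule measurable_restrict) simp
  show "finite_measure (distr P (PiM I (\<lambda>_. borel)) (\<lambda>\<omega>. \<lambda>i\<in>I. X i \<omega>))"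
    by (intro P.finite_measure_distr mX)
  fix A J assume J: "finite J" "J \<subseteq> I" and A: "\<And>i. i \<in> J \<Longrightarrow> A i \<in> sets (borel :: real measure)"
  have "(CLINT \<omega>|P. of_real (\<Prod>i\<in>J. indicator (A i) (X i \<omega>)) * iexp (\<Sum>i\<in>{}. 0 * X i \<omega>)) =
         (CLINT \<omega>|Q. of_real (\<Prod>i\<in>J. indicator (A i) (Y i \<omega>)) * iexp (\<Sum>i\<in>{}. 0 * Y i \<omega>))"
    by (rule cramer_wold_cylinder[OF P Q X Y eq J A]) auto
  then have 1: "(\<integral>\<omega>. (\<Prod>i\<in>J. indicator (A i) (X i \<omega>)) \<partial>P) = (\<integral>\<omega>. (\<Prod>i\<in>J. indicator (A i) (Y i \<omega>)) \<partial>Q :: real)"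
    by (simp del: of_real_prod)
  have E[measurable]: "prod_emb I (\<lambda>_. borel) J (Pi\<^sub>E J A) \<in> sets (PiM I (\<lambda>_. borel :: real measure))"
    using J A by (intro sets_PiM_I) auto
  have emb: "indicator (prod_emb I (\<lambda>_. borel) J (Pi\<^sub>E J A)) (\<lambda>i\<in>I. Z i) = (\<Prod>i\<in>J. indicator (A i) (Z i) :: real)" for Z :: "'i \<Rightarrow> real"
  proof -
    have "(\<Prod>i\<in>J. indicator (A i) (Z i) :: real) = (if \<forall>i\<in>J. Z i \<in> A i then 1 else 0)"
      using J by (auto simp: indicator_def)
    then show ?thesis using J
      by (auto simp: indicator_def prod_emb_def space_PiM Pi_iff PiE_iff extensional_def subset_iff restrict_def)
  qed
  have *: "emeasure (distr P (PiM I (\<lambda>_. borel)) (\<lambda>\<omega>. \<lambda>i\<in>I. X i \<omega>)) (prod_emb I (\<lambda>_. borel) J (Pi\<^sub>E J A)) =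
      ennreal (\<integral>\<omega>. (\<Prod>i\<in>J. indicator (A i) (X i \<omega>)) \<partial>P)" 
  proof -
    interpret D: prob_space "distr P (PiM I (\<lambda>_. borel)) (\<lambda>\<omega>. \<lambda>i\<in>I. X i \<omega>)" by (rule P.prob_space_distr) fact
    have "D.prob (prod_emb I (\<lambda>_. borel) J (Pi\<^sub>E J A)) = (\<integral>x. indicator (prod_emb I (\<lambda>_. borel) J (Pi\<^sub>E J A)) x \<partial>distr P (PiM I (\<lambda>_. borel)) (\<lambda>\<omega>. \<lambda>i\<in>I. X i \<omega>))"
      by simp
    also have "\<dots> = (\<integral>\<omega>. (\<Prod>i\<in>J. indicator (A i) (X i \<omega>)) \<partial>P)"
      by (subst integral_distr[OF mX]) (simp_all only: emb borel_measurable_indicator[OF E])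
    finally show ?thesis by (simp add: D.emeasure_eq_measure)
  qed
  have **: "emeasure (distr Q (PiM I (\<lambda>_. borel)) (\<lambda>\<omega>. \<lambda>i\<in>I. Y i \<omega>)) (prod_emb I (\<lambda>_. borel) J (Pi\<^sub>E J A)) =
      ennreal (\<integral>\<omega>. (\<Prod>i\<in>J. indicator (A i) (Y i \<omega>)) \<partial>Q)" 
  proof -
    interpret D: prob_space "distr Q (PiM I (\<lambda>_. borel)) (\<lambda>\<omega>. \<lambda>i\<in>I. Y i \<omega>)" by (rule Q.prob_space_distr) fact
    have "D.prob (prod_emb I (\<lambda>_. borel) J (Pi\<^sub>E J A)) = (\<integral>x. indicator (prod_emb I (\<lambda>_. borel) J (Pi\<^sub>E J A)) x \<partial>distr Q (PiM I (\<lambda>_. borel)) (\<lambda>\<omega>. \<lambda>i\<in>I. Y i \<omega>))"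
      by simp
    also have "\<dots> = (\<integral>\<omega>. (\<Prod>i\<in>J. indicator (A i) (Y i \<omega>)) \<partial>Q)"
      by (subst integral_distr[OF mY]) (simp_all only: emb borel_measurable_indicator[OF E])
    finally show ?thesis by (simp add: D.emeasure_eq_measure)
  qed
  show "emeasure (distr P (PiM I (\<lambda>_. borel)) (\<lambda>\<omega>. \<lambda>i\<in>I. X i \<omega>)) (prod_emb I (\<lambda>_. borel) J (Pi\<^sub>E J A)) =
    emeasure (distr Q (PiM I (\<lambda>_. borel)) (\<lambda>\<omega>. \<lambda>i\<in>I. Y i \<omega>)) (prod_emb I (\<lambda>_. borel) J (Pi\<^sub>E J A))"
    unfolding * ** 1 ..
qed (auto)

section \<open>Exponential tilting of Gaussian variables\<close>

lemma char_normal_density: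
  assumes "0 < s"
  shows "integrable lborel (\<lambda>x. normal_density m s x *\<^sub>R iexp (u * x))"
    and "(CLBINT x. normal_density m s x *\<^sub>R iexp (u * x)) = exp (\<i> * of_real (m * u) - of_real (s\<^sup>2 * u\<^sup>2 / 2))"
proof -
  show *: "integrable lborel (\<lambda>x. normal_density m s x *\<^sub>R iexp (u * x))" for u
    by (rule Bochner_Integration.integrable_bound[OF integrable_normal_density[OF assms, of m]])
       (auto simp: assms)
  have nd: "\<bar>s\<bar> * normal_density m s (m + s * x) = std_normal_density x" for x
    using assms by (simp add: normal_density_def real_sqrt_mult power_mult_distrib)
  have "(CLBINT x. normal_density m s x *\<^sub>R iexp (u * x)) =
      \<bar>s\<bar> *\<^sub>R (CLBINT x. normal_density m s (m + s * x) *\<^sub>R iexp (u * (m + s * x)))"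
    by (rule lborel_integral_real_affine) (use assms in auto)
  also have "\<dots> = (CLBINT x. iexp (u * m) * (std_normal_density x *\<^sub>R iexp ((u * s) * x)))"
    unfolding integral_scaleR_right[symmetric] nd[symmetric]
    by (rule Bochner_Integration.integral_cong) (simp_all add: distrib_left exp_add algebra_simps)
  also have "\<dots> = iexp (u * m) * (CLBINT x. (std_normal_density x *\<^sub>R iexp ((u * s) * x)))"
    by (rule integral_mult_right_zero)
  also have "(CLBINT x. (std_normal_density x *\<^sub>R iexp ((u * s) * x))) = char std_normal_distribution (u * s)"
    unfolding char_def by (subst integral_density) auto
  also have "\<dots> = of_real (exp (- (u * s)\<^sup>2 / 2))"
    by (simp add: char_std_normal_distribution)
  also have "iexp (u * m) * of_real (exp (- (u * s)\<^sup>2 / 2)) = exp (\<i> * of_real (m * u) - of_real (s\<^sup>2 * u\<^sup>2 / 2))"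
    unfolding exp_of_real[symmetric] exp_add[symmetric] by (simp add: power_mult_distrib mult.commute)
  finally show "(CLBINT x. normal_density m s x *\<^sub>R iexp (u * x)) = exp (\<i> * of_real (m * u) - of_real (s\<^sup>2 * u\<^sup>2 / 2))" .
qed

text \<open>Completing the square; this is Cameron--Martin in dimension one, where the mean moves by
  the variance of the tilting variable.\<close>

lemma normal_density_tilt:
  assumes "0 < s"
  shows "normal_density 0 s x * exp (x - s\<^sup>2 / 2) = normal_density (s\<^sup>2) s x"
proof -
  have "- (x - 0)\<^sup>2 / (2 * s\<^sup>2) + (x - s\<^sup>2 / 2) = - (x - s\<^sup>2)\<^sup>2 / (2 * s\<^sup>2)"
    using assms by (simp add: power2_eq_square field_simps)
  then show ?thesis
    unfolding normal_density_def by (simp only: mult.assoc exp_add[symmetric])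
qed

text \<open>Formally this is \<open>ch\<close> at the imaginary frequency \<open>u = - \<i>\<close>
  with \<open>v = 1\<close>, times exp(-a/2). Instead of analytic continuation,
  \<open>\<eta>\<close> is regressed on \<open>\<xi>\<close>: the residual is independent of
  \<open>\<xi>\<close>, and one-dimensional laws suffice.\<close>

lemma cameron_martin_char:
  fixes \<xi> \<eta> :: "'a \<Rightarrow> real"
  assumes P: "prob_space P"
    and \<xi>[measurable]: "\<xi> \<in> borel_measurable P" and \<eta>[measurable]: "\<eta> \<in> borel_measurable P"
    and a: "0 < a"
    and ch: "\<And>u v. (CLINT \<omega>|P. iexp (u * \<xi> \<omega> + v * \<eta> \<omega>)) = of_real (exp (- (u\<^sup>2 * a + 2 * u * v * b + v\<^sup>2 * d) / 2))"
  shows "(CLINT \<omega>|P. of_real (exp (\<xi> \<omega> - a / 2)) * iexp (\<eta> \<omega>)) = exp (\<i> * of_real b - of_real (d / 2))"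
proof -
  interpret P: prob_space P by fact
  \<comment> \<open>\<open>\<alpha>\<close> is the regression coefficient and
    \<open>\<delta>\<close> the residual variance, so the joint characteristic function of
    \<open>\<xi>\<close> and \<open>\<zeta>\<close> factorises in \<open>ch'\<close>.\<close>
  define \<alpha> where "\<alpha> = b / a"
  define \<delta> where "\<delta> = d - b\<^sup>2 / a"
  define \<zeta> where "\<zeta> \<omega> = \<eta> \<omega> - \<alpha> * \<xi> \<omega>" for \<omega>
  have [measurable]: "\<zeta> \<in> borel_measurable P" unfolding \<zeta>_def by measurable
  define s where "s = sqrt a"
  have s: "0 < s" "s\<^sup>2 = a" using a by (auto simp: s_def)
  have ch': "(CLINT \<omega>|P. iexp (u * \<xi> \<omega> + v * \<zeta> \<omega>)) = of_real (exp (- (u\<^sup>2 * a + v\<^sup>2 * \<delta>) / 2))" for u v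
  proof -
    have "(CLINT \<omega>|P. iexp (u * \<xi> \<omega> + v * \<zeta> \<omega>)) = (CLINT \<omega>|P. iexp ((u - v * \<alpha>) * \<xi> \<omega> + v * \<eta> \<omega>))"
      by (rule Bochner_Integration.integral_cong) (auto simp: \<zeta>_def algebra_simps)
    also have "\<dots> = of_real (exp (- ((u - v * \<alpha>)\<^sup>2 * a + 2 * (u - v * \<alpha>) * v * b + v\<^sup>2 * d) / 2))"
      by (rule ch)
    also have "(u - v * \<alpha>)\<^sup>2 * a + 2 * (u - v * \<alpha>) * v * b + v\<^sup>2 * d = u\<^sup>2 * a + v\<^sup>2 * \<delta>"
      using a by (simp add: \<alpha>_def \<delta>_def power2_eq_square field_simps)
    finally show ?thesis .
  qed
  have int: "integrable P (\<lambda>\<omega>. iexp (Z \<omega>))" if [measurable]: "Z \<in> borel_measurable P" for Z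
    by (rule P.integrable_const_bound[where B=1]) auto
  define N where "N = density lborel (normal_density 0 s)"
  interpret N: prob_space N unfolding N_def by (rule prob_space_normal_density) (rule s)
  have [simp]: "sets N = sets borel" "space N = UNIV" by (auto simp: N_def)
  have N[measurable_cong]: "sets N = sets borel" by simp
  have chN: "(CLINT x|N. iexp (u * x)) = of_real (exp (- (u\<^sup>2 * a) / 2))" for u
  proof -
    have "(CLINT x|N. iexp (u * x)) = (CLBINT x. normal_density 0 s x *\<^sub>R iexp (u * x))"
      unfolding N_def by (subst integral_density) auto
    also have "\<dots> = exp (\<i> * of_real (0 * u) - of_real (s\<^sup>2 * u\<^sup>2 / 2))" by (rule char_normal_density[OF s(1)])
    also have "\<dots> = of_real (exp (- (u\<^sup>2 * a) / 2))"
      by (simp add: exp_of_real[symmetric] s mult.commute)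
    finally show ?thesis .
  qed
  define f where "f x = complex_of_real (exp (x - a / 2)) * iexp (\<alpha> * x)" for x :: real
  have [measurable]: "f \<in> borel_measurable borel" unfolding f_def by measurable
  have ft: "normal_density 0 s x *\<^sub>R f x = normal_density a s x *\<^sub>R iexp (\<alpha> * x)" for x
    using normal_density_tilt[OF s(1), of x] unfolding f_def s(2)
    by (simp add: scaleR_conv_of_real mult.assoc[symmetric] of_real_mult[symmetric] del: of_real_mult)
  have intf: "integrable N f"
    unfolding N_def by (subst integrable_density) (use char_normal_density(1)[OF s(1), of a \<alpha>] in \<open>auto simp: ft\<close>)
  define e where "e = exp (\<i> * of_real b - of_real (b\<^sup>2 / (2 * a)))"
  have If: "(CLINT x|N. f x) = e"
  proof -
    have "(CLINT x|N. f x) = (CLBINT x. normal_density a s x *\<^sub>R iexp (\<alpha> * x))"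
      unfolding N_def by (subst integral_density) (auto simp: ft)
    also have "\<dots> = exp (\<i> * of_real (a * \<alpha>) - of_real (s\<^sup>2 * \<alpha>\<^sup>2 / 2))" by (rule char_normal_density[OF s(1)])
    also have "a * \<alpha> = b" using a by (simp add: \<alpha>_def)
    also have "s\<^sup>2 * \<alpha>\<^sup>2 / 2 = b\<^sup>2 / (2 * a)" unfolding s(2) using a by (simp add: \<alpha>_def power2_eq_square field_simps)
    also have "exp (\<i> * of_real b - of_real (b\<^sup>2 / (2 * a))) = e" by (simp only: e_def)
    finally show ?thesis .
  qed
  \<comment> \<open>Independence in usable form: the hypothesis says that the weight
    \<open>W\<close>, below a function of \<open>\<zeta>\<close>, leaves the law of
    \<open>\<xi>\<close> proportional to \<open>N\<close>. The unbounded factor \<open>f\<close> is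
    thereby integrated against an explicit Gaussian law.\<close>
  have key: "integrable P (\<lambda>\<omega>. W \<omega> *\<^sub>R f (\<xi> \<omega>)) \<and> (CLINT \<omega>|P. W \<omega> *\<^sub>R f (\<xi> \<omega>)) = of_real c * e"
    if [measurable]: "W \<in> borel_measurable P" and W: "\<And>\<omega>. 0 \<le> W \<omega>" "\<And>\<omega>. W \<omega> \<le> 2" and c: "0 \<le> c"
      and eq: "\<And>u. (CLINT \<omega>|P. of_real (W \<omega>) * iexp (u * \<xi> \<omega>)) = of_real (c * exp (- (u\<^sup>2 * a) / 2))" for W c
  proof -
    have D: "distr (density P W) borel \<xi> = distr (density N (\<lambda>_. ennreal c)) borel (\<lambda>x. x)"
    proof (rule weighted_char_unique[where K=2 and L=c])
      fix u
      show "(CLINT \<omega>|P. of_real (W \<omega>) * iexp (u * \<xi> \<omega>)) = (CLINT x|N. of_real c * iexp (u * x))"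
        unfolding eq using chN[of u] by simp
    qed (use W c in \<open>auto simp: P.finite_measure_axioms N.finite_measure_axioms\<close>)
    have "integrable (distr (density N (\<lambda>_. ennreal c)) borel (\<lambda>x. x)) f"
      using c intf by (subst integrable_distr_eq) (auto simp: integrable_density)
    moreover have "(CLINT x|distr (density N (\<lambda>_. ennreal c)) borel (\<lambda>x. x). f x) = of_real c * e"
      using c If by (subst integral_distr) (auto simp: integral_density scaleR_conv_of_real)
    ultimately show ?thesis
      unfolding D[symmetric] using W
      by (subst (asm) integrable_distr_eq, simp, simp, subst (asm) integral_distr, simp, simp)
        (auto simp: integrable_density integral_density)
  qed
  have i0: "iexp 0 = 1" by simp
  have alg1: "(1 + (x + y) / 2) * v = v * 1 + (v * x + v * y) / 2" for x y v :: complex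
    by (simp add: field_simps)
  have alg2: "(1 + (x - y) / (2 * \<i>)) * v = v * 1 + (v * x - v * y) / (2 * \<i>)" for x y v :: complex
    by (simp add: field_simps)
  have k1: "integrable P (\<lambda>\<omega>. 1 *\<^sub>R f (\<xi> \<omega>)) \<and> (CLINT \<omega>|P. 1 *\<^sub>R f (\<xi> \<omega>)) = of_real 1 * e"
    by (rule key) (use ch'[of _ 0] in auto)
  have kc: "integrable P (\<lambda>\<omega>. (1 + cos (\<zeta> \<omega>)) *\<^sub>R f (\<xi> \<omega>)) \<and> (CLINT \<omega>|P. (1 + cos (\<zeta> \<omega>)) *\<^sub>R f (\<xi> \<omega>)) = of_real (1 + exp (- \<delta> / 2)) * e"
  proof (rule key)
    fix u
    have "(CLINT \<omega>|P. of_real (1 + cos (\<zeta> \<omega>)) * iexp (u * \<xi> \<omega>)) =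
      (CLINT \<omega>|P. iexp (u * \<xi> \<omega> + 0 * \<zeta> \<omega>) + (iexp (u * \<xi> \<omega> + 1 * \<zeta> \<omega>) + iexp (u * \<xi> \<omega> + (-1) * \<zeta> \<omega>)) / 2)"
      by (rule Bochner_Integration.integral_cong[OF refl], simp only: iexp_add)
         (simp only: of_real_add of_real_1 cos_eq_iexp alg1 mult_zero_left mult_1 mult_minus1 i0)
    also have "\<dots> = of_real (exp (- (u\<^sup>2 * a + 0\<^sup>2 * \<delta>) / 2)) + (of_real (exp (- (u\<^sup>2 * a + 1\<^sup>2 * \<delta>) / 2)) + of_real (exp (- (u\<^sup>2 * a + (-1)\<^sup>2 * \<delta>) / 2))) / 2"
      by (subst integral_add_half(1), (rule int, measurable)+) (simp only: ch')
    also have "\<dots> = of_real ((1 + exp (- \<delta> / 2)) * exp (- (u\<^sup>2 * a) / 2))"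
    proof -
      have *: "exp (- (u\<^sup>2 * a + \<delta>) / 2) = exp (- (u\<^sup>2 * a) / 2) * exp (- \<delta> / 2)"
        unfolding exp_add[symmetric] by (simp add: field_simps)
      have "(1 + exp (- \<delta> / 2)) * exp (- (u\<^sup>2 * a) / 2) =
        exp (- (u\<^sup>2 * a + 0\<^sup>2 * \<delta>) / 2) + (exp (- (u\<^sup>2 * a + 1\<^sup>2 * \<delta>) / 2) + exp (- (u\<^sup>2 * a + (-1)\<^sup>2 * \<delta>) / 2)) / 2"
        by (simp only: power_one power2_minus mult_1 * power_zero_numeral mult_zero_left add_0_right) (rule distrib_right[THEN trans], simp)
      then show ?thesis by (simp only: of_real_add of_real_divide of_real_numeral)
    qed
    finally show "(CLINT \<omega>|P. of_real (1 + cos (\<zeta> \<omega>)) * iexp (u * \<xi> \<omega>)) = of_real ((1 + exp (- \<delta> / 2)) * exp (- (u\<^sup>2 * a) / 2))" .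
  qed (simp_all only: one_plus_cos_sin_bounds, simp_all)
  have ks: "integrable P (\<lambda>\<omega>. (1 + sin (\<zeta> \<omega>)) *\<^sub>R f (\<xi> \<omega>)) \<and> (CLINT \<omega>|P. (1 + sin (\<zeta> \<omega>)) *\<^sub>R f (\<xi> \<omega>)) = of_real 1 * e"
  proof (rule key)
    fix u
    have "(CLINT \<omega>|P. of_real (1 + sin (\<zeta> \<omega>)) * iexp (u * \<xi> \<omega>)) =
      (CLINT \<omega>|P. iexp (u * \<xi> \<omega> + 0 * \<zeta> \<omega>) + (iexp (u * \<xi> \<omega> + 1 * \<zeta> \<omega>) - iexp (u * \<xi> \<omega> + (-1) * \<zeta> \<omega>)) / (2 * \<i>))"
      by (rule Bochner_Integration.integral_cong[OF refl], simp only: iexp_add)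
         (simp only: of_real_add of_real_1 sin_eq_iexp alg2 mult_zero_left mult_1 mult_minus1 i0)
    also have "\<dots> = of_real (exp (- (u\<^sup>2 * a + 0\<^sup>2 * \<delta>) / 2)) + (of_real (exp (- (u\<^sup>2 * a + 1\<^sup>2 * \<delta>) / 2)) - of_real (exp (- (u\<^sup>2 * a + (-1)\<^sup>2 * \<delta>) / 2))) / (2 * \<i>)"
      by (subst integral_add_half(2), (rule int, measurable)+) (simp only: ch')
    also have "\<dots> = of_real (1 * exp (- (u\<^sup>2 * a) / 2))"
      by simp
    finally show "(CLINT \<omega>|P. of_real (1 + sin (\<zeta> \<omega>)) * iexp (u * \<xi> \<omega>)) = of_real (1 * exp (- (u\<^sup>2 * a) / 2))" .
  qed (simp_all only: one_plus_cos_sin_bounds, simp_all)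
  \<comment> \<open>\<open>iexp (\<zeta> \<omega>)\<close> is rebuilt from the nonnegative weights
    \<open>1 + cos\<close>, \<open>1 + sin\<close> and \<open>1\<close>; the sine contributes 0
    because \<open>\<zeta>\<close> is symmetric.\<close>
  have "(CLINT \<omega>|P. of_real (exp (\<xi> \<omega> - a / 2)) * iexp (\<eta> \<omega>)) =
    (CLINT \<omega>|P. ((1 + cos (\<zeta> \<omega>)) *\<^sub>R f (\<xi> \<omega>) - 1 *\<^sub>R f (\<xi> \<omega>)) + \<i> * ((1 + sin (\<zeta> \<omega>)) *\<^sub>R f (\<xi> \<omega>) - 1 *\<^sub>R f (\<xi> \<omega>)))"
  proof (rule Bochner_Integration.integral_cong[OF refl])
    fix \<omega>
    have "iexp (\<eta> \<omega>) = iexp (\<alpha> * \<xi> \<omega>) * iexp (\<zeta> \<omega>)"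
      unfolding iexp_add[symmetric] by (simp add: \<zeta>_def)
    also have "iexp (\<zeta> \<omega>) = of_real (cos (\<zeta> \<omega>)) + \<i> * of_real (sin (\<zeta> \<omega>))"
      by (simp add: complex_eq_iff Re_exp Im_exp)
    finally show "of_real (exp (\<xi> \<omega> - a / 2)) * iexp (\<eta> \<omega>) = ((1 + cos (\<zeta> \<omega>)) *\<^sub>R f (\<xi> \<omega>) - 1 *\<^sub>R f (\<xi> \<omega>)) + \<i> * ((1 + sin (\<zeta> \<omega>)) *\<^sub>R f (\<xi> \<omega>) - 1 *\<^sub>R f (\<xi> \<omega>))"
      by (simp add: f_def scaleR_conv_of_real algebra_simps)
  qed
  also have "\<dots> = (of_real (1 + exp (- \<delta> / 2)) * e - of_real 1 * e) + \<i> * (of_real 1 * e - of_real 1 * e)"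
    by (subst Bochner_Integration.integral_add)
       (use k1 kc ks in \<open>simp_all only: Bochner_Integration.integrable_diff integrable_mult_right
          integral_mult_right_zero Bochner_Integration.integral_diff\<close>)
  also have "\<dots> = of_real (exp (- \<delta> / 2)) * e" by (simp add: algebra_simps)
  also have "\<dots> = exp (\<i> * of_real b - of_real (d / 2))"
  proof -
    have "- \<delta> / 2 = b\<^sup>2 / (2 * a) - d / 2" by (simp add: \<delta>_def diff_divide_distrib)
    then show ?thesis unfolding e_def by (simp add: exp_of_real[symmetric] exp_add[symmetric])
  qed
  finally show ?thesis .
qed

section \<open>Square-integrable functions and admissible shifts\<close>

text \<open>Genuine functions, not classes modulo null sets: random variables and kernels are also
  evaluated pointwise.\<close>

definition L2 :: "'a measure \<Rightarrow> ('a \<Rightarrow> real) set" where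
  "L2 M = {f \<in> borel_measurable M. integrable M (\<lambda>x. (f x)\<^sup>2)}"

lemma L2_measurable[measurable_dest]: "f \<in> L2 M \<Longrightarrow> f \<in> borel_measurable M"
  by (simp add: L2_def)

lemma L2_mult:
  assumes "f \<in> L2 M" "g \<in> L2 M"
  shows "integrable M (\<lambda>x. f x * g x)"
proof (rule Bochner_Integration.integrable_bound[of _ "\<lambda>x. (f x)\<^sup>2 + (g x)\<^sup>2"])
  show "AE x in M. norm (f x * g x) \<le> norm ((f x)\<^sup>2 + (g x)\<^sup>2)"
  proof (rule AE_I2)
    fix x
    have "2 * (\<bar>f x\<bar> * \<bar>g x\<bar>) \<le> (f x)\<^sup>2 + (g x)\<^sup>2"
      using sum_squares_bound[of "\<bar>f x\<bar>" "\<bar>g x\<bar>"] by simp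
    moreover have "0 \<le> \<bar>f x\<bar> * \<bar>g x\<bar>" by simp
    ultimately show "norm (f x * g x) \<le> norm ((f x)\<^sup>2 + (g x)\<^sup>2)"
      unfolding real_norm_def abs_mult by linarith
  qed
qed (use assms in \<open>auto simp: L2_def\<close>)

lemma L2_square: "f \<in> L2 M \<Longrightarrow> integrable M (\<lambda>x. (f x)\<^sup>2)"
  by (simp add: L2_def)

lemma L2_add:
  assumes "f \<in> L2 M" "g \<in> L2 M"
  shows "(\<lambda>x. f x + g x) \<in> L2 M"
  using assms L2_mult[OF assms] by (auto simp: L2_def power2_sum mult.assoc)

lemma L2_scale: "f \<in> L2 M \<Longrightarrow> (\<lambda>x. c * f x) \<in> L2 M"
  by (auto simp: L2_def power_mult_distrib)

lemma L2_diff: "f \<in> L2 M \<Longrightarrow> g \<in> L2 M \<Longrightarrow> (\<lambda>x. f x - g x) \<in> L2 M"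
  using L2_add[of f M "\<lambda>x. (-1) * g x"] L2_scale[of g M "-1"] by simp

lemma L2_zero: "(\<lambda>x. 0) \<in> L2 M"
  by (simp add: L2_def)

lemma L2_sum: "(\<And>i. i \<in> F \<Longrightarrow> f i \<in> L2 M) \<Longrightarrow> (\<lambda>x. \<Sum>i\<in>F. f i x) \<in> L2 M"
  by (induction F rule: infinite_finite_induct) (auto intro: L2_zero L2_add)

lemma L2_Cauchy_Schwarz:
  assumes f: "f \<in> L2 M" and g: "g \<in> L2 M"
  shows "(\<integral>x. f x * g x \<partial>M)\<^sup>2 \<le> (\<integral>x. (f x)\<^sup>2 \<partial>M) * (\<integral>x. (g x)\<^sup>2 \<partial>M)"
proof -
  define A B C where "A = (\<integral>x. (f x)\<^sup>2 \<partial>M)" and "B = (\<integral>x. f x * g x \<partial>M)" and "C = (\<integral>x. (g x)\<^sup>2 \<partial>M)"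
  have q: "0 \<le> A + 2 * u * B + u\<^sup>2 * C" for u
  proof -
    have "0 \<le> (\<integral>x. (f x + u * g x)\<^sup>2 \<partial>M)" by simp
    also have "\<dots> = (\<integral>x. (f x)\<^sup>2 + (2 * u) * (f x * g x) + u\<^sup>2 * (g x)\<^sup>2 \<partial>M)"
      by (rule Bochner_Integration.integral_cong) (auto simp: power2_eq_square algebra_simps)
    also have "\<dots> = A + 2 * u * B + u\<^sup>2 * C"
      using L2_mult[OF f g] L2_square[OF f] L2_square[OF g] by (simp add: A_def B_def C_def)
    finally show ?thesis .
  qed
  have "B\<^sup>2 \<le> A * C"
  proof (cases "C = 0")
    case True
    have "B = 0"
    proof (rule ccontr)
      assume "B \<noteq> 0"
      \<comment> \<open>For \<open>C = 0\<close> the quadratic is affine in \<open>u\<close>, and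
        this \<open>u\<close> would give it the value -1.\<close>
      with q[of "- (A + 1) / (2 * B)"] True show False by (simp add: field_simps)
    qed
    then show ?thesis using True by simp
  next
    case False
    then have "0 < C" by (simp add: C_def less_le)
    with q[of "- B / C"] show ?thesis by (simp add: field_simps power2_eq_square)
  qed
  then show ?thesis by (simp add: A_def B_def C_def)
qed

section \<open>Mean-square convergence, completeness and Riesz representation\<close>

lemma (in finite_measure) L2_integrable: "f \<in> L2 M \<Longrightarrow> integrable M f"
  using L2_mult[of f M "\<lambda>_. 1"] by (simp add: L2_def)

text \<open>Membership in \<open>L2\<close> is part of the notion, since the integral of a
  non-integrable square is 0 and would simulate convergence.\<close>

definition L2_tendsto :: "'a measure \<Rightarrow> (nat \<Rightarrow> 'a \<Rightarrow> real) \<Rightarrow> ('a \<Rightarrow> real) \<Rightarrow> bool" where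
  "L2_tendsto M Y \<xi> \<longleftrightarrow> (\<forall>n. Y n \<in> L2 M) \<and> \<xi> \<in> L2 M \<and> (\<lambda>n. \<integral>x. (Y n x - \<xi> x)\<^sup>2 \<partial>M) \<longlonglongrightarrow> 0"

lemma L2_tendsto_inner:
  assumes "L2_tendsto M Y \<xi>" and Z: "Z \<in> L2 M"
  shows "(\<lambda>n. \<integral>x. Y n x * Z x \<partial>M) \<longlonglongrightarrow> (\<integral>x. \<xi> x * Z x \<partial>M)"
proof -
  have Y: "Y n \<in> L2 M" and \<xi>: "\<xi> \<in> L2 M" and lim: "(\<lambda>n. \<integral>x. (Y n x - \<xi> x)\<^sup>2 \<partial>M) \<longlonglongrightarrow> 0" for n
    using assms by (auto simp: L2_tendsto_def)
  have "(\<lambda>n. \<integral>x. (Y n x - \<xi> x) * Z x \<partial>M) \<longlonglongrightarrow> 0"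
  proof (rule Lim_null_comparison)
    show "(\<lambda>n. sqrt ((\<integral>x. (Y n x - \<xi> x)\<^sup>2 \<partial>M) * (\<integral>x. (Z x)\<^sup>2 \<partial>M))) \<longlonglongrightarrow> 0"
      using tendsto_real_sqrt[OF tendsto_mult_left_zero[OF lim]] by simp
    show "\<forall>\<^sub>F n in sequentially. norm (\<integral>x. (Y n x - \<xi> x) * Z x \<partial>M) \<le> sqrt ((\<integral>x. (Y n x - \<xi> x)\<^sup>2 \<partial>M) * (\<integral>x. (Z x)\<^sup>2 \<partial>M))"
      using L2_Cauchy_Schwarz[OF L2_diff[OF Y \<xi>] Z] by (intro always_eventually allI real_le_rsqrt) simp
  qed
  then have "(\<lambda>n. (\<integral>x. (Y n x - \<xi> x) * Z x \<partial>M) + (\<integral>x. \<xi> x * Z x \<partial>M)) \<longlonglongrightarrow> 0 + (\<integral>x. \<xi> x * Z x \<partial>M)"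
    by (intro tendsto_intros)
  moreover have "(\<integral>x. (Y n x - \<xi> x) * Z x \<partial>M) + (\<integral>x. \<xi> x * Z x \<partial>M) = (\<integral>x. Y n x * Z x \<partial>M)" for n
    using L2_mult[OF Y Z] L2_mult[OF \<xi> Z] by (simp add: left_diff_distrib)
  ultimately show ?thesis by simp
qed

lemma L2_tendsto_square:
  assumes "L2_tendsto M Y \<xi>"
  shows "(\<lambda>n. \<integral>x. (Y n x)\<^sup>2 \<partial>M) \<longlonglongrightarrow> (\<integral>x. (\<xi> x)\<^sup>2 \<partial>M)"
proof -
  have Y: "Y n \<in> L2 M" and \<xi>: "\<xi> \<in> L2 M" and lim: "(\<lambda>n. \<integral>x. (Y n x - \<xi> x)\<^sup>2 \<partial>M) \<longlonglongrightarrow> 0" for n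
    using assms by (auto simp: L2_tendsto_def)
  have "(\<lambda>n. (\<integral>x. (Y n x - \<xi> x)\<^sup>2 \<partial>M) + 2 * (\<integral>x. Y n x * \<xi> x \<partial>M) - (\<integral>x. (\<xi> x)\<^sup>2 \<partial>M)) \<longlonglongrightarrow>
      0 + 2 * (\<integral>x. \<xi> x * \<xi> x \<partial>M) - (\<integral>x. (\<xi> x)\<^sup>2 \<partial>M)"
    by (intro tendsto_intros lim L2_tendsto_inner[OF assms \<xi>])
  moreover have "(\<integral>x. (Y n x - \<xi> x)\<^sup>2 \<partial>M) + 2 * (\<integral>x. Y n x * \<xi> x \<partial>M) - (\<integral>x. (\<xi> x)\<^sup>2 \<partial>M) = (\<integral>x. (Y n x)\<^sup>2 \<partial>M)" for n
  proof -
    have "(\<integral>x. (Y n x)\<^sup>2 \<partial>M) = (\<integral>x. (Y n x - \<xi> x)\<^sup>2 + 2 * (Y n x * \<xi> x) - (\<xi> x)\<^sup>2 \<partial>M)"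
      by (rule Bochner_Integration.integral_cong) (auto simp: power2_eq_square algebra_simps)
    also have "\<dots> = (\<integral>x. (Y n x - \<xi> x)\<^sup>2 \<partial>M) + 2 * (\<integral>x. Y n x * \<xi> x \<partial>M) - (\<integral>x. (\<xi> x)\<^sup>2 \<partial>M)"
      using L2_square[OF L2_diff[OF Y \<xi>], of n] L2_square[OF \<xi>] L2_mult[OF Y \<xi>, of n] by simp
    finally show ?thesis by simp
  qed
  ultimately show ?thesis by (simp add: power2_eq_square)
qed

lemma L2_tendsto_affine:
  assumes "L2_tendsto M Y \<xi>" and Z: "Z \<in> L2 M"
  shows "L2_tendsto M (\<lambda>n x. u * Y n x + Z x) (\<lambda>x. u * \<xi> x + Z x)"
proof -
  have Y: "Y n \<in> L2 M" and \<xi>: "\<xi> \<in> L2 M" and lim: "(\<lambda>n. \<integral>x. (Y n x - \<xi> x)\<^sup>2 \<partial>M) \<longlonglongrightarrow> 0" for n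
    using assms by (auto simp: L2_tendsto_def)
  have "(u * Y n x + Z x - (u * \<xi> x + Z x))\<^sup>2 = u\<^sup>2 * (Y n x - \<xi> x)\<^sup>2" for n x
    by (simp add: power2_eq_square algebra_simps)
  then show ?thesis
    unfolding L2_tendsto_def using Y \<xi> Z tendsto_mult_right_zero[OF lim, of "u\<^sup>2"]
    by (auto intro!: L2_add L2_scale)
qed

text \<open>The map x to exp(ix) is 1-Lipschitz, and on a probability space the L1 norm is at most
  the L2 norm. This carries Gaussian characteristic functions over to mean-square limits.\<close>

lemma (in prob_space) L2_tendsto_iexp:
  assumes "L2_tendsto M Y \<xi>"
  shows "(\<lambda>n. CLINT x|M. iexp (Y n x)) \<longlonglongrightarrow> (CLINT x|M. iexp (\<xi> x))"
proof -
  have Y[measurable]: "Y n \<in> L2 M" and \<xi>[measurable]: "\<xi> \<in> L2 M" and lim: "(\<lambda>n. \<integral>x. (Y n x - \<xi> x)\<^sup>2 \<partial>M) \<longlonglongrightarrow> 0" for n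
    using assms by (auto simp: L2_tendsto_def)
  have int: "integrable M (\<lambda>\<omega>. iexp (Z \<omega>))" if [measurable]: "Z \<in> borel_measurable M" for Z
    by (rule integrable_const_bound[where B=1]) auto
  have b: "cmod ((CLINT x|M. iexp (Y n x)) - (CLINT x|M. iexp (\<xi> x))) \<le> sqrt (\<integral>x. (Y n x - \<xi> x)\<^sup>2 \<partial>M)" for n
  proof -
    have d: "(\<lambda>x. Y n x - \<xi> x) \<in> L2 M" by (intro L2_diff Y \<xi>)
    then have d': "(\<lambda>x. \<bar>Y n x - \<xi> x\<bar>) \<in> L2 M" by (auto simp: L2_def)
    have "(CLINT x|M. iexp (Y n x)) - (CLINT x|M. iexp (\<xi> x)) = (CLINT x|M. iexp (Y n x) - iexp (\<xi> x))"
      by (subst Bochner_Integration.integral_diff) (auto intro!: int)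
    then have "cmod ((CLINT x|M. iexp (Y n x)) - (CLINT x|M. iexp (\<xi> x))) \<le> (\<integral>x. cmod (iexp (Y n x) - iexp (\<xi> x)) \<partial>M)"
      by simp
    also have "\<dots> \<le> (\<integral>x. \<bar>Y n x - \<xi> x\<bar> \<partial>M)"
    proof (rule integral_mono)
      show "integrable M (\<lambda>x. cmod (iexp (Y n x) - iexp (\<xi> x)))"
        by (intro integrable_norm Bochner_Integration.integrable_diff int) auto
      show "integrable M (\<lambda>x. \<bar>Y n x - \<xi> x\<bar>)"
        using L2_integrable[OF d] by simp
      fix x
      have "iexp (Y n x) - iexp (\<xi> x) = iexp (\<xi> x) * (iexp (Y n x - \<xi> x) - 1)"
        by (simp add: algebra_simps exp_add[symmetric])
      then have "cmod (iexp (Y n x) - iexp (\<xi> x)) = cmod (iexp (Y n x - \<xi> x) - 1)"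
        by (simp add: norm_mult)
      also have "\<dots> \<le> \<bar>Y n x - \<xi> x\<bar>"
        using iexp_approx1[of "Y n x - \<xi> x" 0] by simp
      finally show "cmod (iexp (Y n x) - iexp (\<xi> x)) \<le> \<bar>Y n x - \<xi> x\<bar>" .
    qed
    also have "\<dots> \<le> sqrt (\<integral>x. (Y n x - \<xi> x)\<^sup>2 \<partial>M)"
      using L2_Cauchy_Schwarz[OF d', of "\<lambda>_. 1"] by (intro real_le_rsqrt) (simp add: L2_def prob_space)
    finally show ?thesis .
  qed
  have "(\<lambda>n. sqrt (\<integral>x. (Y n x - \<xi> x)\<^sup>2 \<partial>M)) \<longlonglongrightarrow> 0"
    using tendsto_real_sqrt[OF lim] by simp
  then have "(\<lambda>n. (CLINT x|M. iexp (Y n x)) - (CLINT x|M. iexp (\<xi> x))) \<longlonglongrightarrow> 0"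
    by (rule Lim_null_comparison[rotated]) (use b in simp)
  then show ?thesis by (rule LIM_zero_cancel)
qed

text \<open>For a finite measure an L2-Cauchy sequence is L1-Cauchy, hence converges almost
  everywhere along a subsequence. Fatou's lemma along that subsequence bounds the L2 distance of the
  whole sequence to the limit.\<close>

lemma (in finite_measure) L2_complete:
  fixes Y :: "nat \<Rightarrow> 'a \<Rightarrow> real"
  assumes Y: "\<And>n. Y n \<in> L2 M"
    and C: "\<And>e. 0 < e \<Longrightarrow> \<exists>N. \<forall>m\<ge>N. \<forall>n\<ge>N. (\<integral>x. (Y m x - Y n x)\<^sup>2 \<partial>M) < e"
  obtains \<xi> where "L2_tendsto M Y \<xi>"
proof -
  have [measurable]: "Y n \<in> borel_measurable M" for n using Y by (rule L2_measurable)
  define K where "K = measure M (space M)"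
  have K: "0 \<le> K" by (simp add: K_def)
  obtain r where r: "strict_mono r" and ae: "AE x in M. Cauchy (\<lambda>i. Y (r i) x)"
  proof (rule cauchy_L1_AE_cauchy_subseq)
    show "integrable M (Y n)" for n by (rule L2_integrable[OF Y])
    fix e :: real assume e: "0 < e"
    then have "0 < e\<^sup>2 / (K + 1)" using K by simp
    from C[OF this] obtain N where N: "\<And>m n. m \<ge> N \<Longrightarrow> n \<ge> N \<Longrightarrow> (\<integral>x. (Y m x - Y n x)\<^sup>2 \<partial>M) < e\<^sup>2 / (K + 1)" by blast
    have "(\<integral>x. norm (Y m x - Y n x) \<partial>M) < e" if "m \<ge> N" "n \<ge> N" for m n
    proof -
      have "(\<lambda>x. \<bar>Y m x - Y n x\<bar>) \<in> L2 M" using L2_diff[OF Y Y, of m n] by (auto simp: L2_def)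
      from L2_Cauchy_Schwarz[OF this, of "\<lambda>_. 1"]
      have "(\<integral>x. \<bar>Y m x - Y n x\<bar> \<partial>M)\<^sup>2 \<le> (\<integral>x. (Y m x - Y n x)\<^sup>2 \<partial>M) * K"
        by (simp add: L2_def K_def)
      also have "\<dots> \<le> e\<^sup>2 / (K + 1) * K"
        using N[OF that] K by (intro mult_right_mono) auto
      also have "\<dots> < e\<^sup>2" using K e by (simp add: field_simps)
      finally show ?thesis using e by (simp add: power_less_imp_less_base)
    qed
    then show "\<exists>N. \<forall>i\<ge>N. \<forall>j\<ge>N. (LINT x|M. norm (Y i x - Y j x)) < e" by blast
  qed auto
  define \<xi> where "\<xi> x = lim (\<lambda>i. Y (r i) x)" for x
  have m\<xi>[measurable]: "\<xi> \<in> borel_measurable M" unfolding \<xi>_def by measurable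
  have lim: "AE x in M. (\<lambda>i. Y (r i) x) \<longlonglongrightarrow> \<xi> x"
    using ae by eventually_elim (auto simp: \<xi>_def Cauchy_convergent_iff convergent_LIMSEQ_iff)
  have fatou: "integrable M (\<lambda>x. (Y n x - \<xi> x)\<^sup>2) \<and> (\<integral>x. (Y n x - \<xi> x)\<^sup>2 \<partial>M) \<le> e"
    if e: "0 < e" and N: "\<And>m. m \<ge> N \<Longrightarrow> (\<integral>x. (Y n x - Y m x)\<^sup>2 \<partial>M) < e" for e n N
  proof -
    have "(\<integral>\<^sup>+x. ennreal ((Y n x - \<xi> x)\<^sup>2) \<partial>M) = (\<integral>\<^sup>+x. liminf (\<lambda>i. ennreal ((Y n x - Y (r i) x)\<^sup>2)) \<partial>M)"
    proof (rule nn_integral_cong_AE)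
      show "AE x in M. ennreal ((Y n x - \<xi> x)\<^sup>2) = liminf (\<lambda>i. ennreal ((Y n x - Y (r i) x)\<^sup>2))"
        using lim
      proof eventually_elim
        case (elim x)
        have "(\<lambda>i. ennreal ((Y n x - Y (r i) x)\<^sup>2)) \<longlonglongrightarrow> ennreal ((Y n x - \<xi> x)\<^sup>2)"
          by (intro tendsto_ennrealI tendsto_intros elim)
        from lim_imp_Liminf[OF _ this] show ?case by simp
      qed
    qed
    also have "\<dots> \<le> liminf (\<lambda>i. \<integral>\<^sup>+x. ennreal ((Y n x - Y (r i) x)\<^sup>2) \<partial>M)"
      by (rule nn_integral_liminf) measurable
    also have "\<dots> \<le> ennreal e"
    proof (rule Liminf_le, simp)
      have "(\<integral>\<^sup>+x. ennreal ((Y n x - Y (r i) x)\<^sup>2) \<partial>M) \<le> ennreal e" if "i \<ge> N" for i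
      proof -
        have "r i \<ge> N" using that seq_suble[OF r, of i] by simp
        from N[OF this] show ?thesis
          using L2_square[OF L2_diff[OF Y Y, of n "r i"]]
          by (subst nn_integral_eq_integral) (auto intro!: ennreal_leI)
      qed
      then show "\<forall>\<^sub>F i in sequentially. (\<integral>\<^sup>+x. ennreal ((Y n x - Y (r i) x)\<^sup>2) \<partial>M) \<le> ennreal e"
        by (auto simp: eventually_sequentially)
    qed
    finally have le: "(\<integral>\<^sup>+x. ennreal ((Y n x - \<xi> x)\<^sup>2) \<partial>M) \<le> ennreal e" .
    have i: "integrable M (\<lambda>x. (Y n x - \<xi> x)\<^sup>2)"
      by (rule integrableI_bounded) (use le in \<open>auto intro: le_less_trans\<close>)
    then have "ennreal (\<integral>x. (Y n x - \<xi> x)\<^sup>2 \<partial>M) \<le> ennreal e"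
      using le by (subst (asm) nn_integral_eq_integral) auto
    then show ?thesis using i e by (simp add: ennreal_le_iff)
  qed
  obtain N1 where N1: "\<And>m n. m \<ge> N1 \<Longrightarrow> n \<ge> N1 \<Longrightarrow> (\<integral>x. (Y m x - Y n x)\<^sup>2 \<partial>M) < 1"
    using C[of 1] by auto
  have "(\<lambda>x. Y N1 x - \<xi> x) \<in> L2 M"
    using fatou[of 1 N1 N1] N1 by (auto simp: L2_def)
  from L2_diff[OF Y this, of N1] have \<xi>: "\<xi> \<in> L2 M" by simp
  have "(\<lambda>n. \<integral>x. (Y n x - \<xi> x)\<^sup>2 \<partial>M) \<longlonglongrightarrow> 0"
  proof (rule LIMSEQ_I)
    fix e :: real assume e: "0 < e"
    then obtain N where N: "\<And>m n. m \<ge> N \<Longrightarrow> n \<ge> N \<Longrightarrow> (\<integral>x. (Y m x - Y n x)\<^sup>2 \<partial>M) < e / 2"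
      using C[of "e / 2"] by auto
    have "norm ((\<integral>x. (Y n x - \<xi> x)\<^sup>2 \<partial>M) - 0) < e" if "n \<ge> N" for n
      using fatou[of "e / 2" N n] N that e by auto
    then show "\<exists>N. \<forall>n\<ge>N. norm ((\<integral>x. (Y n x - \<xi> x)\<^sup>2 \<partial>M) - 0) < e" by blast
  qed
  then show ?thesis using that Y \<xi> by (auto simp: L2_tendsto_def)
qed

text \<open>Riesz representation on a subspace \<open>V\<close> given by the graph of a bounded functional; the
  representer is the limit of a minimising sequence of \<open>\<parallel>Y\<parallel>\<^sup>2 - 2 l\<close>.\<close>

lemma (in finite_measure) L2_riesz:
  fixes V :: "(('a \<Rightarrow> real) \<times> real) set"
  assumes V0: "(\<lambda>_. 0, 0) \<in> V"
    and Vlin: "\<And>Y k Z l a b. (Y, k) \<in> V \<Longrightarrow> (Z, l) \<in> V \<Longrightarrow> (\<lambda>x. a * Y x + b * Z x, a * k + b * l) \<in> V"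
    and V2: "\<And>Y k. (Y, k) \<in> V \<Longrightarrow> Y \<in> L2 M"
    and Vb: "\<And>Y k. (Y, k) \<in> V \<Longrightarrow> k\<^sup>2 \<le> C * (\<integral>x. (Y x)\<^sup>2 \<partial>M)"
    and C: "0 \<le> C"
  obtains Y \<xi> where "\<And>n. Y n \<in> fst ` V" "L2_tendsto M Y \<xi>" "\<And>Z l. (Z, l) \<in> V \<Longrightarrow> (\<integral>x. \<xi> x * Z x \<partial>M) = l"
proof -
  define J where "J p = (\<integral>x. (fst p x)\<^sup>2 \<partial>M) - 2 * snd p" for p :: "('a \<Rightarrow> real) \<times> real"
  \<comment> \<open>The bound on the functional and 4 C N <= (C + N)^2 give 2 k <= C + N, so
    \<open>J\<close> is bounded below.\<close>
  have Jlow: "- C \<le> J p" if "p \<in> V" for p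
  proof -
    obtain Y k where p: "p = (Y, k)" by force
    define N where "N = (\<integral>x. (Y x)\<^sup>2 \<partial>M)"
    have N: "0 \<le> N" by (simp add: N_def)
    have "k\<^sup>2 \<le> C * N" using Vb that by (simp add: p N_def)
    moreover have "4 * (C * N) \<le> (C + N)\<^sup>2" using sum_squares_bound[of C N] by (simp add: power2_sum)
    ultimately have "(2 * k)\<^sup>2 \<le> (C + N)\<^sup>2" by (simp add: power_mult_distrib)
    then have "2 * k \<le> C + N" by (rule power2_le_imp_le) (use C N in simp)
    then show ?thesis by (simp add: J_def p N_def)
  qed
  define S where "S = Inf (J ` V)"
  have bdd: "bdd_below (J ` V)" using Jlow by (auto intro!: bdd_belowI[of _ "-C"])
  have S: "S \<le> J p" if "p \<in> V" for p
    unfolding S_def using that bdd by (auto intro: cInf_lower)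
  have "\<exists>p\<in>V. J p < S + 1 / Suc n" for n
  proof -
    have "Inf (J ` V) < S + 1 / Suc n" by (simp add: S_def)
    then show ?thesis using bdd V0 by (subst (asm) cInf_less_iff) auto
  qed
  then obtain p where pV: "\<And>n. p n \<in> V" and pJ: "\<And>n. J (p n) < S + 1 / Suc n" by metis
  define Y where "Y n = fst (p n)" for n
  define k where "k n = snd (p n)" for n
  have YV: "(Y n, k n) \<in> V" for n using pV[of n] by (simp add: Y_def k_def)
  have Y2: "Y n \<in> L2 M" for n using V2[OF YV] .
  have JY: "J (p n) = (\<integral>x. (Y n x)\<^sup>2 \<partial>M) - 2 * k n" for n by (simp add: J_def Y_def k_def)
  have pJ': "J (p n) - S \<le> 1 / Suc n" for n using less_imp_le[OF pJ[of n]] by (simp only: diff_le_eq add.commute)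
  \<comment> \<open>The parallelogram identity at the midpoint of two near-minimisers.\<close>
  have par: "(\<integral>x. (Y m x - Y n x)\<^sup>2 \<partial>M) \<le> 2 / Suc m + 2 / Suc n" for m n
  proof -
    have "S \<le> J (\<lambda>x. (1/2) * Y m x + (1/2) * Y n x, (1/2) * k m + (1/2) * k n)"
      by (rule S[OF Vlin[OF YV YV]])
    also have "\<dots> = (\<integral>x. (1/2) * (Y m x)\<^sup>2 + (1/2) * (Y n x)\<^sup>2 - (1/4) * (Y m x - Y n x)\<^sup>2 \<partial>M) - k m - k n"
      unfolding J_def fst_conv snd_conv
      by (simp, rule Bochner_Integration.integral_cong) (auto simp: power2_eq_square field_simps)
    also have "\<dots> = (1/2) * J (p m) + (1/2) * J (p n) - (1/4) * (\<integral>x. (Y m x - Y n x)\<^sup>2 \<partial>M)"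
      using L2_square[OF Y2, of m] L2_square[OF Y2, of n] L2_square[OF L2_diff[OF Y2 Y2], of m n]
      by (simp add: JY field_simps)
    finally have "(\<integral>x. (Y m x - Y n x)\<^sup>2 \<partial>M) \<le> 2 * (J (p m) - S) + 2 * (J (p n) - S)" by simp
    also have "\<dots> \<le> 2 * (1 / Suc m) + 2 * (1 / Suc n)" by (intro add_mono mult_left_mono pJ') auto
    finally show ?thesis by simp
  qed
  obtain \<xi> where \<xi>: "L2_tendsto M Y \<xi>"
  proof (rule L2_complete[OF Y2])
    fix e :: real assume e: "0 < e"
    obtain N where N: "4 / e < real N" using reals_Archimedean2 by blast
    have "(\<integral>x. (Y m x - Y n x)\<^sup>2 \<partial>M) < e" if "m \<ge> N" "n \<ge> N" for m n
    proof -
      have "4 / e < Suc m" "4 / e < Suc n" using that N by auto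
      then have "2 / Suc m < e / 2" "2 / Suc n < e / 2" using e by (auto simp: field_simps)
      then show ?thesis using par[of m n] by linarith
    qed
    then show "\<exists>N. \<forall>m\<ge>N. \<forall>n\<ge>N. (\<integral>x. (Y m x - Y n x)\<^sup>2 \<partial>M) < e" by blast
  qed
  have "(\<integral>x. \<xi> x * Z x \<partial>M) = l" if ZV: "(Z, l) \<in> V" for Z l
  proof -
    have Z2: "Z \<in> L2 M" by (rule V2[OF ZV])
    define A where "A = (\<integral>x. \<xi> x * Z x \<partial>M) - l"
    define B where "B = (\<integral>x. (Z x)\<^sup>2 \<partial>M)"
    have B: "0 \<le> B" by (simp add: B_def)
    \<comment> \<open>First variation: a move by \<open>e * Z\<close> from a near-minimiser lowers
      \<open>J\<close> by at most the slack \<open>1 / Suc n\<close>, which vanishes in the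
      limit.\<close>
    have var: "0 \<le> 2 * e * A + e\<^sup>2 * B" for e
    proof (rule LIMSEQ_le_const)
      show "(\<lambda>n. 1 / Suc n + 2 * e * ((\<integral>x. Y n x * Z x \<partial>M) - l) + e\<^sup>2 * B) \<longlonglongrightarrow> 2 * e * A + e\<^sup>2 * B"
        unfolding A_def
        using tendsto_add[OF tendsto_add[OF LIMSEQ_inverse_real_of_nat tendsto_mult[OF tendsto_const tendsto_diff[OF L2_tendsto_inner[OF \<xi> Z2] tendsto_const]]] tendsto_const, of "2 * e" l "e\<^sup>2 * B"]
        by (simp add: inverse_eq_divide)
      have "0 \<le> 1 / Suc n + 2 * e * ((\<integral>x. Y n x * Z x \<partial>M) - l) + e\<^sup>2 * B" for n
      proof -
        have "S \<le> J (\<lambda>x. 1 * Y n x + e * Z x, 1 * k n + e * l)"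
          by (rule S[OF Vlin[OF YV ZV]])
        also have "\<dots> = (\<integral>x. (Y n x)\<^sup>2 + 2 * e * (Y n x * Z x) + e\<^sup>2 * (Z x)\<^sup>2 \<partial>M) - 2 * (k n + e * l)"
          unfolding J_def fst_conv snd_conv
          by (simp, rule Bochner_Integration.integral_cong) (auto simp: power2_eq_square algebra_simps)
        also have "\<dots> = J (p n) + 2 * e * ((\<integral>x. Y n x * Z x \<partial>M) - l) + e\<^sup>2 * B"
          using L2_square[OF Y2, of n] L2_mult[OF Y2 Z2, of n] L2_square[OF Z2]
          by (simp add: JY B_def) (simp add: algebra_simps)
        finally show ?thesis using pJ[of n] by simp
      qed
      then show "\<exists>N. \<forall>n\<ge>N. 0 \<le> 1 / Suc n + 2 * e * ((\<integral>x. Y n x * Z x \<partial>M) - l) + e\<^sup>2 * B" by blast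
    qed
    have "A = 0"
    proof (rule ccontr)
      assume "A \<noteq> 0"
      \<comment> \<open>The step \<open>e = - A / D\<close> makes the variation negative;
        \<open>D\<close> replaces \<open>B\<close>, which may be 0.\<close>
      define D where "D = B + 1"
      have D: "0 < D" "B = D - 1" using B by (auto simp: D_def)
      have "0 \<le> 2 * (- A / D) * A + (- A / D)\<^sup>2 * B" by (rule var)
      also have "\<dots> = - (A\<^sup>2 * (D + 1)) / D\<^sup>2"
        unfolding D(2) using D(1) by (simp add: power2_eq_square field_simps)
      also have "\<dots> < 0" using D(1) \<open>A \<noteq> 0\<close> by (simp add: divide_neg_pos)
      finally show False by simp
    qed
    then show ?thesis by (simp add: A_def)
  qed
  moreover have "Y n \<in> fst ` V" for n using YV by force
  ultimately show ?thesis using that \<xi> by blast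
qed

text \<open>\<open>Q\<close> is not tied to a Gaussian density, so the notion passes from M to U by
  taking images of laws. Absolute continuity ensures that a \<open>P\<close>-null event cannot
  receive mass from the shifted law.\<close>

definition admissible_shift :: "'a measure \<Rightarrow> 'i set \<Rightarrow> ('i \<Rightarrow> 'a \<Rightarrow> real) \<Rightarrow> ('i \<Rightarrow> real) \<Rightarrow> bool" where
  "admissible_shift P I X h \<longleftrightarrow>
     (\<exists>Q. prob_space Q \<and> sets Q = sets P \<and> absolutely_continuous P Q \<and>
        distr Q (PiM I (\<lambda>_. borel)) (\<lambda>\<omega>. \<lambda>i\<in>I. X i \<omega> - h i) = distr P (PiM I (\<lambda>_. borel)) (\<lambda>\<omega>. \<lambda>i\<in>I. X i \<omega>))"

text \<open>The hypothesis on \<open>h\<close> says that \<open>h\<close> lies in the reproducing kernel Hilbert space of \<open>M\<close>.\<close>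

lemma gaussian_admissible_shift:
  fixes M :: "'i \<Rightarrow> 'a \<Rightarrow> real"
  assumes P: "prob_space P"
    and M2: "\<And>i. M i \<in> L2 P"
    and ch: "\<And>F c. finite F \<Longrightarrow> (CLINT \<omega>|P. iexp (\<Sum>i\<in>F. c i * M i \<omega>)) = of_real (exp (- (\<integral>\<omega>. (\<Sum>i\<in>F. c i * M i \<omega>)\<^sup>2 \<partial>P) / 2))"
    and hb: "\<And>F c. finite F \<Longrightarrow> (\<Sum>i\<in>F. c i * h i)\<^sup>2 \<le> C * (\<integral>\<omega>. (\<Sum>i\<in>F. c i * M i \<omega>)\<^sup>2 \<partial>P)"
    and C: "0 \<le> C"
  shows "admissible_shift P I M h"
proof -
  interpret P: prob_space P by fact
  have [measurable]: "M i \<in> borel_measurable P" for i using M2 by (rule L2_measurable)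
  define X where "X F c \<omega> = (\<Sum>i\<in>F. c i * M i \<omega>)" for F c \<omega>
  define V where "V = {(X F c, \<Sum>i\<in>F. c i * h i) | F c. finite F}"
  have X2: "X F c \<in> L2 P" for F c
    unfolding X_def by (intro L2_sum L2_scale M2)
  note [measurable] = X2[THEN L2_measurable]
  have merge: "a * (\<Sum>i\<in>F. c i * z i) + b * (\<Sum>i\<in>G. d i * z i) =
    (\<Sum>i\<in>F \<union> G. (a * (if i \<in> F then c i else 0) + b * (if i \<in> G then d i else 0)) * z i)"
    if "finite F" "finite G" for a b c d F G and z :: "'i \<Rightarrow> real"
  proof -
    have "(\<Sum>i\<in>F. c i * z i) = (\<Sum>i\<in>F \<union> G. (if i \<in> F then c i else 0) * z i)"
      using that by (intro sum.mono_neutral_cong_left) auto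
    moreover have "(\<Sum>i\<in>G. d i * z i) = (\<Sum>i\<in>F \<union> G. (if i \<in> G then d i else 0) * z i)"
      using that by (intro sum.mono_neutral_cong_left) auto
    ultimately show ?thesis
      by (simp only: sum_distrib_left sum.distrib[symmetric]) (simp add: algebra_simps)
  qed
  obtain Y \<xi> where YV: "\<And>n. Y n \<in> fst ` V" and Y\<xi>: "L2_tendsto P Y \<xi>"
    and rep: "\<And>Z l. (Z, l) \<in> V \<Longrightarrow> (\<integral>x. \<xi> x * Z x \<partial>P) = l"
  proof (rule P.L2_riesz[of V C])
    show "(\<lambda>_. 0, 0) \<in> V"
      unfolding V_def by (auto intro!: exI[of _ "{}"] simp: X_def fun_eq_iff)
    show "(\<lambda>x. a * Y x + b * Z x, a * k + b * l) \<in> V" if YZ: "(Y, k) \<in> V" "(Z, l) \<in> V" for Y k Z l a b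
    proof -
      obtain F c G d where "finite F" "finite G" "Y = X F c" "k = (\<Sum>i\<in>F. c i * h i)" "Z = X G d" "l = (\<Sum>i\<in>G. d i * h i)"
        using YZ unfolding V_def by auto
      then show ?thesis
        unfolding V_def by (auto simp: merge X_def[abs_def])
    qed
    show "Y \<in> L2 P" if "(Y, k) \<in> V" for Y k using that X2 by (auto simp: V_def)
    show "k\<^sup>2 \<le> C * (\<integral>x. (Y x)\<^sup>2 \<partial>P)" if "(Y, k) \<in> V" for Y k
      using that hb by (auto simp: V_def X_def)
  qed (use C in auto)
  have \<xi>2: "\<xi> \<in> L2 P" using Y\<xi> by (simp add: L2_tendsto_def)
  note [measurable] = \<xi>2[THEN L2_measurable]
  have repX: "(\<integral>x. \<xi> x * X F c x \<partial>P) = (\<Sum>i\<in>F. c i * h i)" if "finite F" for F c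
    by (rule rep) (use that in \<open>auto simp: V_def\<close>)
  \<comment> \<open>Adjoining \<open>\<xi>\<close> keeps the family jointly Gaussian: it is a
    mean-square limit of the linear combinations \<open>Y n\<close>, and both sides of the formula
    pass to the limit.\<close>
  have gauss: "(CLINT \<omega>|P. iexp (u * \<xi> \<omega> + X F c \<omega>)) = of_real (exp (- (\<integral>\<omega>. (u * \<xi> \<omega> + X F c \<omega>)\<^sup>2 \<partial>P) / 2))"
    if F: "finite F" for u F c
  proof (rule LIMSEQ_unique)
    have lim: "L2_tendsto P (\<lambda>n x. u * Y n x + X F c x) (\<lambda>x. u * \<xi> x + X F c x)"
      by (rule L2_tendsto_affine[OF Y\<xi> X2])
    show "(\<lambda>n. CLINT \<omega>|P. iexp (u * Y n \<omega> + X F c \<omega>)) \<longlonglongrightarrow> (CLINT \<omega>|P. iexp (u * \<xi> \<omega> + X F c \<omega>))"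
      by (rule P.L2_tendsto_iexp[OF lim])
    have "(CLINT \<omega>|P. iexp (u * Y n \<omega> + X F c \<omega>)) = of_real (exp (- (\<integral>\<omega>. (u * Y n \<omega> + X F c \<omega>)\<^sup>2 \<partial>P) / 2))" for n
    proof -
      obtain G d where G: "finite G" "Y n = X G d" using YV[of n] by (auto simp: V_def)
      have *: "u * Y n \<omega> + X F c \<omega> = (\<Sum>i\<in>G \<union> F. (u * (if i \<in> G then d i else 0) + 1 * (if i \<in> F then c i else 0)) * M i \<omega>)" for \<omega>
        using merge[OF G(1) F, of u d "\<lambda>i. M i \<omega>" 1 c] by (simp add: G(2) X_def)
      show ?thesis unfolding * by (rule ch) (use G F in auto)
    qed
    moreover have "(\<lambda>n. complex_of_real (exp (- (\<integral>\<omega>. (u * Y n \<omega> + X F c \<omega>)\<^sup>2 \<partial>P) / 2))) \<longlonglongrightarrow> of_real (exp (- (\<integral>\<omega>. (u * \<xi> \<omega> + X F c \<omega>)\<^sup>2 \<partial>P) / 2))"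
      by (intro tendsto_intros L2_tendsto_square[OF lim]) auto
    ultimately show "(\<lambda>n. CLINT \<omega>|P. iexp (u * Y n \<omega> + X F c \<omega>)) \<longlonglongrightarrow> of_real (exp (- (\<integral>\<omega>. (u * \<xi> \<omega> + X F c \<omega>)\<^sup>2 \<partial>P) / 2))" by simp
  qed
  \<comment> \<open>If this variance is 0, Cauchy--Schwarz forces \<open>h\<close> to be 0 and
    \<open>Q = P\<close> will do. The tilting formula needs it to be positive.\<close>
  define a where "a = (\<integral>\<omega>. (\<xi> \<omega>)\<^sup>2 \<partial>P)"
  have a0: "0 \<le> a" by (simp add: a_def)
  show ?thesis
  proof (cases "a = 0")
    case True
    have "h i = 0" for i
    proof -
      have "(\<integral>x. \<xi> x * X {i} (\<lambda>_. 1) x \<partial>P)\<^sup>2 \<le> a * (\<integral>x. (X {i} (\<lambda>_. 1) x)\<^sup>2 \<partial>P)"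
        unfolding a_def by (rule L2_Cauchy_Schwarz[OF \<xi>2 X2])
      then show ?thesis unfolding repX[of "{i}" "\<lambda>_. 1", simplified] by (simp add: True)
    qed
    then show ?thesis
      unfolding admissible_shift_def by (intro exI[of _ P]) (simp add: P absolutely_continuous_def)
  next
    case False
    with a0 have a: "0 < a" by simp
    have cm: "(CLINT \<omega>|P. of_real (exp (\<xi> \<omega> - a / 2)) * iexp (X F c \<omega>)) =
        exp (\<i> * of_real (\<Sum>i\<in>F. c i * h i) - of_real ((\<integral>\<omega>. (X F c \<omega>)\<^sup>2 \<partial>P) / 2))" if F: "finite F" for F c
    proof (rule cameron_martin_char[OF P _ _ a])
      fix u v
      have vX: "v * X F c \<omega> = X F (\<lambda>i. v * c i) \<omega>" for \<omega>
        by (simp add: X_def sum_distrib_left mult.assoc)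
      have "(CLINT \<omega>|P. iexp (u * \<xi> \<omega> + v * X F c \<omega>)) = of_real (exp (- (\<integral>\<omega>. (u * \<xi> \<omega> + v * X F c \<omega>)\<^sup>2 \<partial>P) / 2))"
        unfolding vX by (rule gauss[OF F])
      also have "(\<integral>\<omega>. (u * \<xi> \<omega> + v * X F c \<omega>)\<^sup>2 \<partial>P) = (\<integral>\<omega>. u\<^sup>2 * (\<xi> \<omega>)\<^sup>2 + 2 * u * v * (\<xi> \<omega> * X F c \<omega>) + v\<^sup>2 * (X F c \<omega>)\<^sup>2 \<partial>P)"
        by (rule Bochner_Integration.integral_cong) (auto simp: power2_eq_square algebra_simps)
      also have "\<dots> = u\<^sup>2 * a + 2 * u * v * (\<Sum>i\<in>F. c i * h i) + v\<^sup>2 * (\<integral>\<omega>. (X F c \<omega>)\<^sup>2 \<partial>P)"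
        using L2_square[OF \<xi>2] L2_mult[OF \<xi>2 X2] L2_square[OF X2] by (simp add: a_def repX[OF F])
      finally show "(CLINT \<omega>|P. iexp (u * \<xi> \<omega> + v * X F c \<omega>)) =
          of_real (exp (- (u\<^sup>2 * a + 2 * u * v * (\<Sum>i\<in>F. c i * h i) + v\<^sup>2 * (\<integral>\<omega>. (X F c \<omega>)\<^sup>2 \<partial>P)) / 2))" .
    qed measurable
    \<comment> \<open>The Cameron--Martin density; the tilting formula over the empty index set
      gives it total mass 1.\<close>
    define D where "D \<omega> = exp (\<xi> \<omega> - a / 2)" for \<omega>
    have [measurable]: "D \<in> borel_measurable P" unfolding D_def by measurable
    have D0: "0 \<le> D \<omega>" for \<omega> by (simp add: D_def)
    define Q where "Q = density P D"
    have D1: "(\<integral>\<omega>. D \<omega> \<partial>P) = 1"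
    proof -
      have "complex_of_real (\<integral>\<omega>. D \<omega> \<partial>P) = 1"
        using cm[of "{}"] by (simp add: X_def D_def del: exp_of_real integral_complex_of_real flip: integral_complex_of_real)
      then show ?thesis by simp
    qed
    then have Dint: "integrable P D" using not_integrable_integral_eq by fastforce
    have Q: "prob_space Q"
    proof
      have "(\<integral>\<^sup>+\<omega>. ennreal (D \<omega>) \<partial>P) = 1"
        using nn_integral_eq_integral[OF Dint] D0 D1 by simp
      then show "emeasure Q (space Q) = 1"
        by (simp add: Q_def emeasure_density cong: nn_integral_cong)
    qed
    have sQ[simp]: "sets Q = sets P" by (simp add: Q_def)
    note [measurable_cong] = sQ
    have "distr Q (PiM I (\<lambda>_. borel)) (\<lambda>\<omega>. \<lambda>i\<in>I. M i \<omega> - h i) = distr P (PiM I (\<lambda>_. borel)) (\<lambda>\<omega>. \<lambda>i\<in>I. M i \<omega>)"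
    proof (rule cramer_wold_process[OF Q P])
      fix F and c :: "'i \<Rightarrow> real" assume F: "finite F" "F \<subseteq> I"
      define k where "k = (\<Sum>i\<in>F. c i * h i)"
      have "(CLINT \<omega>|Q. iexp (\<Sum>i\<in>F. c i * (M i \<omega> - h i))) = (CLINT \<omega>|P. D \<omega> *\<^sub>R iexp (\<Sum>i\<in>F. c i * (M i \<omega> - h i)))"
        unfolding Q_def by (subst integral_density) (auto simp: D0)
      also have "\<dots> = (CLINT \<omega>|P. iexp (- k) * (of_real (exp (\<xi> \<omega> - a / 2)) * iexp (X F c \<omega>)))"
      proof (rule Bochner_Integration.integral_cong[OF refl])
        fix \<omega>
        have "(\<Sum>i\<in>F. c i * (M i \<omega> - h i)) = - k + X F c \<omega>"
          by (simp add: k_def X_def right_diff_distrib sum_subtractf)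
        then show "D \<omega> *\<^sub>R iexp (\<Sum>i\<in>F. c i * (M i \<omega> - h i)) = iexp (- k) * (of_real (exp (\<xi> \<omega> - a / 2)) * iexp (X F c \<omega>))"
          by (simp only: of_real_add distrib_left exp_add scaleR_conv_of_real D_def mult_ac)
      qed
      also have "\<dots> = iexp (- k) * exp (\<i> * of_real k - of_real ((\<integral>\<omega>. (X F c \<omega>)\<^sup>2 \<partial>P) / 2))"
        unfolding integral_mult_right_zero cm[OF F(1)] k_def ..
      also have "\<dots> = exp (- of_real ((\<integral>\<omega>. (X F c \<omega>)\<^sup>2 \<partial>P) / 2))"
        unfolding exp_add[symmetric] by simp
      also have "\<dots> = (CLINT \<omega>|P. iexp (\<Sum>i\<in>F. c i * M i \<omega>))"
        unfolding ch[OF F(1)] X_def exp_of_real[symmetric] by simp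
      finally show "(CLINT \<omega>|Q. iexp (\<Sum>i\<in>F. c i * (M i \<omega> - h i))) = (CLINT \<omega>|P. iexp (\<Sum>i\<in>F. c i * M i \<omega>))" .
    qed measurable
    then show ?thesis
      unfolding admissible_shift_def
      by (intro exI[of _ Q]) (simp add: Q, simp add: Q_def absolutely_continuousI_density)
  qed
qed

section \<open>The Mandelbrot--van Ness kernel\<close>

lemma L2_dominated:
  assumes g: "g \<in> L2 M" and [measurable]: "f \<in> borel_measurable M" and le: "\<And>x. \<bar>f x\<bar> \<le> g x"
  shows "f \<in> L2 M"
proof -
  have "integrable M (\<lambda>x. (f x)\<^sup>2)"
  proof (rule Bochner_Integration.integrable_bound[OF L2_square[OF g]])
    show "AE x in M. norm ((f x)\<^sup>2) \<le> norm ((g x)\<^sup>2)"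
      using le by (auto simp: abs_le_square_iff[symmetric] intro: order_trans[OF le abs_ge_self])
  qed measurable
  then show ?thesis by (simp add: L2_def)
qed

lemma L2_lborel_affine:
  fixes f :: "real \<Rightarrow> real"
  assumes f: "f \<in> L2 lborel" and c: "c \<noteq> 0"
  shows "(\<lambda>x. f (t + c * x)) \<in> L2 lborel"
proof -
  have [measurable]: "f \<in> borel_measurable borel" using L2_measurable[OF f] by simp
  show ?thesis
    using lborel_integrable_real_affine[OF L2_square[OF f] c, of t] by (simp add: L2_def)
qed

lemma integrable_lborel_of_integrable_on:
  fixes f :: "real \<Rightarrow> real"
  assumes [measurable]: "f \<in> borel_measurable borel" and S[measurable]: "S \<in> sets borel"
    and f0: "\<And>x. x \<in> S \<Longrightarrow> 0 \<le> f x" and int: "f integrable_on S"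
  shows "integrable lborel (\<lambda>x. indicator S x * f x)"
proof -
  have "set_integrable lebesgue S f"
    using nonnegative_absolutely_integrable_1[OF int] f0 by auto
  then have "integrable lebesgue (\<lambda>x. indicator S x * f x)"
    by (simp add: set_integrable_def)
  then show ?thesis
    by (subst (asm) integrable_completion) measurable
qed

lemma L2_powr_unit:
  fixes a :: real
  assumes "- 1/2 < a"
  shows "(\<lambda>x. indicator {0..1} x * x powr a) \<in> L2 lborel"
proof -
  have "(indicator {0..1} x * x powr a)\<^sup>2 = indicator {0..1} x * x powr (2 * a)" for x :: real
    by (auto simp: power2_eq_square powr_add[symmetric] split: split_indicator)
  moreover have "integrable lborel (\<lambda>x. indicator {0..1} x * x powr (2 * a))"
    by (rule integrable_lborel_of_integrable_on) (use assms in \<open>auto intro!: integrable_on_powr_from_0\<close>)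
  ultimately show ?thesis by (simp add: L2_def)
qed

lemma L2_powr_tail:
  fixes a :: real
  assumes "a < - 1/2"
  shows "(\<lambda>x. indicator {1..} x * x powr a) \<in> L2 lborel"
proof -
  have "(indicator {1..} x * x powr a)\<^sup>2 = indicator {1..} x * x powr (2 * a)" for x :: real
    by (auto simp: power2_eq_square powr_add[symmetric] split: split_indicator)
  moreover have "integrable lborel (\<lambda>x. indicator {1..} x * x powr (2 * a))"
  proof (rule integrable_lborel_of_integrable_on)
    show "(\<lambda>x. x powr (2 * a)) integrable_on {1..}"
      using has_integral_powr_to_inf[of "2 * a" 1] assms by (auto simp: integrable_on_def)
  qed auto
  ultimately show ?thesis by (simp add: L2_def)
qed

lemma integral_lborel_pos:
  fixes f :: "real \<Rightarrow> real"
  assumes f: "integrable lborel f" and f0: "\<And>x. 0 \<le> f x" and pos: "\<And>x. 0 < x \<Longrightarrow> x < 1 \<Longrightarrow> 0 < f x"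
  shows "0 < (\<integral>x. f x \<partial>lborel)"
proof -
  have "(\<integral>x. f x \<partial>lborel) \<noteq> 0"
  proof
    assume "(\<integral>x. f x \<partial>lborel) = 0"
    then have "AE x in lborel. f x = 0"
      using integral_nonneg_eq_0_iff_AE[OF f] f0 by simp
    then have "AE x in lborel. x \<notin> {0<..<1::real}"
      by eventually_elim (use pos in force)
    then have "{0<..<1::real} \<in> null_sets lborel"
      by (subst (asm) AE_iff_null_sets[symmetric]) auto
    then show False by (auto simp: null_sets_def)
  qed
  moreover have "0 \<le> (\<integral>x. f x \<partial>lborel)" using f0 by simp
  ultimately show ?thesis by simp
qed

text \<open>The Mandelbrot--van Ness kernel; the Hurst index is \<open>a + 1/2\<close>. Note that \<open>0 powr a = 0\<close> for every \<open>a\<close>.\<close>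

definition mvn :: "real \<Rightarrow> real \<Rightarrow> real \<Rightarrow> real" where
  "mvn a t s = max 0 (t - s) powr a - max 0 (- s) powr a"

lemma mvn_measurable[measurable]: "mvn a t \<in> borel_measurable borel"
  unfolding mvn_def by measurable

text \<open>By the mean value theorem the increment decays one power faster than
  \<open>x powr a\<close>. For exponents between -1/2 and 1/2 this makes the Mandelbrot--van Ness
  kernel square-integrable at minus infinity, although neither of its two terms is.\<close>

lemma abs_powr_diff_le:
  fixes a x :: real
  assumes a: "\<bar>a\<bar> < 1" and x: "1 \<le> x"
  shows "\<bar>(1 + x) powr a - x powr a\<bar> \<le> x powr (a - 1)"
proof -
  have "\<exists>z>x. z < 1 + x \<and> (1 + x) powr a - x powr a = (1 + x - x) * (a * z powr (a - 1))"
    by (rule MVT2) (use x in \<open>auto intro!: derivative_eq_intros\<close>)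
  then obtain z where z: "x < z" and eq: "(1 + x) powr a - x powr a = a * z powr (a - 1)" by auto
  have "\<bar>a\<bar> * z powr (a - 1) \<le> 1 * x powr (a - 1)"
    by (rule mult_mono) (use a x z in \<open>auto intro!: powr_mono2'\<close>)
  then show ?thesis by (simp add: eq abs_mult)
qed

lemma L2_mvn_1:
  assumes a: "\<bar>a\<bar> < 1 / 2"
  shows "mvn a 1 \<in> L2 lborel"
proof -
  \<comment> \<open>A majorant in four pieces: the possible singularity at s = 1, a bound for the
    first term on [-1,0], the possible singularity at s = 0, and the tail of the increment.\<close>
  define G where "G s = indicator {0..1} (1 + (-1) * s) * (1 + (-1) * s) powr a + 2 * indicator {-1..0} s
    + indicator {0..1} (0 + (-1) * s) * (0 + (-1) * s) powr a + indicator {1..} (0 + (-1) * s) * (0 + (-1) * s) powr (a - 1)" for s :: real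
  have "(\<lambda>s. indicator {-1..0::real} s) \<in> L2 lborel"
  proof -
    have "(indicator {-1..0::real} s :: real)\<^sup>2 = indicator {-1..0} s" for s by (simp split: split_indicator)
    then show ?thesis by (simp add: L2_def)
  qed
  then have "G \<in> L2 lborel"
    unfolding G_def using a
    by (intro L2_add L2_scale L2_lborel_affine[OF L2_powr_unit] L2_lborel_affine[OF L2_powr_tail]) auto
  moreover have "\<bar>mvn a 1 s\<bar> \<le> G s" for s
  proof -
    consider "1 < s" | "0 \<le> s" "s \<le> 1" | "-1 < s" "s < 0" | "s \<le> -1" by linarith
    then show ?thesis
    proof cases
      case 3
      have "(1 - s) powr a \<le> (1 - s) powr 1" using 3 a by (intro powr_mono) auto
      then have "(1 - s) powr a \<le> 2" using 3 by simp
      moreover have "\<bar>(1 - s) powr a - (- s) powr a\<bar> \<le> (1 - s) powr a + (- s) powr a"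
        using powr_ge_zero[of "1 - s" a] powr_ge_zero[of "- s" a] by linarith
      ultimately show ?thesis using 3 by (simp add: mvn_def G_def)
    next
      case 4
      then show ?thesis using abs_powr_diff_le[of a "- s"] a
        by (auto simp: mvn_def G_def split: split_indicator)
    qed (auto simp: mvn_def G_def split: split_indicator)
  qed
  ultimately show ?thesis using L2_dominated[of G lborel "mvn a 1"] by simp
qed

lemma mvn_scale: "0 < t \<Longrightarrow> mvn a t s = t powr a * mvn a 1 (0 + (1 / t) * s)"
proof -
  assume t: "0 < t"
  have "max 0 (t - s) = t * max 0 (1 - s / t)" "max 0 (- s) = t * max 0 (- (s / t))"
    using t by (auto simp: max_def field_simps)
  then show ?thesis using t by (simp add: mvn_def powr_mult right_diff_distrib)
qed

lemma mvn_reflect: "mvn a t s = - mvn a (- t) (- t + 1 * s)"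
  by (simp add: mvn_def)

lemma mvn_diff: "mvn a t s - mvn a r s = mvn a (t - r) (- r + 1 * s)"
  by (simp add: mvn_def)

lemma mvn_0: "mvn a 0 s = 0"
  by (simp add: mvn_def)

lemma L2_mvn:
  assumes a: "\<bar>a\<bar> < 1 / 2"
  shows "mvn a t \<in> L2 lborel"
proof -
  have pos: "mvn a t \<in> L2 lborel" if "0 < t" for t
    using L2_scale[OF L2_lborel_affine[OF L2_mvn_1[OF a], of "1 / t" 0], of "t powr a"] that
    by (simp add: mvn_scale[OF that, abs_def])
  consider "0 < t" | "t = 0" | "t < 0" by linarith
  then show ?thesis
  proof cases
    case 2
    then show ?thesis using L2_zero by (simp add: mvn_0[abs_def])
  next
    case 3
    then show ?thesis using L2_scale[OF L2_lborel_affine[OF pos[of "- t"], of 1 "- t"], of "-1"]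
      by (simp add: mvn_reflect[of a t, abs_def])
  qed (rule pos)
qed

text \<open>Self-similarity: rescaling time multiplies the kernel by \<open>t powr a\<close>, and
  the change of variables contributes one more factor \<open>t\<close>. Negative times are reached
  by a translation.\<close>

lemma mvn_norm:
  assumes a: "\<bar>a\<bar> < 1 / 2"
  shows "(\<integral>s. (mvn a t s)\<^sup>2 \<partial>lborel) = \<bar>t\<bar> powr (2 * a + 1) * (\<integral>s. (mvn a 1 s)\<^sup>2 \<partial>lborel)"
proof -
  have pos: "(\<integral>s. (mvn a t s)\<^sup>2 \<partial>lborel) = t powr (2 * a + 1) * (\<integral>s. (mvn a 1 s)\<^sup>2 \<partial>lborel)" if t: "0 < t" for t
  proof -
    have "(\<integral>s. (mvn a 1 s)\<^sup>2 \<partial>lborel) = \<bar>1 / t\<bar> *\<^sub>R (\<integral>s. (mvn a 1 (0 + (1 / t) * s))\<^sup>2 \<partial>lborel)"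
      by (rule lborel_integral_real_affine) (use t in auto)
    then have "(\<integral>s. (mvn a 1 (0 + (1 / t) * s))\<^sup>2 \<partial>lborel) = t * (\<integral>s. (mvn a 1 s)\<^sup>2 \<partial>lborel)"
      using t by (simp add: field_simps)
    then show ?thesis
      using t by (simp add: mvn_scale[OF t, abs_def] power_mult_distrib powr_add powr_power mult.commute)
  qed
  consider "0 < t" | "t = 0" | "t < 0" by linarith
  then show ?thesis
  proof cases
    case 3
    have "(\<integral>s. (mvn a (- t) s)\<^sup>2 \<partial>lborel) = \<bar>1\<bar> *\<^sub>R (\<integral>s. (mvn a (- t) (- t + 1 * s))\<^sup>2 \<partial>lborel)"
      by (rule lborel_integral_real_affine) simp
    then show ?thesis using pos[of "- t"] 3 by (simp add: mvn_reflect[of a t, abs_def])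
  qed (use pos[of t] in \<open>auto simp: mvn_0[abs_def]\<close>)
qed

text \<open>Up to the last factor this is the fractional Brownian covariance with
  \<open>2 * H = 2 * a + 1\<close>. It follows by polarisation, because a difference of two kernels
  is a translate of a kernel.\<close>

lemma mvn_inner:
  assumes a: "\<bar>a\<bar> < 1 / 2"
  shows "(\<integral>s. mvn a t s * mvn a r s \<partial>lborel) =
    (\<bar>t\<bar> powr (2 * a + 1) + \<bar>r\<bar> powr (2 * a + 1) - \<bar>t - r\<bar> powr (2 * a + 1)) / 2 * (\<integral>s. (mvn a 1 s)\<^sup>2 \<partial>lborel)"
proof -
  note L = L2_mvn[OF a]
  have "(\<integral>s. (mvn a (t - r) s)\<^sup>2 \<partial>lborel) = \<bar>1\<bar> *\<^sub>R (\<integral>s. (mvn a (t - r) (- r + 1 * s))\<^sup>2 \<partial>lborel)"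
    by (rule lborel_integral_real_affine) simp
  also have "\<dots> = (\<integral>s. (mvn a t s)\<^sup>2 + (mvn a r s)\<^sup>2 - 2 * (mvn a t s * mvn a r s) \<partial>lborel)"
    unfolding mvn_diff[symmetric] by (simp add: power2_diff mult.assoc)
  also have "\<dots> = (\<integral>s. (mvn a t s)\<^sup>2 \<partial>lborel) + (\<integral>s. (mvn a r s)\<^sup>2 \<partial>lborel) - 2 * (\<integral>s. mvn a t s * mvn a r s \<partial>lborel)"
    using L2_square[OF L] L2_mult[OF L L] by simp
  finally show ?thesis
    unfolding mvn_norm[OF a, of t] mvn_norm[OF a, of r] mvn_norm[OF a, of "t - r"] by (simp add: algebra_simps)
qed

lemma mvn_1_pos:
  assumes a: "\<bar>a\<bar> < 1 / 2"
  shows "0 < (\<integral>s. (mvn a 1 s)\<^sup>2 \<partial>lborel)"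
  by (rule integral_lborel_pos) (use L2_square[OF L2_mvn[OF a]] in \<open>auto simp: mvn_def\<close>)

text \<open>Fractional integration maps \<open>(s - q)\<^sup>k\<^sup>-\<^sup>a\<close> to a multiple of \<open>(t - q)\<^sup>k\<^sup>+\<^sup>1\<close>.\<close>

lemma mvn_monomial:
  fixes a q l :: real and k :: nat
  assumes a: "\<bar>a\<bar> < 1 / 2" and q: "0 \<le> q" and l: "0 < l"
  obtains \<psi> where "\<psi> \<in> L2 lborel" "\<And>t. t \<le> q + l \<Longrightarrow> (\<integral>s. mvn a t s * \<psi> s \<partial>lborel) = max 0 (t - q) ^ Suc k"
proof -
  \<comment> \<open>The exponents \<open>a\<close> and \<open>e\<close> add up to \<open>k\<close>,
    and the integration supplies one more power. As \<open>k\<close> is natural and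
    \<open>a < 1/2\<close>, the function below is square-integrable at \<open>q\<close>.\<close>
  define e where "e = real k - a"
  have e: "- 1/2 < e" using a by (auto simp: e_def)
  \<comment> \<open>The cut at \<open>q + l\<close> secures square-integrability and restricts the
    formula to \<open>t \<le> q + l\<close>. Since \<open>0 \<le> q\<close>, the second term of the
    kernel vanishes on the support.\<close>
  define \<phi> where "\<phi> s = indicator {q..q + l} s * (s - q) powr e" for s
  \<comment> \<open>The Beta integral B(e + 1, a + 1), divided out at the end.\<close>
  define \<beta> where "\<beta> = (\<integral>u. indicator {0..1} u * u powr e * (indicator {0..1} (1 + (-1) * u) * (1 + (-1) * u) powr a) \<partial>lborel)"
  have \<beta>: "0 < \<beta>"
    unfolding \<beta>_def
  proof (rule integral_lborel_pos)
    show "integrable lborel (\<lambda>u. indicator {0..1} u * u powr e * (indicator {0..1} (1 + (-1) * u) * (1 + (-1) * u) powr a))"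
      by (rule L2_mult[OF L2_powr_unit[OF e] L2_lborel_affine[OF L2_powr_unit]]) (use a in auto)
  qed auto
  have "\<phi> = (\<lambda>s. l powr e * (indicator {0..1} (- q / l + (1 / l) * s) * (- q / l + (1 / l) * s) powr e))"
  proof
    fix s
    have "- q / l + (1 / l) * s = (s - q) / l" using l by (simp add: field_simps)
    then show "\<phi> s = l powr e * (indicator {0..1} (- q / l + (1 / l) * s) * (- q / l + (1 / l) * s) powr e)"
      using l by (auto simp: \<phi>_def powr_divide field_simps split: split_indicator)
  qed
  then have \<phi>2: "\<phi> \<in> L2 lborel"
    using L2_scale[OF L2_lborel_affine[OF L2_powr_unit[OF e], of "1 / l" "- q / l"], of "l powr e"] l by simp
  have main: "(\<integral>s. mvn a t s * \<phi> s \<partial>lborel) = \<beta> * max 0 (t - q) ^ Suc k" if t: "t \<le> q + l" for t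
  proof (cases "t \<le> q")
    case True
    then have "(\<lambda>s. mvn a t s * \<phi> s) = (\<lambda>s. 0)"
      using q by (auto simp: mvn_def \<phi>_def split: split_indicator)
    then show ?thesis using True by (simp only:) simp
  next
    case False
    define d where "d = t - q"
    have d: "0 < d" "d \<le> l" using False t by (auto simp: d_def)
    have *: "mvn a t (q + d * u) * \<phi> (q + d * u) =
        d ^ k * (indicator {0..1} u * u powr e * (indicator {0..1} (1 + (-1) * u) * (1 + (-1) * u) powr a))" for u
    proof -
      have dk: "d powr a * d powr e = d ^ k"
        using d by (simp add: powr_add[symmetric] e_def powr_realpow)
      consider "u < 0" | "0 \<le> u" "u \<le> 1" | "1 < u" by linarith
      then show ?thesis
      proof cases
        case 1
        then have "q + d * u < q" using d by (simp add: mult_less_0_iff)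
        then show ?thesis using 1 by (simp add: \<phi>_def)
      next
        case 2
        have "d * u \<le> l" using 2 d mult_mono[of d l u 1] by simp
        moreover have "t - (q + d * u) = d * (1 - u)" by (simp add: d_def algebra_simps)
        moreover have "0 \<le> d * (1 - u)" "0 \<le> d * u" using 2 d by auto
        ultimately have "mvn a t (q + d * u) * \<phi> (q + d * u) = (d * (1 - u)) powr a * (d * u) powr e"
          using q by (simp add: mvn_def \<phi>_def)
        also have "\<dots> = d powr a * d powr e * ((1 - u) powr a * u powr e)"
          using 2 d by (simp add: powr_mult)
        finally show ?thesis using 2 by (simp add: dk)
      next
        case 3
        then have "d \<le> d * u" using d by simp
        moreover have "t = q + d" by (simp add: d_def)
        ultimately have "t - (q + d * u) \<le> 0" "- (q + d * u) \<le> 0" using q d(1) by linarith+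
        then have "max 0 (t - (q + d * u)) = 0" "max 0 (- (q + d * u)) = 0" by (simp_all add: max_def)
        then show ?thesis using 3 by (simp add: mvn_def)
      qed
    qed
    have "(\<integral>s. mvn a t s * \<phi> s \<partial>lborel) = \<bar>d\<bar> *\<^sub>R (\<integral>u. mvn a t (q + d * u) * \<phi> (q + d * u) \<partial>lborel)"
      by (rule lborel_integral_real_affine) (use d in auto)
    also have "\<dots> = d * (d ^ k * \<beta>)"
      unfolding * \<beta>_def using d by (simp only: integral_mult_right_zero) simp
    finally show ?thesis using d by (simp add: d_def)
  qed
  show ?thesis
  proof (rule that[of "\<lambda>s. (1 / \<beta>) * \<phi> s"])
    show "(\<lambda>s. (1 / \<beta>) * \<phi> s) \<in> L2 lborel" by (rule L2_scale[OF \<phi>2])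
    show "(\<integral>s. mvn a t s * ((1 / \<beta>) * \<phi> s) \<partial>lborel) = max 0 (t - q) ^ Suc k" if "t \<le> q + l" for t
    proof -
      have "(\<integral>s. mvn a t s * ((1 / \<beta>) * \<phi> s) \<partial>lborel) = (\<integral>s. (1 / \<beta>) * (mvn a t s * \<phi> s) \<partial>lborel)"
        by (rule Bochner_Integration.integral_cong) auto
      also have "\<dots> = (1 / \<beta>) * (\<beta> * max 0 (t - q) ^ Suc k)"
        unfolding integral_mult_right_zero main[OF that] ..
      finally show ?thesis using \<beta> by simp
    qed
  qed
qed

text \<open>\<open>h t\<close> is the inner product of \<open>mvn a t\<close> with a fixed
  \<open>\<rho>\<close>, so Cauchy--Schwarz applies to the combined kernel, whose squared norm is by
  \<open>mvn_inner\<close> the quadratic form on the right times \<open>D\<close>. Hence the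
  constant is \<open>D\<close> times the squared norm of \<open>\<rho>\<close>.\<close>

lemma fBm_kernel_polynomial:
  fixes H q l :: real and r :: "nat \<Rightarrow> real"
  assumes H: "0 < H" "H < 1" and q: "0 \<le> q" and l: "0 < l"
  obtains C h where "0 \<le> C"
    "\<And>F c. finite F \<Longrightarrow> (\<Sum>t\<in>F. c t * h t)\<^sup>2 \<le>
        C * (\<Sum>t\<in>F. \<Sum>s\<in>F. c t * c s * ((\<bar>t\<bar> powr (2 * H) + \<bar>s\<bar> powr (2 * H) - \<bar>t - s\<bar> powr (2 * H)) / 2))"
    "\<And>t. t \<le> q + l \<Longrightarrow> h t = (\<Sum>k<n. r k * max 0 (t - q) ^ Suc k)"
    "h \<in> borel_measurable borel"
proof -
  define a where "a = H - 1 / 2"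
  have a: "\<bar>a\<bar> < 1 / 2" and aH: "2 * a + 1 = 2 * H" using H unfolding a_def abs_less_iff by auto
  have "\<forall>k. \<exists>\<psi>. \<psi> \<in> L2 lborel \<and> (\<forall>t\<le>q + l. (\<integral>s. mvn a t s * \<psi> s \<partial>lborel) = max 0 (t - q) ^ Suc k)"
  proof
    fix k
    obtain \<psi> where "\<psi> \<in> L2 lborel" "\<And>t. t \<le> q + l \<Longrightarrow> (\<integral>s. mvn a t s * \<psi> s \<partial>lborel) = max 0 (t - q) ^ Suc k"
      by (rule mvn_monomial[OF a q l, of k]) blast
    then show "\<exists>\<psi>. \<psi> \<in> L2 lborel \<and> (\<forall>t\<le>q + l. (\<integral>s. mvn a t s * \<psi> s \<partial>lborel) = max 0 (t - q) ^ Suc k)"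
      by blast
  qed
  from choice[OF this] obtain \<psi> where \<psi>: "\<And>k. \<psi> k \<in> L2 lborel"
    "\<And>k t. t \<le> q + l \<Longrightarrow> (\<integral>s. mvn a t s * \<psi> k s \<partial>lborel) = max 0 (t - q) ^ Suc k"
    by blast
  define D where "D = (\<integral>s. (mvn a 1 s)\<^sup>2 \<partial>lborel)"
  have D: "0 < D" unfolding D_def by (rule mvn_1_pos[OF a])
  define \<rho> where "\<rho> s = (\<Sum>k<n. r k * \<psi> k s)" for s
  have \<rho>: "\<rho> \<in> L2 lborel" unfolding \<rho>_def by (intro L2_sum L2_scale \<psi>)
  define h where "h t = (\<integral>s. mvn a t s * \<rho> s \<partial>lborel)" for t
  show ?thesis
  proof (rule that[of "D * (\<integral>s. (\<rho> s)\<^sup>2 \<partial>lborel)" h])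
    show "0 \<le> D * (\<integral>s. (\<rho> s)\<^sup>2 \<partial>lborel)" using D by simp
    have [measurable]: "\<rho> \<in> borel_measurable borel" using L2_measurable[OF \<rho>] by simp
    show "h \<in> borel_measurable borel"
      unfolding h_def[abs_def] mvn_def by (rule lborel.borel_measurable_lebesgue_integral) measurable
    show "h t = (\<Sum>k<n. r k * max 0 (t - q) ^ Suc k)" if "t \<le> q + l" for t
    proof -
      have "h t = (\<integral>s. (\<Sum>k<n. r k * (mvn a t s * \<psi> k s)) \<partial>lborel)"
        unfolding h_def \<rho>_def by (simp add: sum_distrib_left mult_ac)
      also have "\<dots> = (\<Sum>k<n. r k * (\<integral>s. mvn a t s * \<psi> k s \<partial>lborel))"
        using L2_mult[OF L2_mvn[OF a, of t] \<psi>(1)] by (subst Bochner_Integration.integral_sum) auto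
      finally show ?thesis by (simp add: \<psi>(2)[OF that])
    qed
    fix F :: "real set" and c :: "real \<Rightarrow> real" assume F: "finite F"
    define K where "K s = (\<Sum>t\<in>F. c t * mvn a t s)" for s
    have K: "K \<in> L2 lborel" unfolding K_def by (intro L2_sum L2_scale L2_mvn[OF a])
    have "(\<Sum>t\<in>F. c t * h t) = (\<integral>s. (\<Sum>t\<in>F. c t * (mvn a t s * \<rho> s)) \<partial>lborel)"
      unfolding h_def using L2_mult[OF L2_mvn[OF a] \<rho>] by (subst Bochner_Integration.integral_sum) auto
    also have "\<dots> = (\<integral>s. K s * \<rho> s \<partial>lborel)"
      unfolding K_def by (simp add: sum_distrib_right mult.assoc)
    finally have "(\<Sum>t\<in>F. c t * h t)\<^sup>2 \<le> (\<integral>s. (K s)\<^sup>2 \<partial>lborel) * (\<integral>s. (\<rho> s)\<^sup>2 \<partial>lborel)"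
      using L2_Cauchy_Schwarz[OF K \<rho>] by simp
    also have "(\<integral>s. (K s)\<^sup>2 \<partial>lborel) = (\<integral>s. (\<Sum>t\<in>F. \<Sum>r\<in>F. (c t * c r) * (mvn a t s * mvn a r s)) \<partial>lborel)"
      unfolding K_def power2_eq_square sum_product by (simp add: mult_ac)
    also have "\<dots> = (\<Sum>t\<in>F. \<Sum>r\<in>F. (c t * c r) * (\<integral>s. mvn a t s * mvn a r s \<partial>lborel))"
      using L2_mult[OF L2_mvn[OF a] L2_mvn[OF a]] by (simp add: Bochner_Integration.integral_sum)
    also have "\<dots> = D * (\<Sum>t\<in>F. \<Sum>s\<in>F. c t * c s * ((\<bar>t\<bar> powr (2 * H) + \<bar>s\<bar> powr (2 * H) - \<bar>t - s\<bar> powr (2 * H)) / 2))"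
      unfolding mvn_inner[OF a] aH D_def[symmetric] by (simp add: sum_distrib_left mult_ac)
    finally show "(\<Sum>t\<in>F. c t * h t)\<^sup>2 \<le> D * (\<integral>s. (\<rho> s)\<^sup>2 \<partial>lborel) *
        (\<Sum>t\<in>F. \<Sum>s\<in>F. c t * c s * ((\<bar>t\<bar> powr (2 * H) + \<bar>s\<bar> powr (2 * H) - \<bar>t - s\<bar> powr (2 * H)) / 2))"
      by (simp add: mult_ac)
  qed
qed

section \<open>Multi-mixed fractional Brownian motion as a Gaussian process\<close>

lemma L2_tendsto_add:
  assumes "L2_tendsto M Y \<xi>" "L2_tendsto M Z \<eta>"
  shows "L2_tendsto M (\<lambda>n x. Y n x + Z n x) (\<lambda>x. \<xi> x + \<eta> x)"
proof -
  have Y: "Y n \<in> L2 M" and \<xi>: "\<xi> \<in> L2 M" and limY: "(\<lambda>n. \<integral>x. (Y n x - \<xi> x)\<^sup>2 \<partial>M) \<longlonglongrightarrow> 0"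
    and Z: "Z n \<in> L2 M" and \<eta>: "\<eta> \<in> L2 M" and limZ: "(\<lambda>n. \<integral>x. (Z n x - \<eta> x)\<^sup>2 \<partial>M) \<longlonglongrightarrow> 0" for n
    using assms by (auto simp: L2_tendsto_def)
  have le: "(\<integral>x. (Y n x + Z n x - (\<xi> x + \<eta> x))\<^sup>2 \<partial>M) \<le> 2 * (\<integral>x. (Y n x - \<xi> x)\<^sup>2 \<partial>M) + 2 * (\<integral>x. (Z n x - \<eta> x)\<^sup>2 \<partial>M)" for n
  proof -
    have "(\<integral>x. (Y n x + Z n x - (\<xi> x + \<eta> x))\<^sup>2 \<partial>M) \<le> (\<integral>x. 2 * (Y n x - \<xi> x)\<^sup>2 + 2 * (Z n x - \<eta> x)\<^sup>2 \<partial>M)"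
    proof (rule integral_mono)
      show "integrable M (\<lambda>x. (Y n x + Z n x - (\<xi> x + \<eta> x))\<^sup>2)"
        by (intro L2_square L2_diff L2_add Y Z \<xi> \<eta>)
      show "integrable M (\<lambda>x. 2 * (Y n x - \<xi> x)\<^sup>2 + 2 * (Z n x - \<eta> x)\<^sup>2)"
        using L2_square[OF L2_diff[OF Y \<xi>]] L2_square[OF L2_diff[OF Z \<eta>]] by simp
      show "(Y n x + Z n x - (\<xi> x + \<eta> x))\<^sup>2 \<le> 2 * (Y n x - \<xi> x)\<^sup>2 + 2 * (Z n x - \<eta> x)\<^sup>2" for x
        using sum_squares_bound[of "Y n x - \<xi> x" "Z n x - \<eta> x"] by (simp add: power2_eq_square algebra_simps)
    qed
    then show ?thesis
      using L2_square[OF L2_diff[OF Y \<xi>], of n] L2_square[OF L2_diff[OF Z \<eta>], of n] by simp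
  qed
  have "(\<lambda>n. \<integral>x. (Y n x + Z n x - (\<xi> x + \<eta> x))\<^sup>2 \<partial>M) \<longlonglongrightarrow> 0"
  proof (rule Lim_null_comparison)
    show "(\<lambda>n. 2 * (\<integral>x. (Y n x - \<xi> x)\<^sup>2 \<partial>M) + 2 * (\<integral>x. (Z n x - \<eta> x)\<^sup>2 \<partial>M)) \<longlonglongrightarrow> 0"
      using tendsto_add[OF tendsto_mult_right_zero[OF limY, of 2] tendsto_mult_right_zero[OF limZ, of 2]] by simp
  qed (use le in \<open>simp\<close>)
  then show ?thesis using Y Z \<xi> \<eta> by (auto simp: L2_tendsto_def intro: L2_add)
qed

lemma L2_tendsto_sum:
  assumes "\<And>i. i \<in> F \<Longrightarrow> L2_tendsto M (Y i) (\<xi> i)"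
  shows "L2_tendsto M (\<lambda>n x. \<Sum>i\<in>F. c i * Y i n x) (\<lambda>x. \<Sum>i\<in>F. c i * \<xi> i x)"
  using assms
proof (induction F rule: infinite_finite_induct)
  case (insert i F)
  then show ?case
    using L2_tendsto_add[OF L2_tendsto_affine[OF insert.prems[of i] L2_zero, of "c i"], of "\<lambda>n x. \<Sum>i\<in>F. c i * Y i n x"] by simp
qed (simp_all add: L2_tendsto_def L2_zero)

text \<open>Finiteness of the extended integral at a single index already places the limit in
  \<open>L2\<close>; from then on it equals the Bochner integral.\<close>

lemma L2_tendstoI_nn_integral:
  assumes Y: "\<And>n. Y n \<in> L2 M" and [measurable]: "\<xi> \<in> borel_measurable M"
    and lim: "(\<lambda>n. \<integral>\<^sup>+x. ennreal ((\<xi> x - Y n x)\<^sup>2) \<partial>M) \<longlonglongrightarrow> 0"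
  shows "L2_tendsto M Y \<xi>"
proof -
  note [measurable] = Y[THEN L2_measurable]
  have "\<forall>\<^sub>F n in sequentially. (\<integral>\<^sup>+x. ennreal ((\<xi> x - Y n x)\<^sup>2) \<partial>M) < 1"
    using lim by (rule order_tendstoD) simp
  then obtain n where n: "(\<integral>\<^sup>+x. ennreal ((\<xi> x - Y n x)\<^sup>2) \<partial>M) < 1"
    by (auto simp: eventually_sequentially)
  have "integrable M (\<lambda>x. (\<xi> x - Y n x)\<^sup>2)"
  proof (rule integrableI_bounded)
    show "(\<integral>\<^sup>+x. ennreal (norm ((\<xi> x - Y n x)\<^sup>2)) \<partial>M) < \<infinity>"
      using n by (simp add: order_less_trans[OF n])
  qed measurable
  then have "(\<lambda>x. \<xi> x - Y n x) \<in> L2 M" by (simp add: L2_def)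
  from L2_add[OF this Y, of n] have \<xi>: "\<xi> \<in> L2 M" by simp
  have "(\<integral>\<^sup>+x. ennreal ((\<xi> x - Y n x)\<^sup>2) \<partial>M) = ennreal (\<integral>x. (Y n x - \<xi> x)\<^sup>2 \<partial>M)" for n
    unfolding power2_commute[of "\<xi> _"] using L2_square[OF L2_diff[OF Y \<xi>]] by (subst nn_integral_eq_integral) auto
  with lim have "(\<lambda>n. ennreal (\<integral>x. (Y n x - \<xi> x)\<^sup>2 \<partial>M)) \<longlonglongrightarrow> ennreal 0" by simp
  then have "(\<lambda>n. \<integral>x. (Y n x - \<xi> x)\<^sup>2 \<partial>M) \<longlonglongrightarrow> 0"
    by (rule tendsto_ennrealD) auto
  then show ?thesis using Y \<xi> by (simp add: L2_tendsto_def)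
qed

lemma (in prob_space) centered_gaussian_moments:
  assumes "centered_gaussian M X"
  shows "X \<in> L2 M" and "expectation X = 0"
    and "(CLINT \<omega>|M. iexp (u * X \<omega>)) = of_real (exp (- (u\<^sup>2 * expectation (\<lambda>\<omega>. (X \<omega>)\<^sup>2)) / 2))"
proof -
  have X[measurable]: "X \<in> borel_measurable M" using assms by (simp add: centered_gaussian_def)
  consider "AE \<omega> in M. X \<omega> = 0" | s where "0 < s" "distributed M lborel X (normal_density 0 s)"
    using assms by (auto simp: centered_gaussian_def)
  then have "X \<in> L2 M \<and> expectation X = 0 \<and> (CLINT \<omega>|M. iexp (u * X \<omega>)) = of_real (exp (- (u\<^sup>2 * expectation (\<lambda>\<omega>. (X \<omega>)\<^sup>2)) / 2))"
  proof cases
    case 1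
    have "integrable M (\<lambda>\<omega>. (X \<omega>)\<^sup>2) \<longleftrightarrow> integrable M (\<lambda>\<omega>. 0 :: real)"
      by (rule integrable_cong_AE) (use 1 in auto)
    moreover have "expectation X = expectation (\<lambda>\<omega>. 0)"
      by (rule integral_cong_AE) (use 1 in auto)
    moreover have "expectation (\<lambda>\<omega>. (X \<omega>)\<^sup>2) = expectation (\<lambda>\<omega>. 0)"
      by (rule integral_cong_AE) (use 1 in auto)
    moreover have "(CLINT \<omega>|M. iexp (u * X \<omega>)) = (CLINT \<omega>|M. 1)"
      by (rule integral_cong_AE) (use 1 in auto)
    ultimately show ?thesis by (simp add: L2_def prob_space)
  next
    case (2 s)
    have E0: "expectation X = 0" by (rule normal_distributed_expectation[OF 2])
    have E2: "expectation (\<lambda>\<omega>. (X \<omega>)\<^sup>2) = s\<^sup>2"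
      using normal_distributed_variance[OF 2] by (simp add: E0)
    \<comment> \<open>The second moment is nonzero, whereas the integral of a non-integrable
      function is 0.\<close>
    have i2: "integrable M (\<lambda>\<omega>. (X \<omega>)\<^sup>2)"
    proof (rule ccontr)
      assume "\<not> integrable M (\<lambda>\<omega>. (X \<omega>)\<^sup>2)"
      then have "expectation (\<lambda>\<omega>. (X \<omega>)\<^sup>2) = 0" by (rule not_integrable_integral_eq)
      then show False using E2 2 by simp
    qed
    have "(CLINT \<omega>|M. iexp (u * X \<omega>)) = (CLINT x|distr M lborel X. iexp (u * x))"
      by (subst integral_distr) auto
    also have "\<dots> = (CLBINT x. normal_density 0 s x *\<^sub>R iexp (u * x))"
      unfolding distributed_distr_eq_density[OF 2(2)] by (subst integral_density) auto
    also have "\<dots> = exp (\<i> * of_real (0 * u) - of_real (s\<^sup>2 * u\<^sup>2 / 2))" by (rule char_normal_density[OF 2(1)])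
    also have "\<dots> = of_real (exp (- (u\<^sup>2 * s\<^sup>2) / 2))"
      by (simp add: exp_of_real[symmetric] mult.commute)
    finally show ?thesis using E0 E2 i2 by (simp add: L2_def)
  qed
  then show "X \<in> L2 M" "expectation X = 0"
    "(CLINT \<omega>|M. iexp (u * X \<omega>)) = of_real (exp (- (u\<^sup>2 * expectation (\<lambda>\<omega>. (X \<omega>)\<^sup>2)) / 2))" by auto
qed

text \<open>The bound is free of \<open>H\<close>, so it can be summed over all components of the
  mixture.\<close>

lemma powr_le_one_plus_square:
  fixes H s :: real
  assumes "0 < H" "H < 1"
  shows "\<bar>s\<bar> powr (2 * H) \<le> 1 + s\<^sup>2"
proof (cases "\<bar>s\<bar> \<le> 1")
  case True
  then have "\<bar>s\<bar> powr (2 * H) \<le> 1" using assms powr_mono2[of "2 * H" "\<bar>s\<bar>" 1] by simp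
  then show ?thesis using zero_le_power2[of s] by linarith
next
  case False
  then have "\<bar>s\<bar> powr (2 * H) \<le> \<bar>s\<bar> powr 2" using assms by (intro powr_mono) auto
  also have "\<dots> = s\<^sup>2" using False by (simp add: powr_numeral)
  finally show ?thesis by linarith
qed

text \<open>For partial sums, characteristic functions of independent terms multiply and variances
  add; both facts survive the mean-square limit. The third claim keeps the component of index 0
  alone, as a lower bound for the kernel-space comparison. The fourth bounds all components at once
  and makes the exponentially weighted integral of M converge.\<close>

lemma mmfBm_gaussian:
  assumes P: "prob_space P" and mm: "mmfBm P \<sigma> H B M"
  shows "M t \<in> L2 P"
    and "finite F \<Longrightarrow> (CLINT \<omega>|P. iexp (\<Sum>t\<in>F. c t * M t \<omega>)) = of_real (exp (- (\<integral>\<omega>. (\<Sum>t\<in>F. c t * M t \<omega>)\<^sup>2 \<partial>P) / 2))"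
    and "finite F \<Longrightarrow> (\<sigma> 0)\<^sup>2 * (\<Sum>t\<in>F. \<Sum>s\<in>F. c t * c s * ((\<bar>t\<bar> powr (2 * H 0) + \<bar>s\<bar> powr (2 * H 0) - \<bar>t - s\<bar> powr (2 * H 0)) / 2)) \<le>
        (\<integral>\<omega>. (\<Sum>t\<in>F. c t * M t \<omega>)\<^sup>2 \<partial>P)"
    and "(\<integral>\<omega>. (M t \<omega>)\<^sup>2 \<partial>P) \<le> (\<Sum>k. (\<sigma> k)\<^sup>2) * (1 + t\<^sup>2)"
proof -
  interpret P: prob_space P by fact
  have par: "mmfBm_params \<sigma> H" and fB: "\<And>k. fBm P (H k) (B k)"
    and ind: "P.indep_vars (\<lambda>_. PiM UNIV (\<lambda>_. borel)) (\<lambda>k \<omega> t. B k t \<omega>) UNIV"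
    and Mm: "\<And>t. M t \<in> borel_measurable P"
    and lim: "\<And>t. (\<lambda>n. \<integral>\<^sup>+ \<omega>. ennreal ((M t \<omega> - (\<Sum>k<n. \<sigma> k * B k t \<omega>))\<^sup>2) \<partial>P) \<longlonglongrightarrow> 0"
    using mm by (auto simp: mmfBm_def)
  define Y where "Y F c k \<omega> = (\<Sum>t\<in>F. c t * B k t \<omega>)" for F and c :: "real \<Rightarrow> real" and k \<omega>
  have g: "centered_gaussian P (Y F c k)" if "finite F" for F c k
    using fB[of k] that by (simp add: fBm_def centered_gaussian_process_def Y_def[abs_def])
  have Y2: "Y F c k \<in> L2 P" if "finite F" for F c k
    using P.centered_gaussian_moments(1)[OF g[OF that]] .
  have B2: "B k t \<in> L2 P" for k t
    using Y2[of "{t}" "\<lambda>_. 1" k] by (simp add: Y_def[abs_def])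
  have cov: "(\<integral>\<omega>. B k t \<omega> * B k s \<omega> \<partial>P) = (\<bar>t\<bar> powr (2 * H k) + \<bar>s\<bar> powr (2 * H k) - \<bar>t - s\<bar> powr (2 * H k)) / 2" for k t s
    using fB[of k] by (simp add: fBm_def)
  have limM: "L2_tendsto P (\<lambda>n \<omega>. \<Sum>k<n. \<sigma> k * B k t \<omega>) (M t)" for t
    by (rule L2_tendstoI_nn_integral[OF _ Mm lim]) (intro L2_sum L2_scale B2)
  then show "M t \<in> L2 P" by (simp add: L2_tendsto_def)
  define v where "v F c k = (\<integral>\<omega>. (Y F c k \<omega>)\<^sup>2 \<partial>P)" for F and c :: "real \<Rightarrow> real" and k
  have v0: "0 \<le> v F c k" for F c k by (simp add: v_def)
  have v_eq: "v F c k = (\<Sum>t\<in>F. \<Sum>s\<in>F. c t * c s * ((\<bar>t\<bar> powr (2 * H k) + \<bar>s\<bar> powr (2 * H k) - \<bar>t - s\<bar> powr (2 * H k)) / 2))"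
    if "finite F" for F c k
  proof -
    have "v F c k = (\<integral>\<omega>. (\<Sum>t\<in>F. \<Sum>s\<in>F. (c t * c s) * (B k t \<omega> * B k s \<omega>)) \<partial>P)"
      unfolding v_def Y_def power2_eq_square sum_product by (simp add: mult_ac)
    also have "\<dots> = (\<Sum>t\<in>F. \<Sum>s\<in>F. (c t * c s) * (\<integral>\<omega>. B k t \<omega> * B k s \<omega> \<partial>P))"
      using L2_mult[OF B2 B2] by (simp add: Bochner_Integration.integral_sum)
    finally show ?thesis by (simp only: cov)
  qed
  have main: "(CLINT \<omega>|P. iexp (\<Sum>t\<in>F. c t * M t \<omega>)) = of_real (exp (- (\<integral>\<omega>. (\<Sum>t\<in>F. c t * M t \<omega>)\<^sup>2 \<partial>P) / 2))
    \<and> (\<lambda>n. \<Sum>k<n. (\<sigma> k)\<^sup>2 * v F c k) \<longlonglongrightarrow> (\<integral>\<omega>. (\<Sum>t\<in>F. c t * M t \<omega>)\<^sup>2 \<partial>P)"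
    if F: "finite F" for F c
  proof -
    define S where "S n \<omega> = (\<Sum>k<n. \<sigma> k * Y F c k \<omega>)" for n \<omega>
    have S2: "S n \<in> L2 P" for n unfolding S_def by (intro L2_sum L2_scale Y2 F)
    have "L2_tendsto P (\<lambda>n \<omega>. \<Sum>t\<in>F. c t * (\<Sum>k<n. \<sigma> k * B k t \<omega>)) (\<lambda>\<omega>. \<Sum>t\<in>F. c t * M t \<omega>)"
      by (rule L2_tendsto_sum) (rule limM)
    moreover have "(\<Sum>t\<in>F. c t * (\<Sum>k<n. \<sigma> k * B k t \<omega>)) = S n \<omega>" for n \<omega>
      unfolding S_def Y_def sum_distrib_left by (subst sum.swap) (simp add: mult_ac)
    ultimately have lS: "L2_tendsto P S (\<lambda>\<omega>. \<Sum>t\<in>F. c t * M t \<omega>)" by simp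
    have ind': "P.indep_vars (\<lambda>_. borel) (\<lambda>k \<omega>. \<sigma> k * Y F c k \<omega>) UNIV"
    proof -
      have "P.indep_vars (\<lambda>_. borel) (\<lambda>k. (\<lambda>x. \<sigma> k * (\<Sum>t\<in>F. c t * x t)) \<circ> (\<lambda>\<omega> t. B k t \<omega>)) UNIV"
        by (rule P.indep_vars_compose[OF ind]) measurable
      then show ?thesis by (simp add: comp_def Y_def)
    qed
    have chS: "(CLINT \<omega>|P. iexp (S n \<omega>)) = of_real (exp (- (\<Sum>k<n. (\<sigma> k)\<^sup>2 * v F c k) / 2))" for n
    proof -
      note [measurable] = S2[THEN L2_measurable] Y2[OF F, THEN L2_measurable]
      have "(CLINT \<omega>|P. iexp (S n \<omega>)) = char (distr P borel (\<lambda>\<omega>. \<Sum>k<n. \<sigma> k * Y F c k \<omega>)) 1"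
        unfolding char_def by (subst integral_distr) (auto simp: S_def)
      also have "\<dots> = (\<Prod>k<n. char (distr P borel (\<lambda>\<omega>. \<sigma> k * Y F c k \<omega>)) 1)"
        by (rule P.char_distr_sum) (rule P.indep_vars_subset[OF ind'], simp)
      also have "\<dots> = (\<Prod>k<n. of_real (exp (- ((\<sigma> k)\<^sup>2 * v F c k) / 2)))"
      proof (rule prod.cong[OF refl])
        fix k
        have "char (distr P borel (\<lambda>\<omega>. \<sigma> k * Y F c k \<omega>)) 1 = (CLINT \<omega>|P. iexp (\<sigma> k * Y F c k \<omega>))"
          unfolding char_def by (subst integral_distr) auto
        then show "char (distr P borel (\<lambda>\<omega>. \<sigma> k * Y F c k \<omega>)) 1 = of_real (exp (- ((\<sigma> k)\<^sup>2 * v F c k) / 2))"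
          using P.centered_gaussian_moments(3)[OF g[OF F]] by (simp add: v_def)
      qed
      also have "\<dots> = of_real (exp (- (\<Sum>k<n. (\<sigma> k)\<^sup>2 * v F c k) / 2))"
        by (simp add: exp_sum[symmetric] sum_negf sum_divide_distrib flip: of_real_prod)
      finally show ?thesis .
    qed
    have orth: "(\<integral>\<omega>. Y F c j \<omega> * Y F c k \<omega> \<partial>P) = 0" if "j \<noteq> k" for j k
    proof -
      have "P.indep_vars (\<lambda>_. borel) (\<lambda>k. (\<lambda>x. \<Sum>t\<in>F. c t * x t) \<circ> (\<lambda>\<omega> t. B k t \<omega>)) UNIV"
        by (rule P.indep_vars_compose[OF ind]) measurable
      then have "P.indep_vars (\<lambda>_. borel) (Y F c) UNIV" by (simp add: comp_def Y_def[abs_def])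
      then have "P.indep_vars (\<lambda>_. borel) (Y F c) {j, k}" by (rule P.indep_vars_subset) simp
      then have "(\<integral>\<omega>. (\<Prod>i\<in>{j, k}. Y F c i \<omega>) \<partial>P) = (\<Prod>i\<in>{j, k}. \<integral>\<omega>. Y F c i \<omega> \<partial>P)"
        by (intro P.indep_vars_lebesgue_integral P.L2_integrable Y2 F) simp_all
      then show ?thesis using that P.centered_gaussian_moments(2)[OF g[OF F]] by simp
    qed
    have ES: "(\<integral>\<omega>. (S n \<omega>)\<^sup>2 \<partial>P) = (\<Sum>k<n. (\<sigma> k)\<^sup>2 * v F c k)" for n
    proof -
      have "(\<integral>\<omega>. (S n \<omega>)\<^sup>2 \<partial>P) = (\<integral>\<omega>. (\<Sum>j<n. \<Sum>k<n. (\<sigma> j * \<sigma> k) * (Y F c j \<omega> * Y F c k \<omega>)) \<partial>P)"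
        unfolding S_def power2_eq_square sum_product by (simp add: mult_ac)
      also have "\<dots> = (\<Sum>j<n. \<Sum>k<n. (\<sigma> j * \<sigma> k) * (\<integral>\<omega>. Y F c j \<omega> * Y F c k \<omega> \<partial>P))"
        using L2_mult[OF Y2[OF F] Y2[OF F]] by (simp add: Bochner_Integration.integral_sum)
      also have "\<dots> = (\<Sum>j<n. \<Sum>k<n. if k = j then (\<sigma> j)\<^sup>2 * v F c j else 0)"
        by (intro sum.cong refl) (auto simp: orth v_def power2_eq_square)
      finally show ?thesis by simp
    qed
    have l2: "(\<lambda>n. \<Sum>k<n. (\<sigma> k)\<^sup>2 * v F c k) \<longlonglongrightarrow> (\<integral>\<omega>. (\<Sum>t\<in>F. c t * M t \<omega>)\<^sup>2 \<partial>P)"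
      using L2_tendsto_square[OF lS] by (simp add: ES)
    have "(CLINT \<omega>|P. iexp (\<Sum>t\<in>F. c t * M t \<omega>)) = of_real (exp (- (\<integral>\<omega>. (\<Sum>t\<in>F. c t * M t \<omega>)\<^sup>2 \<partial>P) / 2))"
    proof (rule LIMSEQ_unique)
      show "(\<lambda>n. CLINT \<omega>|P. iexp (S n \<omega>)) \<longlonglongrightarrow> (CLINT \<omega>|P. iexp (\<Sum>t\<in>F. c t * M t \<omega>))"
        by (rule P.L2_tendsto_iexp[OF lS])
      show "(\<lambda>n. CLINT \<omega>|P. iexp (S n \<omega>)) \<longlonglongrightarrow> of_real (exp (- (\<integral>\<omega>. (\<Sum>t\<in>F. c t * M t \<omega>)\<^sup>2 \<partial>P) / 2))"
        unfolding chS by (intro tendsto_intros l2) auto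
    qed
    with l2 show ?thesis by simp
  qed
  show "(CLINT \<omega>|P. iexp (\<Sum>t\<in>F. c t * M t \<omega>)) = of_real (exp (- (\<integral>\<omega>. (\<Sum>t\<in>F. c t * M t \<omega>)\<^sup>2 \<partial>P) / 2))"
    if "finite F" using main[OF that] by blast
  show "(\<sigma> 0)\<^sup>2 * (\<Sum>t\<in>F. \<Sum>s\<in>F. c t * c s * ((\<bar>t\<bar> powr (2 * H 0) + \<bar>s\<bar> powr (2 * H 0) - \<bar>t - s\<bar> powr (2 * H 0)) / 2)) \<le>
        (\<integral>\<omega>. (\<Sum>t\<in>F. c t * M t \<omega>)\<^sup>2 \<partial>P)" if F: "finite F"
    unfolding v_eq[OF F, symmetric]
  proof (rule LIMSEQ_le_const)
    show "(\<lambda>n. \<Sum>k<n. (\<sigma> k)\<^sup>2 * v F c k) \<longlonglongrightarrow> (\<integral>\<omega>. (\<Sum>t\<in>F. c t * M t \<omega>)\<^sup>2 \<partial>P)"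
      using main[OF F] by blast
    have "(\<sigma> 0)\<^sup>2 * v F c 0 \<le> (\<Sum>k<n. (\<sigma> k)\<^sup>2 * v F c k)" if "1 \<le> n" for n
      using member_le_sum[of 0 "{..<n}" "\<lambda>k. (\<sigma> k)\<^sup>2 * v F c k"] that v0 by simp
    then show "\<exists>N. \<forall>n\<ge>N. (\<sigma> 0)\<^sup>2 * v F c 0 \<le> (\<Sum>k<n. (\<sigma> k)\<^sup>2 * v F c k)" by blast
  qed
  show "(\<integral>\<omega>. (M t \<omega>)\<^sup>2 \<partial>P) \<le> (\<Sum>k. (\<sigma> k)\<^sup>2) * (1 + t\<^sup>2)"
  proof (rule LIMSEQ_le_const2)
    show "(\<lambda>n. \<Sum>k<n. (\<sigma> k)\<^sup>2 * v {t} (\<lambda>_. 1) k) \<longlonglongrightarrow> (\<integral>\<omega>. (M t \<omega>)\<^sup>2 \<partial>P)"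
      using main[of "{t}" "\<lambda>_. 1"] by simp
    have "(\<Sum>k<n. (\<sigma> k)\<^sup>2 * v {t} (\<lambda>_. 1) k) \<le> (\<Sum>k. (\<sigma> k)\<^sup>2) * (1 + t\<^sup>2)" for n
    proof -
      have "v {t} (\<lambda>_. 1) k \<le> 1 + t\<^sup>2" for k
        unfolding v_eq[of "{t}", simplified] using powr_le_one_plus_square[of "H k" t] par by (simp add: mmfBm_params_def)
      then have "(\<Sum>k<n. (\<sigma> k)\<^sup>2 * v {t} (\<lambda>_. 1) k) \<le> (\<Sum>k<n. (\<sigma> k)\<^sup>2 * (1 + t\<^sup>2))"
        by (intro sum_mono mult_left_mono) auto
      also have "\<dots> = (\<Sum>k<n. (\<sigma> k)\<^sup>2) * (1 + t\<^sup>2)" by (simp add: sum_distrib_right)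
      also have "\<dots> \<le> (\<Sum>k. (\<sigma> k)\<^sup>2) * (1 + t\<^sup>2)"
        using par by (intro mult_right_mono sum_le_suminf) (auto simp: mmfBm_params_def)
      finally show ?thesis .
    qed
    then show "\<exists>N. \<forall>n\<ge>N. (\<Sum>k<n. (\<sigma> k)\<^sup>2 * v {t} (\<lambda>_. 1) k) \<le> (\<Sum>k. (\<sigma> k)\<^sup>2) * (1 + t\<^sup>2)" by blast
  qed
qed

lemma mmfBm_admissible_polynomial:
  fixes r :: "nat \<Rightarrow> real"
  assumes P: "prob_space P" and mm: "mmfBm P \<sigma> H B M" and q: "0 \<le> q" and l: "0 < l"
  obtains h where "admissible_shift P I M h" "\<And>t. t \<le> q + l \<Longrightarrow> h t = (\<Sum>k<n. r k * max 0 (t - q) ^ Suc k)"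
    "h \<in> borel_measurable borel"
proof -
  have H0: "0 < H 0" "H 0 < 1" and \<sigma>0: "0 < \<sigma> 0" using mm by (auto simp: mmfBm_def mmfBm_params_def)
  define R where "R F c = (\<Sum>t\<in>F. \<Sum>s\<in>F. c t * c s * ((\<bar>t\<bar> powr (2 * H 0) + \<bar>s\<bar> powr (2 * H 0) - \<bar>t - s\<bar> powr (2 * H 0)) / 2))"
    for F and c :: "real \<Rightarrow> real"
  obtain C h where C: "0 \<le> C" and hb: "\<And>F c. finite F \<Longrightarrow> (\<Sum>t\<in>F. c t * h t)\<^sup>2 \<le> C * R F c"
    and h: "\<And>t. t \<le> q + l \<Longrightarrow> h t = (\<Sum>k<n. r k * max 0 (t - q) ^ Suc k)" and hm: "h \<in> borel_measurable borel"
    unfolding R_def by (rule fBm_kernel_polynomial[OF H0 q l, where n=n and r=r]) blast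
  note G = mmfBm_gaussian[OF P mm]
  have "admissible_shift P I M h"
  \<comment> \<open>The kernel space of the component of index 0 is compared with that of M at the
    price of the factor 1 / \<open>(\<sigma> 0)\<^sup>2\<close>.\<close>
  proof (rule gaussian_admissible_shift[OF P G(1) G(2), where C="C / (\<sigma> 0)\<^sup>2"])
    fix F :: "real set" and c assume F: "finite F"
    have "(\<Sum>t\<in>F. c t * h t)\<^sup>2 \<le> C / (\<sigma> 0)\<^sup>2 * ((\<sigma> 0)\<^sup>2 * R F c)"
      using hb[OF F, of c] \<sigma>0 by simp
    also have "\<dots> \<le> C / (\<sigma> 0)\<^sup>2 * (\<integral>\<omega>. (\<Sum>t\<in>F. c t * M t \<omega>)\<^sup>2 \<partial>P)"
      unfolding R_def by (rule mult_left_mono[OF G(3)[OF F]]) (use C in simp)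
    finally show "(\<Sum>t\<in>F. c t * h t)\<^sup>2 \<le> C / (\<sigma> 0)\<^sup>2 * (\<integral>\<omega>. (\<Sum>t\<in>F. c t * M t \<omega>)\<^sup>2 \<partial>P)" .
  qed (use C in auto)
  with h hm show ?thesis using that by blast
qed

section \<open>Shifting the Ornstein--Uhlenbeck process\<close>

text \<open>The random time is approximated by times in a countable grid, where evaluation is
  measurable; continuity of the paths gives the limit. With a product space for \<open>N\<close>
  this also yields joint measurability in time and sample point.\<close>

lemma borel_measurable_continuous_eval:
  fixes Y :: "real \<Rightarrow> 'b \<Rightarrow> real"
  assumes Y: "\<And>t. Y t \<in> borel_measurable N" and \<sigma>[measurable]: "\<sigma> \<in> borel_measurable N"
    and cont: "\<And>x. x \<in> space N \<Longrightarrow> continuous_on UNIV (\<lambda>t. Y t x)"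
  shows "(\<lambda>x. Y (\<sigma> x) x) \<in> borel_measurable N"
proof (rule borel_measurable_LIMSEQ_real)
  note [measurable] = Y
  show "(\<lambda>x. Y (real_of_int \<lfloor>real (Suc n) * \<sigma> x\<rfloor> / real (Suc n)) x) \<in> borel_measurable N" for n
  proof (rule measurable_compose_countable[where g="\<lambda>x. \<lfloor>real (Suc n) * \<sigma> x\<rfloor>" and f="\<lambda>i x. Y (real_of_int i / real (Suc n)) x"])
    show "Y (real_of_int i / real (Suc n)) \<in> borel_measurable N" for i by (rule Y)
  qed measurable
  fix x assume x: "x \<in> space N"
  have l: "(\<lambda>n. real_of_int \<lfloor>real (Suc n) * \<sigma> x\<rfloor> / real (Suc n)) \<longlonglongrightarrow> \<sigma> x"
  proof (rule LIM_zero_cancel, rule Lim_null_comparison)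
    show "\<forall>\<^sub>F n in sequentially. norm (real_of_int \<lfloor>real (Suc n) * \<sigma> x\<rfloor> / real (Suc n) - \<sigma> x) \<le> 1 / real (Suc n)"
    proof (rule always_eventually, rule allI)
      fix n
      have "\<bar>real_of_int \<lfloor>real (Suc n) * \<sigma> x\<rfloor> - real (Suc n) * \<sigma> x\<bar> \<le> 1" by linarith
      then have "\<bar>(real_of_int \<lfloor>real (Suc n) * \<sigma> x\<rfloor> - real (Suc n) * \<sigma> x) / real (Suc n)\<bar> \<le> 1 / real (Suc n)"
        unfolding abs_divide by (simp add: divide_right_mono del: of_nat_Suc)
      then show "norm (real_of_int \<lfloor>real (Suc n) * \<sigma> x\<rfloor> / real (Suc n) - \<sigma> x) \<le> 1 / real (Suc n)"
        by (simp add: diff_divide_distrib del: of_nat_Suc)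
    qed
  qed (rule LIMSEQ_Suc[OF lim_1_over_n])
  have "isCont (\<lambda>t. Y t x) (\<sigma> x)" using cont[OF x] by (simp add: continuous_on_eq_continuous_at)
  from isCont_tendsto_compose[OF this l]
  show "(\<lambda>n. Y (real_of_int \<lfloor>real (Suc n) * \<sigma> x\<rfloor> / real (Suc n)) x) \<longlonglongrightarrow> Y (\<sigma> x) x" .
qed

text \<open>The substitution x = \<open>\<theta> * (t - s)\<close> leads to Gamma integrals with
  powers 0, 1 and 2.\<close>

lemma integrable_exp_quadratic:
  fixes \<theta> t A K :: real
  assumes \<theta>: "0 < \<theta>"
  shows "integrable lborel (\<lambda>s. indicator {..t} s * (exp (- \<theta> * (t - s)) * (A + K * s\<^sup>2)))"
proof -
  have p: "integrable lborel (\<lambda>x::real. x ^ k * exp (- x) * indicator {0..} x)" for k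
    using has_bochner_integral_I0i_power_exp_m'[of k] by (rule integrable.intros)
  have "integrable lborel (\<lambda>x::real. (A + K * t\<^sup>2) * (x ^ 0 * exp (- x) * indicator {0..} x) - (2 * K * t / \<theta>) * (x ^ 1 * exp (- x) * indicator {0..} x)
      + (K / \<theta>\<^sup>2) * (x ^ 2 * exp (- x) * indicator {0..} x))"
    by (intro Bochner_Integration.integrable_add Bochner_Integration.integrable_diff integrable_mult_right p)
  also have "(\<lambda>x::real. (A + K * t\<^sup>2) * (x ^ 0 * exp (- x) * indicator {0..} x) - (2 * K * t / \<theta>) * (x ^ 1 * exp (- x) * indicator {0..} x)
      + (K / \<theta>\<^sup>2) * (x ^ 2 * exp (- x) * indicator {0..} x)) = (\<lambda>x. indicator {0..} x * (exp (- x) * (A + K * (t - x / \<theta>)\<^sup>2)))"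
    using \<theta> by (auto simp: power2_eq_square field_simps)
  finally have "integrable lborel (\<lambda>x. indicator {0..} x * (exp (- x) * (A + K * (t - x / \<theta>)\<^sup>2)))" .
  then have "integrable lborel (\<lambda>s. indicator {0..} (\<theta> * t + (- \<theta>) * s) * (exp (- (\<theta> * t + (- \<theta>) * s)) * (A + K * (t - (\<theta> * t + (- \<theta>) * s) / \<theta>)\<^sup>2)))"
    by (rule lborel_integrable_real_affine) (use \<theta> in simp)
  also have "(\<lambda>s. indicator {0..} (\<theta> * t + (- \<theta>) * s) * (exp (- (\<theta> * t + (- \<theta>) * s)) * (A + K * (t - (\<theta> * t + (- \<theta>) * s) / \<theta>)\<^sup>2))) =
      (\<lambda>s. indicator {..t} s * (exp (- \<theta> * (t - s)) * (A + K * s\<^sup>2)))"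
  proof
    fix s
    have "(\<theta> * t + (- \<theta>) * s) / \<theta> = t - s" using \<theta> by (simp add: field_simps)
    moreover have "\<theta> * t + (- \<theta>) * s = \<theta> * (t - s)" by (simp add: algebra_simps)
    moreover have "0 \<le> \<theta> * (t - s) \<longleftrightarrow> s \<le> t" using \<theta> by (simp add: zero_le_mult_iff)
    ultimately show "indicator {0..} (\<theta> * t + (- \<theta>) * s) * (exp (- (\<theta> * t + (- \<theta>) * s)) * (A + K * (t - (\<theta> * t + (- \<theta>) * s) / \<theta>)\<^sup>2)) =
        indicator {..t} s * (exp (- \<theta> * (t - s)) * (A + K * s\<^sup>2))"
      by (simp add: indicator_def)
  qed
  finally show ?thesis .
qed

text \<open>Tonelli: E|X_s| <= 1 + E(X_s^2) grows at most quadratically in s, so the weighted path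
  integral has finite expectation. Integrability guards against the default value 0 of the integral
  in \<open>mmfOU\<close>, which would destroy linearity in the path.\<close>

lemma (in prob_space) AE_set_integrable_exp_weight:
  fixes X :: "real \<Rightarrow> 'a \<Rightarrow> real"
  assumes \<theta>: "0 < \<theta>" and X2: "\<And>s. X s \<in> L2 M"
    and cont: "\<And>\<omega>. \<omega> \<in> space M \<Longrightarrow> continuous_on UNIV (\<lambda>s. X s \<omega>)"
    and le: "\<And>s. expectation (\<lambda>\<omega>. (X s \<omega>)\<^sup>2) \<le> K * (1 + s\<^sup>2)"
  shows "AE \<omega> in M. set_integrable lborel {..t} (\<lambda>s. exp (- \<theta> * (t - s)) * X s \<omega>)"
proof -
  note [measurable] = X2[THEN L2_measurable]
  have [measurable]: "(\<lambda>p. X (fst p) (snd p)) \<in> borel_measurable (lborel \<Otimes>\<^sub>M M)"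
    by (rule borel_measurable_continuous_eval[where Y="\<lambda>t p. X t (snd p)"]) (auto simp: space_pair_measure intro: cont)
  have [measurable]: "(\<lambda>s. X s \<omega>) \<in> borel_measurable borel" if "\<omega> \<in> space M" for \<omega>
    using cont[OF that] by (rule borel_measurable_continuous_onI)
  have [measurable]: "(\<lambda>p. X (snd p) (fst p)) \<in> borel_measurable (M \<Otimes>\<^sub>M lborel)"
    by (rule borel_measurable_continuous_eval[where Y="\<lambda>t p. X t (fst p)"]) (auto simp: space_pair_measure intro: cont)
  interpret pair_sigma_finite lborel M ..
  define w where "w s = indicator {..t} s * exp (- \<theta> * (t - s))" for s
  have [measurable]: "w \<in> borel_measurable borel" unfolding w_def by measurable
  have w0: "0 \<le> w s" for s by (simp add: w_def)
  have E1: "(\<integral>\<^sup>+\<omega>. ennreal \<bar>X s \<omega>\<bar> \<partial>M) \<le> ennreal ((1 + K) + K * s\<^sup>2)" for s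
  proof -
    have "\<bar>x\<bar> \<le> 1 + x\<^sup>2" for x :: real
      using sum_squares_bound[of 1 "\<bar>x\<bar>"] by simp
    then have "(\<integral>\<^sup>+\<omega>. ennreal \<bar>X s \<omega>\<bar> \<partial>M) \<le> (\<integral>\<^sup>+\<omega>. ennreal (1 + (X s \<omega>)\<^sup>2) \<partial>M)"
      by (intro nn_integral_mono ennreal_leI)
    also have "\<dots> = ennreal (expectation (\<lambda>\<omega>. 1 + (X s \<omega>)\<^sup>2))"
      by (rule nn_integral_eq_integral) (use L2_square[OF X2] in auto)
    also have "expectation (\<lambda>\<omega>. 1 + (X s \<omega>)\<^sup>2) = 1 + expectation (\<lambda>\<omega>. (X s \<omega>)\<^sup>2)"
      using L2_square[OF X2] by (simp add: prob_space)
    also have "ennreal \<dots> \<le> ennreal ((1 + K) + K * s\<^sup>2)"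
      using le[of s] by (intro ennreal_leI) (simp add: algebra_simps)
    finally show ?thesis .
  qed
  have "(\<integral>\<^sup>+\<omega>. \<integral>\<^sup>+s. ennreal (w s) * ennreal \<bar>X s \<omega>\<bar> \<partial>lborel \<partial>M) = (\<integral>\<^sup>+s. \<integral>\<^sup>+\<omega>. ennreal (w s) * ennreal \<bar>X s \<omega>\<bar> \<partial>M \<partial>lborel)"
    by (rule Fubini') (simp add: case_prod_beta)
  also have "\<dots> = (\<integral>\<^sup>+s. ennreal (w s) * (\<integral>\<^sup>+\<omega>. ennreal \<bar>X s \<omega>\<bar> \<partial>M) \<partial>lborel)"
    by (intro nn_integral_cong nn_integral_cmult) measurable
  also have "\<dots> \<le> (\<integral>\<^sup>+s. ennreal (w s) * ennreal ((1 + K) + K * s\<^sup>2) \<partial>lborel)"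
    by (intro nn_integral_mono mult_left_mono E1) simp
  also have "\<dots> = (\<integral>\<^sup>+s. ennreal (indicator {..t} s * (exp (- \<theta> * (t - s)) * ((1 + K) + K * s\<^sup>2))) \<partial>lborel)"
    by (intro nn_integral_cong) (simp add: w_def ennreal_mult'[symmetric] mult.assoc)
  also have "\<dots> \<le> (\<integral>\<^sup>+s. ennreal (norm (indicator {..t} s * (exp (- \<theta> * (t - s)) * ((1 + K) + K * s\<^sup>2)))) \<partial>lborel)"
    by (intro nn_integral_mono ennreal_leI) (simp only: real_norm_def abs_ge_self)
  also have "\<dots> < \<infinity>"
    using integrable_exp_quadratic[OF \<theta>, of t "1 + K" K] unfolding integrable_iff_bounded by blast
  finally have fin: "(\<integral>\<^sup>+\<omega>. \<integral>\<^sup>+s. ennreal (w s) * ennreal \<bar>X s \<omega>\<bar> \<partial>lborel \<partial>M) < \<infinity>" .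
  have "AE \<omega> in M. (\<integral>\<^sup>+s. ennreal (w s) * ennreal \<bar>X s \<omega>\<bar> \<partial>lborel) \<noteq> \<infinity>"
    by (rule nn_integral_noteq_infinite) (use fin in \<open>auto simp: case_prod_beta intro!: lborel.borel_measurable_nn_integral\<close>)
  moreover have "AE \<omega> in M. \<omega> \<in> space M" by simp
  ultimately show ?thesis
  proof eventually_elim
    case (elim \<omega>)
    show ?case
      unfolding set_integrable_def
    proof (rule integrableI_bounded)
      have "(\<integral>\<^sup>+s. ennreal (norm (indicator {..t} s *\<^sub>R (exp (- \<theta> * (t - s)) * X s \<omega>))) \<partial>lborel) = (\<integral>\<^sup>+s. ennreal (w s) * ennreal \<bar>X s \<omega>\<bar> \<partial>lborel)"
        by (intro nn_integral_cong) (simp add: w_def abs_mult ennreal_mult[symmetric] mult.assoc)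
      then show "(\<integral>\<^sup>+s. ennreal (norm (indicator {..t} s *\<^sub>R (exp (- \<theta> * (t - s)) * X s \<omega>))) \<partial>lborel) < \<infinity>"
        using elim by (simp add: less_top)
    qed (use elim in measurable)
  qed
qed

text \<open>The stationary Ornstein--Uhlenbeck map as a functional measurable for the product
  \<open>\<sigma>\<close>-algebra: the integral of a continuous path is a limit of integrals of step functions.\<close>

definition ou_step :: "real \<Rightarrow> real \<Rightarrow> nat \<Rightarrow> nat \<Rightarrow> (real \<Rightarrow> real) \<Rightarrow> real" where
  "ou_step \<theta> t N n x =
     (\<integral>s. indicator {t - real N..t} s * (exp (- \<theta> * (t - s)) * x (t - real_of_int \<lfloor>real (Suc n) * (t - s)\<rfloor> / real (Suc n))) \<partial>lborel)"

definition ou_map :: "real \<Rightarrow> real \<Rightarrow> (real \<Rightarrow> real) \<Rightarrow> real" where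
  "ou_map \<theta> t x = x t - \<theta> * lim (\<lambda>N. lim (\<lambda>n. ou_step \<theta> t N n x))"

text \<open>On the space of all real functions, evaluation at a variable time is not jointly
  measurable for the product sigma-algebra. Each \<open>ou_step\<close> reads the path on a
  countable grid only, and sequential limits preserve measurability.\<close>

lemma ou_map_measurable[measurable]: "ou_map \<theta> t \<in> borel_measurable (PiM UNIV (\<lambda>_. borel))"
proof -
  have "(\<lambda>p. (fst p) (t - real_of_int \<lfloor>real (Suc n) * (t - snd p)\<rfloor> / real (Suc n))) \<in> borel_measurable (PiM UNIV (\<lambda>_. borel) \<Otimes>\<^sub>M lborel)" for n
  proof (rule measurable_compose_countable[where g="\<lambda>p. \<lfloor>real (Suc n) * (t - snd p)\<rfloor>" and f="\<lambda>i p. (fst p) (t - real_of_int i / real (Suc n))"])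
    fix i :: int
    show "(\<lambda>p. fst p (t - real_of_int i / real (Suc n))) \<in> borel_measurable (PiM UNIV (\<lambda>_. borel) \<Otimes>\<^sub>M lborel)"
      by (rule measurable_compose[OF measurable_fst]) measurable
  qed measurable
  note [measurable] = this
  have [measurable]: "ou_step \<theta> t N n \<in> borel_measurable (PiM UNIV (\<lambda>_. borel))" for N n
    unfolding ou_step_def[abs_def] by (rule lborel.borel_measurable_lebesgue_integral) (simp add: case_prod_beta)
  show ?thesis unfolding ou_map_def[abs_def] by measurable
qed

text \<open>Dominated convergence twice: on a bounded window the continuous path is bounded, and
  then the window grows below an integrable majorant.\<close>

lemma ou_map_eq:
  fixes x :: "real \<Rightarrow> real"
  assumes cont: "continuous_on {..t} x" and int: "set_integrable lborel {..t} (\<lambda>s. exp (- \<theta> * (t - s)) * x s)"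
    and [measurable]: "x \<in> borel_measurable borel"
  shows "ou_map \<theta> t x = x t - \<theta> * (LINT s:{..t}|lborel. exp (- \<theta> * (t - s)) * x s)"
proof -
  have 1: "(\<lambda>n. ou_step \<theta> t N n x) \<longlonglongrightarrow> (\<integral>s. indicator {t - real N..t} s * (exp (- \<theta> * (t - s)) * x s) \<partial>lborel)" for N
  proof -
    have c: "continuous_on {t - real N..t} x" using cont by (rule continuous_on_subset) auto
    then have "compact (x ` {t - real N..t})" by (rule compact_continuous_image) simp
    then obtain B where B: "\<And>s. s \<in> {t - real N..t} \<Longrightarrow> \<bar>x s\<bar> \<le> B"
      using compact_imp_bounded by (force simp: bounded_iff)
    \<comment> \<open>Rounding \<open>t - s\<close> down keeps the grid point between
      \<open>s\<close> and \<open>t\<close>, where the path is known to be continuous.\<close>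
    define r where "r n s = t - real_of_int \<lfloor>real (Suc n) * (t - s)\<rfloor> / real (Suc n)" for n s
    have r: "s \<le> r n s" "r n s \<le> s + 1 / real (Suc n)" "s \<le> t \<Longrightarrow> r n s \<le> t" for n s
    proof -
      have "real_of_int \<lfloor>real (Suc n) * (t - s)\<rfloor> \<le> real (Suc n) * (t - s)" by linarith
      then have "real_of_int \<lfloor>real (Suc n) * (t - s)\<rfloor> / real (Suc n) \<le> t - s" by (simp add: field_simps del: of_nat_Suc)
      then show "s \<le> r n s" by (simp add: r_def)
      have "real (Suc n) * (t - s) - 1 \<le> real_of_int \<lfloor>real (Suc n) * (t - s)\<rfloor>" by linarith
      then have "(real (Suc n) * (t - s) - 1) / real (Suc n) \<le> real_of_int \<lfloor>real (Suc n) * (t - s)\<rfloor> / real (Suc n)"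
        by (rule divide_right_mono) simp
      then show "r n s \<le> s + 1 / real (Suc n)" by (simp add: r_def diff_divide_distrib del: of_nat_Suc)
      show "r n s \<le> t" if "s \<le> t" using that by (simp add: r_def)
    qed
    have [measurable]: "r n \<in> borel_measurable borel" for n unfolding r_def[abs_def] by measurable
    have rl: "(\<lambda>n. r n s) \<longlonglongrightarrow> s" for s
    proof (rule real_tendsto_sandwich[where f="\<lambda>_. s" and h="\<lambda>n. s + 1 / real (Suc n)"])
      show "(\<lambda>n. s + 1 / real (Suc n)) \<longlonglongrightarrow> s"
        using tendsto_add[OF tendsto_const LIMSEQ_Suc[OF lim_1_over_n], of s] by simp
    qed (use r in auto)
    show ?thesis
      unfolding ou_step_def r_def[symmetric]
    proof (rule integral_dominated_convergence[where w="\<lambda>s. indicator {t - real N..t} s * (exp (- \<theta> * (t - s)) * B)"])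
      show "integrable lborel (\<lambda>s. indicator {t - real N..t} s * (exp (- \<theta> * (t - s)) * B))"
        using borel_integrable_compact[of "{t - real N..t}" "\<lambda>s. exp (- \<theta> * (t - s)) * B"]
        by (simp add: mult.commute[of "indicator _ _"] indicator_scaleR_eq_if[symmetric] continuous_intros) 
      show "AE s in lborel. (\<lambda>n. indicator {t - real N..t} s * (exp (- \<theta> * (t - s)) * x (r n s))) \<longlonglongrightarrow> indicator {t - real N..t} s * (exp (- \<theta> * (t - s)) * x s)"
      proof (rule AE_I2)
        fix s
        show "(\<lambda>n. indicator {t - real N..t} s * (exp (- \<theta> * (t - s)) * x (r n s))) \<longlonglongrightarrow> indicator {t - real N..t} s * (exp (- \<theta> * (t - s)) * x s)"
        proof (cases "s \<in> {t - real N..t}")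
          case True
          have "(\<lambda>n. x (r n s)) \<longlonglongrightarrow> x s"
            by (rule continuous_on_tendsto_compose[OF cont rl]) (use True r in auto)
          then show ?thesis by (intro tendsto_intros)
        qed simp
      qed
      show "AE s in lborel. norm (indicator {t - real N..t} s * (exp (- \<theta> * (t - s)) * x (r n s))) \<le> indicator {t - real N..t} s * (exp (- \<theta> * (t - s)) * B)" for n
      proof (rule AE_I2)
        fix s
        have "s \<in> {t - real N..t} \<Longrightarrow> \<bar>x (r n s)\<bar> \<le> B" using r(1)[where n=n and s=s] r(3)[where n=n and s=s] by (intro B) auto
        then show "norm (indicator {t - real N..t} s * (exp (- \<theta> * (t - s)) * x (r n s))) \<le> indicator {t - real N..t} s * (exp (- \<theta> * (t - s)) * B)"
          by (auto simp: abs_mult split: split_indicator)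
      qed
    qed measurable
  qed
  have 2: "(\<lambda>N. \<integral>s. indicator {t - real N..t} s * (exp (- \<theta> * (t - s)) * x s) \<partial>lborel) \<longlonglongrightarrow> (LINT s:{..t}|lborel. exp (- \<theta> * (t - s)) * x s)"
    unfolding set_lebesgue_integral_def
  proof (rule integral_dominated_convergence[where w="\<lambda>s. \<bar>indicator {..t} s *\<^sub>R (exp (- \<theta> * (t - s)) * x s)\<bar>"])
    show "integrable lborel (\<lambda>s. \<bar>indicator {..t} s *\<^sub>R (exp (- \<theta> * (t - s)) * x s)\<bar>)"
      using int unfolding set_integrable_def by (rule integrable_abs)
    show "AE s in lborel. (\<lambda>N. indicator {t - real N..t} s * (exp (- \<theta> * (t - s)) * x s)) \<longlonglongrightarrow> indicator {..t} s *\<^sub>R (exp (- \<theta> * (t - s)) * x s)"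
    proof (rule AE_I2)
      fix s
      obtain N0 where "t - s \<le> real N0" using real_arch_simple by blast
      then have "indicator {t - real N..t} s = (indicator {..t} s :: real)" if "N \<ge> N0" for N
        using that by (auto split: split_indicator)
      then show "(\<lambda>N. indicator {t - real N..t} s * (exp (- \<theta> * (t - s)) * x s)) \<longlonglongrightarrow> indicator {..t} s *\<^sub>R (exp (- \<theta> * (t - s)) * x s)"
        by (intro tendsto_eventually) (auto simp: eventually_sequentially)
    qed
    show "AE s in lborel. norm (indicator {t - real N..t} s * (exp (- \<theta> * (t - s)) * x s)) \<le> \<bar>indicator {..t} s *\<^sub>R (exp (- \<theta> * (t - s)) * x s)\<bar>" for N
      by (rule AE_I2) (auto split: split_indicator)
  qed measurable
  show ?thesis
    unfolding ou_map_def limI[OF 1] limI[OF 2] ..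
qed

text \<open>A law on the product sigma-algebra is determined by finite linear combinations, so the
  exceptional null set may depend on the index.\<close>

lemma modification_distr_eq:
  fixes V W :: "'i \<Rightarrow> 'a \<Rightarrow> real"
  assumes Q: "prob_space Q" and V: "\<And>i. i \<in> I \<Longrightarrow> V i \<in> borel_measurable Q" and W: "\<And>i. i \<in> I \<Longrightarrow> W i \<in> borel_measurable Q"
    and eq: "\<And>i. i \<in> I \<Longrightarrow> AE \<omega> in Q. V i \<omega> = W i \<omega>"
  shows "distr Q (PiM I (\<lambda>_. borel)) (\<lambda>\<omega>. \<lambda>i\<in>I. V i \<omega>) = distr Q (PiM I (\<lambda>_. borel)) (\<lambda>\<omega>. \<lambda>i\<in>I. W i \<omega>)"
proof (rule cramer_wold_process[OF Q Q V W])
  fix F and c :: "'i \<Rightarrow> real" assume F: "finite F" "F \<subseteq> I"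
  have "AE \<omega> in Q. \<forall>i\<in>F. V i \<omega> = W i \<omega>"
    using F eq by (subst AE_finite_all) auto
  then have ae: "AE \<omega> in Q. iexp (\<Sum>i\<in>F. c i * V i \<omega>) = iexp (\<Sum>i\<in>F. c i * W i \<omega>)"
    by eventually_elim simp
  have [measurable]: "(\<lambda>\<omega>. \<Sum>i\<in>F. c i * V i \<omega>) \<in> borel_measurable Q" "(\<lambda>\<omega>. \<Sum>i\<in>F. c i * W i \<omega>) \<in> borel_measurable Q"
    using F V W by (auto intro!: borel_measurable_sum borel_measurable_times)
  show "(CLINT \<omega>|Q. iexp (\<Sum>i\<in>F. c i * V i \<omega>)) = (CLINT \<omega>|Q. iexp (\<Sum>i\<in>F. c i * W i \<omega>))"
    by (rule integral_cong_AE) (measurable, rule ae)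
qed auto

text \<open>U_t is almost surely \<open>ou_map\<close> of M, and this map is linear on continuous
  paths with integrable weight. Subtracting \<open>h\<close> from M therefore subtracts the stated
  function from U, and the law identity for M on the whole line is pushed forward.\<close>

lemma admissible_shift_ou:
  fixes M U :: "real \<Rightarrow> 'a \<Rightarrow> real"
  assumes P: "prob_space P" and ou: "mmfOU P \<theta> M U" and \<theta>: "0 < \<theta>"
    and Mm: "\<And>t. M t \<in> L2 P" and Mc: "continuous_paths P M"
    and Mle: "\<And>t. (\<integral>\<omega>. (M t \<omega>)\<^sup>2 \<partial>P) \<le> K * (1 + t\<^sup>2)"
    and adm: "admissible_shift P UNIV M h"
    and hc: "continuous_on {..T} h" and h0: "\<And>t. t \<le> q \<Longrightarrow> h t = 0" and [measurable]: "h \<in> borel_measurable borel"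
    and I: "I \<subseteq> {..T}"
  shows "admissible_shift P I U (\<lambda>t. h t - \<theta> * (LINT s:{..t}|lborel. exp (- \<theta> * (t - s)) * h s))"
proof -
  interpret P: prob_space P by fact
  note [measurable] = Mm[THEN L2_measurable]
  define g where "g t = h t - \<theta> * (LINT s:{..t}|lborel. exp (- \<theta> * (t - s)) * h s)" for t
  have Mcont: "continuous_on UNIV (\<lambda>t. M t \<omega>)" if "\<omega> \<in> space P" for \<omega>
    using Mc that by (simp add: continuous_paths_def)
  have Um[measurable]: "\<And>t. U t \<in> borel_measurable P" and Ueq: "\<And>t. AE \<omega> in P. U t \<omega> = M t \<omega> - \<theta> * (LINT s:{..t}|lborel. exp (- \<theta> * (t - s)) * M s \<omega>)"
    using ou by (auto simp: mmfOU_def)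
  have hint: "set_integrable lborel {..t} (\<lambda>s. exp (- \<theta> * (t - s)) * h s)" if "t \<le> T" for t
  proof -
    have "continuous_on {q..t} (\<lambda>s. exp (- \<theta> * (t - s)) * h s)"
      by (intro continuous_intros continuous_on_subset[OF hc]) (use that in auto)
    then have "set_integrable lborel {q..t} (\<lambda>s. exp (- \<theta> * (t - s)) * h s)"
      unfolding set_integrable_def by (intro borel_integrable_compact) auto
    moreover have "indicator {q..t} s *\<^sub>R (exp (- \<theta> * (t - s)) * h s) = indicator {..t} s *\<^sub>R (exp (- \<theta> * (t - s)) * h s)" for s
      using h0[of s] by (auto split: split_indicator)
    ultimately show ?thesis unfolding set_integrable_def by (simp only:)
  qed
  have Mint: "AE \<omega> in P. set_integrable lborel {..t} (\<lambda>s. exp (- \<theta> * (t - s)) * M s \<omega>)" for t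
    by (rule P.AE_set_integrable_exp_weight[OF \<theta> Mm Mcont Mle])
  have 1: "AE \<omega> in P. U t \<omega> = ou_map \<theta> t (\<lambda>t. M t \<omega>)" for t
    using Ueq[of t] Mint[of t] AE_space
  proof eventually_elim
    case (elim \<omega>)
    note c = Mcont[OF elim(3)]
    have "ou_map \<theta> t (\<lambda>t. M t \<omega>) = M t \<omega> - \<theta> * (LINT s:{..t}|lborel. exp (- \<theta> * (t - s)) * M s \<omega>)"
      by (rule ou_map_eq) (use elim c in \<open>auto intro: continuous_on_subset[OF c] borel_measurable_continuous_onI\<close>)
    with elim show ?case by simp
  qed
  have 2: "AE \<omega> in P. U t \<omega> - g t = ou_map \<theta> t (\<lambda>t. M t \<omega> - h t)" if t: "t \<le> T" for t
    using Ueq[of t] Mint[of t] AE_space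
  proof eventually_elim
    case (elim \<omega>)
    note c = Mcont[OF elim(3)]
    have [measurable]: "(\<lambda>s. M s \<omega>) \<in> borel_measurable borel"
      by (rule borel_measurable_continuous_onI[OF c])
    have si: "set_integrable lborel {..t} (\<lambda>s. exp (- \<theta> * (t - s)) * M s \<omega> - exp (- \<theta> * (t - s)) * h s)"
      by (rule set_integral_diff(1)[OF elim(2) hint[OF t]])
    have "ou_map \<theta> t (\<lambda>t. M t \<omega> - h t) = M t \<omega> - h t - \<theta> * (LINT s:{..t}|lborel. exp (- \<theta> * (t - s)) * (M s \<omega> - h s))"
    proof (rule ou_map_eq)
      show "continuous_on {..t} (\<lambda>t. M t \<omega> - h t)"
        using t by (intro continuous_intros continuous_on_subset[OF c] continuous_on_subset[OF hc]) auto
      show "set_integrable lborel {..t} (\<lambda>s. exp (- \<theta> * (t - s)) * (M s \<omega> - h s))"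
        using si by (simp only: right_diff_distrib)
    qed measurable
    also have "(LINT s:{..t}|lborel. exp (- \<theta> * (t - s)) * (M s \<omega> - h s)) =
        (LINT s:{..t}|lborel. exp (- \<theta> * (t - s)) * M s \<omega>) - (LINT s:{..t}|lborel. exp (- \<theta> * (t - s)) * h s)"
      using set_integral_diff(2)[OF elim(2) hint[OF t]] by (simp only: right_diff_distrib)
    finally show ?case using elim(1) by (simp add: g_def algebra_simps)
  qed
  obtain Q where Q: "prob_space Q" and sQ: "sets Q = sets P" and ac: "absolutely_continuous P Q"
    and law: "distr Q (PiM UNIV (\<lambda>_. borel)) (\<lambda>\<omega>. \<lambda>i\<in>UNIV. M i \<omega> - h i) = distr P (PiM UNIV (\<lambda>_. borel)) (\<lambda>\<omega>. \<lambda>i\<in>UNIV. M i \<omega>)"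
    using adm by (auto simp: admissible_shift_def)
  note [measurable_cong] = sQ
  have mh[measurable]: "(\<lambda>\<omega> i. M i \<omega> - h i) \<in> measurable Q (PiM UNIV (\<lambda>_. borel))"
    by (rule measurable_PiM_single') (auto)
  have mM[measurable]: "(\<lambda>\<omega> i. M i \<omega>) \<in> measurable P (PiM UNIV (\<lambda>_. borel))"
    by (rule measurable_PiM_single') (auto)
  have mO: "(\<lambda>x. \<lambda>t\<in>I. ou_map \<theta> t x) \<in> measurable (PiM UNIV (\<lambda>_. borel)) (PiM I (\<lambda>_. borel))"
    by (rule measurable_restrict) measurable
  have "distr Q (PiM I (\<lambda>_. borel)) (\<lambda>\<omega>. \<lambda>t\<in>I. U t \<omega> - g t) = distr Q (PiM I (\<lambda>_. borel)) (\<lambda>\<omega>. \<lambda>t\<in>I. ou_map \<theta> t (\<lambda>t. M t \<omega> - h t))"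
  proof (rule modification_distr_eq[OF Q])
    \<comment> \<open>Almost sure identities under \<open>P\<close> persist under \<open>Q\<close>
      by absolute continuity.\<close>
    show "AE \<omega> in Q. U i \<omega> - g i = ou_map \<theta> i (\<lambda>t. M t \<omega> - h t)" if "i \<in> I" for i
      by (rule absolutely_continuous_AE[OF sQ ac 2]) (use that I in auto)
  qed measurable
  also have "\<dots> = distr (distr Q (PiM UNIV (\<lambda>_. borel)) (\<lambda>\<omega>. \<lambda>i\<in>UNIV. M i \<omega> - h i)) (PiM I (\<lambda>_. borel)) (\<lambda>x. \<lambda>t\<in>I. ou_map \<theta> t x)"
    by (subst distr_distr[OF mO]) (auto simp: comp_def restrict_UNIV)
  also have "\<dots> = distr P (PiM I (\<lambda>_. borel)) (\<lambda>\<omega>. \<lambda>t\<in>I. ou_map \<theta> t (\<lambda>t. M t \<omega>))"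
    unfolding law by (subst distr_distr[OF mO]) (auto simp: comp_def restrict_UNIV)
  also have "\<dots> = distr P (PiM I (\<lambda>_. borel)) (\<lambda>\<omega>. \<lambda>t\<in>I. U t \<omega>)"
    by (rule modification_distr_eq[OF P]) (use 1 in \<open>auto simp: eq_commute\<close>)
  finally show ?thesis
    unfolding admissible_shift_def g_def[symmetric] using Q sQ ac by blast
qed

section \<open>Reduction of conditional full support to fixed times\<close>

lemma Icc_countable_dense:
  fixes a b :: real
  obtains D where "countable D" "D \<subseteq> {a..b}" "closure D = {a..b}"
proof -
  obtain D where D: "countable D" "D \<subseteq> {a..b}" "{a..b} \<subseteq> closure D"
    by (rule separable)
  moreover have "closure D \<subseteq> {a..b}" by (rule closure_minimal[OF D(2)]) simp
  ultimately show ?thesis using that by blast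
qed

lemma sets_Collect_Ball_countable:
  assumes "countable D" "\<And>u. u \<in> D \<Longrightarrow> {x\<in>space M. p u x} \<in> sets M"
  shows "{x\<in>space M. \<forall>u\<in>D. p u x} \<in> sets M"
proof -
  have "space M - (\<Union>u\<in>D. space M - {x\<in>space M. p u x}) \<in> sets M"
    using assms by (intro sets.Diff sets.countable_UN' sets.top) auto
  also have "space M - (\<Union>u\<in>D. space M - {x\<in>space M. p u x}) = {x\<in>space M. \<forall>u\<in>D. p u x}" by auto
  finally show ?thesis .
qed

text \<open>The random interval is parametrised by \<open>r\<close> in [0,1] through
  \<open>\<sigma> \<omega> + r * (b - \<sigma> \<omega>)\<close>; by continuity a fixed countable
  dense set of \<open>r\<close> then decides the condition.\<close>

lemma measurable_sup_oscillation:
  fixes Y :: "real \<Rightarrow> 'a \<Rightarrow> real"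
  assumes b: "0 \<le> b"
    and Y: "\<And>u. u \<in> {0..b} \<Longrightarrow> Y u \<in> borel_measurable N"
    and cont: "\<And>\<omega>. \<omega> \<in> space N \<Longrightarrow> continuous_on {0..b} (\<lambda>u. Y u \<omega>)"
    and \<sigma>[measurable]: "\<sigma> \<in> borel_measurable N" and \<sigma>b: "\<And>\<omega>. \<omega> \<in> space N \<Longrightarrow> \<sigma> \<omega> \<in> {0..b}"
    and f: "continuous_on {0..b} f"
  shows "{\<omega>\<in>space N. \<forall>u\<in>{\<sigma> \<omega>..b}. \<bar>Y u \<omega> - Y (\<sigma> \<omega>) \<omega> - (f u - f (\<sigma> \<omega>))\<bar> \<le> c} \<in> sets N"
proof -
  \<comment> \<open>Clamping time to [0,b] extends the process to the line while using only
    variables up to time \<open>b\<close>. This matters when \<open>N\<close> is the sigma-algebra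
    of the past at \<open>b\<close>.\<close>
  define p where "p t = max 0 (min b t)" for t :: real
  have p: "p t \<in> {0..b}" "t \<in> {0..b} \<Longrightarrow> p t = t" for t using b by (auto simp: p_def)
  have pc: "continuous_on UNIV p" unfolding p_def by (intro continuous_intros)
  define Z where "Z t \<omega> = Y (p t) \<omega> - f (p t)" for t \<omega>
  have Zm: "Z t \<in> borel_measurable N" for t unfolding Z_def using Y[OF p(1)] by measurable
  have Zc: "continuous_on UNIV (\<lambda>t. Z t \<omega>)" if "\<omega> \<in> space N" for \<omega>
    unfolding Z_def using p(1)
    by (intro continuous_on_diff continuous_on_compose2[OF cont[OF that] pc] continuous_on_compose2[OF f pc]) auto
  obtain D where D: "countable D" "D \<subseteq> {0..1::real}" "closure D = {0..1}"
    by (rule Icc_countable_dense)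
  have [measurable]: "(\<lambda>\<omega>. Z (\<sigma> \<omega> + r * (b - \<sigma> \<omega>)) \<omega>) \<in> borel_measurable N" for r
    by (rule borel_measurable_continuous_eval[OF Zm _ Zc]) measurable
  have [measurable]: "(\<lambda>\<omega>. Z (\<sigma> \<omega>) \<omega>) \<in> borel_measurable N"
    by (rule borel_measurable_continuous_eval[OF Zm _ Zc]) measurable
  have "(\<forall>u\<in>{\<sigma> \<omega>..b}. \<bar>Y u \<omega> - Y (\<sigma> \<omega>) \<omega> - (f u - f (\<sigma> \<omega>))\<bar> \<le> c) \<longleftrightarrow>
      (\<forall>r\<in>D. \<bar>Z (\<sigma> \<omega> + r * (b - \<sigma> \<omega>)) \<omega> - Z (\<sigma> \<omega>) \<omega>\<bar> \<le> c)" if \<omega>: "\<omega> \<in> space N" for \<omega>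
  proof -
    have s: "0 \<le> \<sigma> \<omega>" "\<sigma> \<omega> \<le> b" using \<sigma>b[OF \<omega>] by auto
    have Zeq: "Y u \<omega> - Y (\<sigma> \<omega>) \<omega> - (f u - f (\<sigma> \<omega>)) = Z u \<omega> - Z (\<sigma> \<omega>) \<omega>" if "u \<in> {\<sigma> \<omega>..b}" for u
      using that s by (simp add: Z_def p(2))
    have in01: "\<sigma> \<omega> + r * (b - \<sigma> \<omega>) \<in> {\<sigma> \<omega>..b}" if "r \<in> {0..1}" for r
      using that s mult_right_mono[of r 1 "b - \<sigma> \<omega>"] by auto
    show ?thesis
    proof
      assume L: "\<forall>u\<in>{\<sigma> \<omega>..b}. \<bar>Y u \<omega> - Y (\<sigma> \<omega>) \<omega> - (f u - f (\<sigma> \<omega>))\<bar> \<le> c"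
      show "\<forall>r\<in>D. \<bar>Z (\<sigma> \<omega> + r * (b - \<sigma> \<omega>)) \<omega> - Z (\<sigma> \<omega>) \<omega>\<bar> \<le> c"
      proof
        fix r assume "r \<in> D"
        then have "\<sigma> \<omega> + r * (b - \<sigma> \<omega>) \<in> {\<sigma> \<omega>..b}" using D in01 by blast
        then show "\<bar>Z (\<sigma> \<omega> + r * (b - \<sigma> \<omega>)) \<omega> - Z (\<sigma> \<omega>) \<omega>\<bar> \<le> c" using L Zeq by metis
      qed
    next
      assume R: "\<forall>r\<in>D. \<bar>Z (\<sigma> \<omega> + r * (b - \<sigma> \<omega>)) \<omega> - Z (\<sigma> \<omega>) \<omega>\<bar> \<le> c"
      have R': "\<bar>Z (\<sigma> \<omega> + r * (b - \<sigma> \<omega>)) \<omega> - Z (\<sigma> \<omega>) \<omega>\<bar> \<le> c" if "r \<in> {0..1}" for r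
      proof (rule continuous_le_on_closure[where S=D and f="\<lambda>r. \<bar>Z (\<sigma> \<omega> + r * (b - \<sigma> \<omega>)) \<omega> - Z (\<sigma> \<omega>) \<omega>\<bar>"])
        have "continuous_on UNIV (\<lambda>r. \<bar>Z (\<sigma> \<omega> + r * (b - \<sigma> \<omega>)) \<omega> - Z (\<sigma> \<omega>) \<omega>\<bar>)"
          by (intro continuous_intros continuous_on_compose2[OF Zc[OF \<omega>]]) auto
        then show "continuous_on (closure D) (\<lambda>r. \<bar>Z (\<sigma> \<omega> + r * (b - \<sigma> \<omega>)) \<omega> - Z (\<sigma> \<omega>) \<omega>\<bar>)"
          by (rule continuous_on_subset) simp
      qed (use D that R in auto)
      show "\<forall>u\<in>{\<sigma> \<omega>..b}. \<bar>Y u \<omega> - Y (\<sigma> \<omega>) \<omega> - (f u - f (\<sigma> \<omega>))\<bar> \<le> c"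
      proof
        fix u assume u: "u \<in> {\<sigma> \<omega>..b}"
        show "\<bar>Y u \<omega> - Y (\<sigma> \<omega>) \<omega> - (f u - f (\<sigma> \<omega>))\<bar> \<le> c"
        proof (cases "\<sigma> \<omega> = b")
          case True
          then have "u = \<sigma> \<omega>" using u by simp
          then show ?thesis using R'[of 0] Zeq[OF u] by simp
        next
          case False
          define r where "r = (u - \<sigma> \<omega>) / (b - \<sigma> \<omega>)"
          have "r \<in> {0..1}" "\<sigma> \<omega> + r * (b - \<sigma> \<omega>) = u" using u s False by (auto simp: r_def)
          then show ?thesis using R'[of r] Zeq[OF u] by simp
        qed
      qed
    qed
  qed
  then have "{\<omega>\<in>space N. \<forall>u\<in>{\<sigma> \<omega>..b}. \<bar>Y u \<omega> - Y (\<sigma> \<omega>) \<omega> - (f u - f (\<sigma> \<omega>))\<bar> \<le> c} =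
      {\<omega>\<in>space N. \<forall>r\<in>D. \<bar>Z (\<sigma> \<omega> + r * (b - \<sigma> \<omega>)) \<omega> - Z (\<sigma> \<omega>) \<omega>\<bar> \<le> c}" by auto
  also have "\<dots> \<in> sets N"
    by (rule sets_Collect_Ball_countable[OF D(1)]) measurable
  finally show ?thesis .
qed

section \<open>The natural filtration, and events of the past as sets of paths\<close>

lemma space_natural_filtration[simp]: "space (natural_filtration P X t) = space P"
  unfolding natural_filtration_def by (rule space_measure_of) auto

lemma sets_natural_filtration:
  "sets (natural_filtration P X t) = sigma_sets (space P) {X s -` A \<inter> space P | s A. 0 \<le> s \<and> s \<le> t \<and> A \<in> sets borel}"
  unfolding natural_filtration_def by (rule sets_measure_of) auto

lemma natural_filtration_mono: "s \<le> t \<Longrightarrow> sets (natural_filtration P X s) \<subseteq> sets (natural_filtration P X t)"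
  unfolding sets_natural_filtration by (rule sigma_sets_mono') force

lemma filtration_natural_filtration: "filtration (space P) (natural_filtration P X)"
  by standard (simp_all add: natural_filtration_mono)

lemma sets_natural_filtration_subset:
  assumes "\<And>t. X t \<in> borel_measurable P"
  shows "sets (natural_filtration P X t) \<subseteq> sets P"
  unfolding sets_natural_filtration by (rule sets.sigma_sets_subset) (auto intro: measurable_sets[OF assms])

lemma measurable_natural_filtration:
  assumes "0 \<le> s" "s \<le> t"
  shows "X s \<in> borel_measurable (natural_filtration P X t)"
proof (rule measurableI)
  fix A :: "real set" assume "A \<in> sets borel"
  then show "X s -` A \<inter> space (natural_filtration P X t) \<in> sets (natural_filtration P X t)"
    using assms unfolding sets_natural_filtration by (intro sigma_sets.Basic) auto
qed simp

text \<open>Events of this form include the generators and are closed under complements and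
  countable unions. Read on path space, an event of the past cannot notice a shift that vanishes on
  [0,q].\<close>

lemma natural_filtration_representation:
  assumes "A \<in> sets (natural_filtration P X q)"
  obtains S where "S \<in> sets (PiM {0..q} (\<lambda>_. borel))" "A = {\<omega>\<in>space P. (\<lambda>t\<in>{0..q}. X t \<omega>) \<in> S}"
proof -
  define R where "R \<omega> = (\<lambda>t\<in>{0..q}. X t \<omega>)" for \<omega>
  have Rs: "R \<omega> \<in> space (PiM {0..q} (\<lambda>_. borel))" for \<omega> by (simp add: R_def space_PiM)
  have "A \<in> sigma_sets (space P) {X s -` A \<inter> space P | s A. 0 \<le> s \<and> s \<le> q \<and> A \<in> sets borel}"
    using assms by (simp add: sets_natural_filtration)
  then have "\<exists>S \<in> sets (PiM {0..q} (\<lambda>_. borel)). A = {\<omega>\<in>space P. R \<omega> \<in> S}"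
  proof induction
    case (Basic a)
    then obtain s A where s: "0 \<le> s" "s \<le> q" and A: "A \<in> sets borel" and a: "a = X s -` A \<inter> space P" by auto
    have "(\<lambda>x. x s) \<in> measurable (PiM {0..q} (\<lambda>_. borel)) (borel :: real measure)"
      using s by (intro measurable_component_singleton) auto
    note S = measurable_sets[OF this A]
    have "R \<omega> s = X s \<omega>" for \<omega> using s by (simp add: R_def)
    then show ?case
      by (intro bexI[OF _ S]) (use Rs in \<open>auto simp: a\<close>)
  next
    case Empty
    show ?case by (rule bexI[of _ "{}"]) auto
  next
    case (Compl a)
    then obtain S where S: "S \<in> sets (PiM {0..q} (\<lambda>_. borel))" "a = {\<omega>\<in>space P. R \<omega> \<in> S}" by blast
    show ?case
      by (rule bexI[OF _ sets.Diff[OF sets.top S(1)]]) (use Rs in \<open>auto simp: S(2)\<close>)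
  next
    case (Union a)
    then have "\<forall>i. \<exists>S. S \<in> sets (PiM {0..q} (\<lambda>_. borel)) \<and> a i = {\<omega>\<in>space P. R \<omega> \<in> S}" by blast
    from choice[OF this] obtain S where "\<And>i. S i \<in> sets (PiM {0..q} (\<lambda>_. borel))" "\<And>i. a i = {\<omega>\<in>space P. R \<omega> \<in> S i}"
      by blast
    then show ?case by (intro bexI[of _ "\<Union>i. S i"]) auto
  qed
  then show ?thesis using that unfolding R_def by blast
qed

text \<open>The shift vanishes up to time \<open>q\<close>, hence moves the future of the path and keeps every event of the past.\<close>

lemma sets_PiM_cylinder_ball:
  fixes g :: "real \<Rightarrow> real"
  assumes q: "0 \<le> q" "q \<le> T" and S: "S \<in> sets (PiM {0..q} (\<lambda>_. borel))" and D: "countable D" "D \<subseteq> {0..T}"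
  shows "{x\<in>space (PiM {0..T} (\<lambda>_. borel)). restrict x {0..q} \<in> S \<and> (\<forall>u\<in>D. \<bar>x u - x q - g u\<bar> \<le> \<delta>)}
    \<in> sets (PiM {0..T} (\<lambda>_. borel))" (is "?E \<in> _")
proof -
  have r: "(\<lambda>x. restrict x {0..q}) \<in> measurable (PiM {0..T} (\<lambda>_. borel)) (PiM {0..q} (\<lambda>_. borel))"
    using q by (intro measurable_restrict_subset) simp
  have c: "(\<lambda>x. x u) \<in> borel_measurable (PiM {0..T} (\<lambda>_. borel))" if "u \<in> {0..T}" for u
    using that by (rule measurable_component_singleton)
  have qT: "q \<in> {0..T}" using q by simp
  have B1: "{x\<in>space (PiM {0..T} (\<lambda>_. borel)). \<bar>x u - x q - g u\<bar> \<le> \<delta>} \<in> sets (PiM {0..T} (\<lambda>_. borel))" if "u \<in> D" for u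
    by (intro borel_measurable_le borel_measurable_abs borel_measurable_diff borel_measurable_const c subsetD[OF D(2) that] qT)
  have "{x\<in>space (PiM {0..T} (\<lambda>_. borel)). \<forall>u\<in>D. \<bar>x u - x q - g u\<bar> \<le> \<delta>} \<in> sets (PiM {0..T} (\<lambda>_. borel))"
    by (rule sets_Collect_Ball_countable[OF D(1) B1])
  moreover have "{x\<in>space (PiM {0..T} (\<lambda>_. borel)). restrict x {0..q} \<in> S} \<in> sets (PiM {0..T} (\<lambda>_. borel))"
    using measurable_sets[OF r S] by (simp add: vimage_def Int_def conj_commute)
  moreover have "?E = {x\<in>space (PiM {0..T} (\<lambda>_. borel)). \<forall>u\<in>D. \<bar>x u - x q - g u\<bar> \<le> \<delta>} \<inter>
      {x\<in>space (PiM {0..T} (\<lambda>_. borel)). restrict x {0..q} \<in> S}"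
    by blast
  ultimately show ?thesis by (simp only: sets.Int)
qed

lemma path_ball_dense_iff:
  fixes x g :: "real \<Rightarrow> real"
  assumes D: "D \<subseteq> {q..T}" "closure D = {q..T}" and x: "continuous_on {q..T} x" and g: "continuous_on {q..T} g"
  shows "(\<forall>u\<in>{q..T}. \<bar>x u - x q - g u\<bar> \<le> \<delta>) \<longleftrightarrow> (\<forall>u\<in>D. \<bar>x u - x q - g u\<bar> \<le> \<delta>)"
proof
  assume L: "\<forall>u\<in>D. \<bar>x u - x q - g u\<bar> \<le> \<delta>"
  show "\<forall>u\<in>{q..T}. \<bar>x u - x q - g u\<bar> \<le> \<delta>"
  proof
    fix u assume u: "u \<in> {q..T}"
    show "\<bar>x u - x q - g u\<bar> \<le> \<delta>"
    proof (rule continuous_le_on_closure[where S=D and f="\<lambda>u. \<bar>x u - x q - g u\<bar>"])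
      show "continuous_on (closure D) (\<lambda>u. \<bar>x u - x q - g u\<bar>)"
        unfolding D(2) by (intro continuous_intros x g)
    qed (use D L u in auto)
  qed
qed (use D(1) in blast)

text \<open>One set \<open>E\<close> of paths serves both sides: its preimage under X is the event
  for \<open>g1\<close>, its preimage under the shifted X is the event for \<open>g2\<close>. So the
  \<open>P\<close>-mass of the former is the \<open>Q\<close>-mass of the latter, which absolute
  continuity would make 0 if the latter were \<open>P\<close>-null.\<close>

lemma admissible_shift_moves_ball:
  fixes X :: "real \<Rightarrow> 'a \<Rightarrow> real"
  assumes Xm: "\<And>t. X t \<in> borel_measurable P" and Xc: "continuous_paths P X"
    and q: "0 \<le> q" "q \<le> T"
    and adm: "admissible_shift P {0..T} X (\<lambda>t. g2 t - g1 t)"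
    and g0: "\<And>t. t \<in> {0..q} \<Longrightarrow> g1 t = 0" "\<And>t. t \<in> {0..q} \<Longrightarrow> g2 t = 0"
    and gc: "continuous_on {q..T} g1" "continuous_on {q..T} g2"
    and A: "A \<in> sets (natural_filtration P X q)"
    and pos: "emeasure P {\<omega>\<in>A. \<forall>u\<in>{q..T}. \<bar>X u \<omega> - X q \<omega> - g1 u\<bar> \<le> \<delta>} \<noteq> 0"
  shows "emeasure P {\<omega>\<in>A. \<forall>u\<in>{q..T}. \<bar>X u \<omega> - X q \<omega> - g2 u\<bar> \<le> \<delta>} \<noteq> 0"
proof
  assume zero: "emeasure P {\<omega>\<in>A. \<forall>u\<in>{q..T}. \<bar>X u \<omega> - X q \<omega> - g2 u\<bar> \<le> \<delta>} = 0"
  obtain S where S: "S \<in> sets (PiM {0..q} (\<lambda>_. borel))" and AS: "A = {\<omega>\<in>space P. (\<lambda>t\<in>{0..q}. X t \<omega>) \<in> S}"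
    by (rule natural_filtration_representation[OF A])
  obtain D where D: "countable D" "D \<subseteq> {q..T}" "closure D = {q..T}" by (rule Icc_countable_dense)
  have DT: "D \<subseteq> {0..T}" using D(2) q by force
  have qT: "q \<in> {0..T}" using q by simp
  obtain Q where sQ: "sets Q = sets P" and ac: "absolutely_continuous P Q"
    and law: "distr Q (PiM {0..T} (\<lambda>_. borel)) (\<lambda>\<omega>. \<lambda>i\<in>{0..T}. X i \<omega> - (g2 i - g1 i)) =
      distr P (PiM {0..T} (\<lambda>_. borel)) (\<lambda>\<omega>. \<lambda>i\<in>{0..T}. X i \<omega>)"
    using adm unfolding admissible_shift_def by blast
  have spQ: "space Q = space P" using sQ by (rule sets_eq_imp_space_eq)
  define E where "E = {x\<in>space (PiM {0..T} (\<lambda>_. borel)). restrict x {0..q} \<in> S \<and> (\<forall>u\<in>D. \<bar>x u - x q - g1 u\<bar> \<le> \<delta>)}"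
  have E: "E \<in> sets (PiM {0..T} (\<lambda>_. borel))"
    unfolding E_def by (rule sets_PiM_cylinder_ball[OF q S D(1) DT])
  have Xcq: "continuous_on {q..T} (\<lambda>u. X u \<omega>)" if "\<omega> \<in> space P" for \<omega>
    using Xc that by (auto simp: continuous_paths_def intro: continuous_on_subset)
  have mX: "(\<lambda>\<omega>. \<lambda>i\<in>{0..T}. X i \<omega>) \<in> measurable P (PiM {0..T} (\<lambda>_. borel))"
    by (rule measurable_restrict[OF Xm])
  have XQ: "X i \<in> borel_measurable Q" for i
    using Xm[of i] measurable_cong_sets[OF sQ refl] by blast
  have mXg: "(\<lambda>\<omega>. \<lambda>i\<in>{0..T}. X i \<omega> - (g2 i - g1 i)) \<in> measurable Q (PiM {0..T} (\<lambda>_. borel))"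
    by (intro measurable_restrict borel_measurable_diff XQ borel_measurable_const)
  have rr: "restrict (\<lambda>i\<in>{0..T}. z i) {0..q} = (\<lambda>i\<in>{0..q}. z i)" for z :: "real \<Rightarrow> real"
    using q by (auto simp: restrict_def fun_eq_iff)
  have E_iff: "(\<lambda>i\<in>{0..T}. z i) \<in> E \<longleftrightarrow> (\<lambda>i\<in>{0..q}. z i) \<in> S \<and> (\<forall>u\<in>D. \<bar>z u - z q - g1 u\<bar> \<le> \<delta>)" for z
  proof -
    have "(\<forall>u\<in>D. \<bar>(\<lambda>i\<in>{0..T}. z i) u - (\<lambda>i\<in>{0..T}. z i) q - g1 u\<bar> \<le> \<delta>) \<longleftrightarrow> (\<forall>u\<in>D. \<bar>z u - z q - g1 u\<bar> \<le> \<delta>)"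
      using subsetD[OF DT] qT by (intro ball_cong refl) (simp only: restrict_apply if_True)
    then show ?thesis unfolding E_def mem_Collect_eq rr by (simp add: space_PiM)
  qed
  have V1: "(\<lambda>\<omega>. \<lambda>i\<in>{0..T}. X i \<omega>) -` E \<inter> space P = {\<omega>\<in>A. \<forall>u\<in>{q..T}. \<bar>X u \<omega> - X q \<omega> - g1 u\<bar> \<le> \<delta>}"
    using path_ball_dense_iff[OF D(2,3) Xcq gc(1)] unfolding AS vimage_def E_iff by blast
  have r1: "(\<lambda>i\<in>{0..q}. X i \<omega> - (g2 i - g1 i)) = (\<lambda>i\<in>{0..q}. X i \<omega>)" for \<omega>
    by (rule restrict_ext) (simp add: g0)
  have "q \<in> {0..q}" using q by simp
  then have r2: "X u \<omega> - (g2 u - g1 u) - (X q \<omega> - (g2 q - g1 q)) - g1 u = X u \<omega> - X q \<omega> - g2 u" for u \<omega>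
    by (simp add: g0)
  have V2: "(\<lambda>\<omega>. \<lambda>i\<in>{0..T}. X i \<omega> - (g2 i - g1 i)) -` E \<inter> space Q = {\<omega>\<in>A. \<forall>u\<in>{q..T}. \<bar>X u \<omega> - X q \<omega> - g2 u\<bar> \<le> \<delta>}"
    using path_ball_dense_iff[OF D(2,3) Xcq gc(2)] unfolding AS spQ vimage_def E_iff r1 r2 by blast
  have "emeasure P {\<omega>\<in>A. \<forall>u\<in>{q..T}. \<bar>X u \<omega> - X q \<omega> - g1 u\<bar> \<le> \<delta>} = emeasure Q {\<omega>\<in>A. \<forall>u\<in>{q..T}. \<bar>X u \<omega> - X q \<omega> - g2 u\<bar> \<le> \<delta>}"
    unfolding V1[symmetric] V2[symmetric]
    by (simp only: emeasure_distr[OF mX E, symmetric] emeasure_distr[OF mXg E, symmetric] law)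
  moreover have "{\<omega>\<in>A. \<forall>u\<in>{q..T}. \<bar>X u \<omega> - X q \<omega> - g2 u\<bar> \<le> \<delta>} \<in> null_sets P"
    using zero measurable_sets[OF mXg E] unfolding V2 sQ by (rule null_setsI)
  then have "{\<omega>\<in>A. \<forall>u\<in>{q..T}. \<bar>X u \<omega> - X q \<omega> - g2 u\<bar> \<le> \<delta>} \<in> null_sets Q"
    using ac unfolding absolutely_continuous_def by blast
  ultimately show False using pos by (simp add: null_setsD1)
qed

text \<open>The density assumption is used twice: for the increments of each path of X, which yields
  the countable cover, and for the target \<open>f\<close>. The balls have radius
  \<open>\<delta> / 2\<close> so that replacing \<open>f\<close> by a member of \<open>G\<close>
  still ends within \<open>\<delta>\<close>.\<close>

lemma support_at_fixed_time:
  fixes X :: "real \<Rightarrow> 'a \<Rightarrow> real"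
  assumes P: "prob_space P" and Xm: "\<And>t. X t \<in> borel_measurable P" and Xc: "continuous_paths P X"
    and q: "0 \<le> q" "q \<le> T"
    and cG: "countable G"
    and adm: "\<And>g1 g2. g1 \<in> G \<Longrightarrow> g2 \<in> G \<Longrightarrow> admissible_shift P {0..T} X (\<lambda>t. g2 t - g1 t)"
    and g0: "\<And>g t. g \<in> G \<Longrightarrow> t \<in> {0..q} \<Longrightarrow> g t = 0" and gc: "\<And>g. g \<in> G \<Longrightarrow> continuous_on {q..T} g"
    and dense: "\<And>f \<delta>. continuous_on {q..T} f \<Longrightarrow> f q = 0 \<Longrightarrow> 0 < \<delta> \<Longrightarrow> \<exists>g\<in>G. \<forall>u\<in>{q..T}. \<bar>f u - g u\<bar> \<le> \<delta>"
    and A: "A \<in> sets (natural_filtration P X q)" and pos: "emeasure P A \<noteq> 0"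
    and f: "continuous_on {q..T} f" and \<delta>: "0 < \<delta>"
  shows "emeasure P {\<omega>\<in>A. \<forall>u\<in>{q..T}. \<bar>X u \<omega> - X q \<omega> - (f u - f q)\<bar> \<le> \<delta>} \<noteq> 0"
proof -
  define Bl where "Bl g d = {\<omega>\<in>A. \<forall>u\<in>{q..T}. \<bar>X u \<omega> - X q \<omega> - g u\<bar> \<le> d}" for g and d :: real
  have AP: "A \<in> sets P" by (rule subsetD[OF sets_natural_filtration_subset[OF Xm] A])
  have Asp: "A \<subseteq> space P" using sets.sets_into_space[OF AP] .
  have Xcq: "continuous_on S (\<lambda>u. X u \<omega>)" if "\<omega> \<in> space P" for S \<omega>
    using Xc that by (auto simp: continuous_paths_def intro: continuous_on_subset)
  have Bl: "Bl g d \<in> sets P" if g: "continuous_on {q..T} g" and gq: "g q = 0" for g d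
  proof -
    \<comment> \<open>A constant continuation outside [q,T], since the measurability lemma asks for
      continuity on [0,T].\<close>
    define g' where "g' u = g (max q (min T u))" for u
    have c: "continuous_on {0..T} (\<lambda>u. max q (min T u))" by (intro continuous_intros)
    have g'c: "continuous_on {0..T} g'" unfolding g'_def
      by (rule continuous_on_compose2[OF g c]) (use q in auto)
    have "{\<omega>\<in>space P. \<forall>u\<in>{q..T}. \<bar>X u \<omega> - X q \<omega> - (g' u - g' q)\<bar> \<le> d} \<in> sets P"
      by (rule measurable_sup_oscillation[where \<sigma>="\<lambda>_. q"]) (use q Xm Xcq g'c in auto)
    moreover have "Bl g d = A \<inter> {\<omega>\<in>space P. \<forall>u\<in>{q..T}. \<bar>X u \<omega> - X q \<omega> - (g' u - g' q)\<bar> \<le> d}"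
      using Asp q gq by (auto simp: Bl_def g'_def)
    ultimately show ?thesis using AP by auto
  qed
  have gq: "g q = 0" if "g \<in> G" for g using g0[OF that] q by auto
  have cover: "A \<subseteq> (\<Union>g\<in>G. Bl g (\<delta> / 2))"
  proof
    fix \<omega> assume \<omega>: "\<omega> \<in> A"
    have "\<exists>g\<in>G. \<forall>u\<in>{q..T}. \<bar>(X u \<omega> - X q \<omega>) - g u\<bar> \<le> \<delta> / 2"
      by (rule dense) (use \<omega> Asp \<delta> in \<open>auto intro!: continuous_intros Xcq\<close>)
    then show "\<omega> \<in> (\<Union>g\<in>G. Bl g (\<delta> / 2))" using \<omega> by (auto simp: Bl_def)
  qed
  have "\<exists>g\<in>G. emeasure P (Bl g (\<delta> / 2)) \<noteq> 0"
  proof (rule ccontr)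
    assume "\<not> ?thesis"
    then have "(\<Union>g\<in>G. Bl g (\<delta> / 2)) \<in> null_sets P"
      by (intro null_sets_UN' cG) (auto intro: Bl gc gq)
    then have "A \<in> null_sets P"
      using AP cover by (rule null_sets_subset)
    then show False using pos by auto
  qed
  then obtain g1 where g1: "g1 \<in> G" "emeasure P (Bl g1 (\<delta> / 2)) \<noteq> 0" by blast
  have "\<exists>g\<in>G. \<forall>u\<in>{q..T}. \<bar>(f u - f q) - g u\<bar> \<le> \<delta> / 2"
    by (rule dense) (use f \<delta> in \<open>auto intro!: continuous_intros\<close>)
  then obtain g2 where g2: "g2 \<in> G" "\<And>u. u \<in> {q..T} \<Longrightarrow> \<bar>(f u - f q) - g2 u\<bar> \<le> \<delta> / 2" by blast
  have "emeasure P (Bl g2 (\<delta> / 2)) \<noteq> 0"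
    unfolding Bl_def
    by (rule admissible_shift_moves_ball[OF Xm Xc q adm[OF g1(1) g2(1)] _ _ _ _ A g1(2)[unfolded Bl_def]])
      (use g0 gc g1 g2 in auto)
  moreover have "Bl g2 (\<delta> / 2) \<subseteq> Bl (\<lambda>u. f u - f q) \<delta>"
  proof
    fix \<omega> assume \<omega>: "\<omega> \<in> Bl g2 (\<delta> / 2)"
    have "\<bar>X u \<omega> - X q \<omega> - (f u - f q)\<bar> \<le> \<delta>" if "u \<in> {q..T}" for u
    proof -
      have "\<bar>X u \<omega> - X q \<omega> - g2 u\<bar> \<le> \<delta> / 2" using \<omega> that by (auto simp: Bl_def)
      then show ?thesis using g2(2)[OF that] by linarith
    qed
    then show "\<omega> \<in> Bl (\<lambda>u. f u - f q) \<delta>" using \<omega> by (auto simp: Bl_def)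
  qed
  then have "emeasure P (Bl g2 (\<delta> / 2)) \<le> emeasure P (Bl (\<lambda>u. f u - f q) \<delta>)"
    by (rule emeasure_mono) (auto intro!: Bl continuous_intros f)
  ultimately show ?thesis unfolding Bl_def by auto
qed

text \<open>Reduction from stopping times to fixed times: on a non-null part of an event of \<open>\<F>\<^sub>\<tau>\<close> there
  is a fixed rational time \<open>q\<close> shortly after \<open>\<tau>\<close>, and the path has hardly moved on \<open>[\<tau>, q]\<close>.\<close>

lemma conditional_full_supportI:
  fixes X :: "real \<Rightarrow> 'a \<Rightarrow> real"
  assumes P: "prob_space P" and Xm: "\<And>t. X t \<in> borel_measurable P" and Xc: "continuous_paths P X"
    and T: "0 < T"
    and fixed: "\<And>q A f \<delta>. q \<in> {0..T} \<Longrightarrow> A \<in> sets (natural_filtration P X q) \<Longrightarrow> emeasure P A \<noteq> 0 \<Longrightarrow>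
        continuous_on {q..T} f \<Longrightarrow> 0 < \<delta> \<Longrightarrow>
        emeasure P {\<omega>\<in>A. \<forall>u\<in>{q..T}. \<bar>X u \<omega> - X q \<omega> - (f u - f q)\<bar> \<le> \<delta>} \<noteq> 0"
  shows "conditional_full_support P T X"
  unfolding conditional_full_support_def
proof (intro allI impI)
  interpret prob_space P by fact
  fix \<tau> :: "'a \<Rightarrow> real" and f :: "real \<Rightarrow> real" and \<epsilon> :: real
  assume st: "stopping_time (natural_filtration P X) \<tau>" and \<tau>T: "\<forall>\<omega>\<in>space P. \<tau> \<omega> \<in> {0..T}"
    and f: "continuous_on {0..T} f" and \<epsilon>: "0 < \<epsilon>"
  define F where "F = natural_filtration P X"
  interpret filtration "space P" F unfolding F_def by (rule filtration_natural_filtration)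
  have FP: "sets (F t) \<subseteq> sets P" for t unfolding F_def by (rule sets_natural_filtration_subset[OF Xm])
  have spF: "space (F t) = space P" for t by (simp add: F_def)
  have st': "stopping_time F \<tau>" using st by (simp add: F_def)
  have \<tau>m[measurable]: "\<tau> \<in> borel_measurable P"
    using measurable_stopping_time[OF st'] FP spF by blast
  have Xcq: "continuous_on S (\<lambda>u. X u \<omega>)" if "\<omega> \<in> space P" for S \<omega>
    using Xc that by (auto simp: continuous_paths_def intro: continuous_on_subset)
  define osc where "osc u \<omega> = \<bar>X u \<omega> - X (\<tau> \<omega>) \<omega> - (f u - f (\<tau> \<omega>))\<bar>" for u \<omega>
  have oscc: "continuous_on {\<tau> \<omega>..T} (\<lambda>u. osc u \<omega>)" if "\<omega> \<in> space P" for \<omega>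
    unfolding osc_def by (intro continuous_intros Xcq that continuous_on_subset[OF f]) (use \<tau>T that in force)
  define E where "E = {\<omega>\<in>space P. (SUP u\<in>{\<tau> \<omega>..T}. osc u \<omega>) < \<epsilon>}"
  \<comment> \<open>The strict bound on a supremum becomes a countable union of closed conditions,
    each covered by \<open>measurable_sup_oscillation\<close>.\<close>
  have E_iff: "(SUP u\<in>{\<tau> \<omega>..T}. osc u \<omega>) < \<epsilon> \<longleftrightarrow> (\<exists>n. \<forall>u\<in>{\<tau> \<omega>..T}. osc u \<omega> \<le> \<epsilon> - 1 / Suc n)" if \<omega>: "\<omega> \<in> space P" for \<omega>
  proof
    have ne: "{\<tau> \<omega>..T} \<noteq> {}" using \<tau>T \<omega> by auto
    have bdd: "bdd_above ((\<lambda>u. osc u \<omega>) ` {\<tau> \<omega>..T})"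
      by (intro bounded_imp_bdd_above compact_imp_bounded compact_continuous_image oscc \<omega>) simp
    show "\<exists>n. \<forall>u\<in>{\<tau> \<omega>..T}. osc u \<omega> \<le> \<epsilon> - 1 / Suc n" if "(SUP u\<in>{\<tau> \<omega>..T}. osc u \<omega>) < \<epsilon>"
    proof -
      have "0 < \<epsilon> - (SUP u\<in>{\<tau> \<omega>..T}. osc u \<omega>)" using that by simp
      then obtain n where n: "inverse (Suc n) < \<epsilon> - (SUP u\<in>{\<tau> \<omega>..T}. osc u \<omega>)" using reals_Archimedean by blast
      have "osc u \<omega> \<le> \<epsilon> - 1 / Suc n" if "u \<in> {\<tau> \<omega>..T}" for u
        using cSUP_upper[OF that bdd] n unfolding inverse_eq_divide by linarith
      then show ?thesis by blast
    qed
    show "(SUP u\<in>{\<tau> \<omega>..T}. osc u \<omega>) < \<epsilon>" if "\<exists>n. \<forall>u\<in>{\<tau> \<omega>..T}. osc u \<omega> \<le> \<epsilon> - 1 / Suc n"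
    proof -
      from that obtain n where "\<And>u. u \<in> {\<tau> \<omega>..T} \<Longrightarrow> osc u \<omega> \<le> \<epsilon> - 1 / Suc n" by blast
      then have "(SUP u\<in>{\<tau> \<omega>..T}. osc u \<omega>) \<le> \<epsilon> - 1 / Suc n" by (intro cSUP_least ne)
      also have "\<dots> < \<epsilon>" by simp
      finally show ?thesis .
    qed
  qed
  have E: "E \<in> sets P"
  proof -
    have "{\<omega>\<in>space P. \<forall>u\<in>{\<tau> \<omega>..T}. osc u \<omega> \<le> c} \<in> sets P" for c
      unfolding osc_def by (rule measurable_sup_oscillation) (use T Xm Xcq \<tau>T f in auto)
    then have "(\<Union>n. {\<omega>\<in>space P. \<forall>u\<in>{\<tau> \<omega>..T}. osc u \<omega> \<le> \<epsilon> - 1 / Suc n}) \<in> sets P" by blast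
    also have "(\<Union>n. {\<omega>\<in>space P. \<forall>u\<in>{\<tau> \<omega>..T}. osc u \<omega> \<le> \<epsilon> - 1 / Suc n}) = E"
      using E_iff by (auto simp: E_def)
    finally show ?thesis .
  qed
  \<comment> \<open>The heart of the matter without conditional expectations: \<open>E\<close>
    charges every non-null event known at time \<open>\<tau>\<close>.\<close>
  have key: "emeasure P (A \<inter> E) \<noteq> 0" if A: "A \<in> sets (pre_sigma \<tau>)" and pos: "emeasure P A \<noteq> 0" for A
  proof -
    have AF: "{\<omega>\<in>A. \<tau> \<omega> \<le> t} \<in> sets (F t)" for t using sets_pre_sigmaD[OF st' A] .
    have Asp: "A \<subseteq> space P" using sets.sets_into_space[OF A] by (simp add: space_pre_sigma)
    have "{\<omega>\<in>A. \<tau> \<omega> \<le> T} = A" using Asp \<tau>T by auto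
    then have AP: "A \<in> sets P" using AF[of T] FP by auto
    \<comment> \<open>\<open>T\<close> is added for paths with \<open>\<tau> \<omega> = T\<close>,
      which have no later time in [0,T], while \<open>T\<close> itself may be irrational.\<close>
    define Dq where "Dq = insert T (\<rat> \<inter> {0..T})"
    have Dq: "countable Dq" "Dq \<subseteq> {0..T}" using T by (auto simp: Dq_def countable_rat)
    define A' where "A' q = {\<omega>\<in>A. \<tau> \<omega> \<le> q \<and> (\<forall>u\<in>{\<tau> \<omega>..q}. osc u \<omega> \<le> \<epsilon> / 4)}" for q
    have A'F: "A' q \<in> sets (F q)" if q: "q \<in> {0..T}" for q
    proof -
      \<comment> \<open>Where \<open>\<tau> \<omega> \<le> q\<close> the minimum with
        \<open>q\<close> changes nothing, and it is measurable at time \<open>q\<close>, as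
        \<open>\<tau>\<close> itself need not be.\<close>
      have m: "(\<lambda>\<omega>. min (\<tau> \<omega>) q) \<in> borel_measurable (F q)"
      proof (rule borel_measurableI_le)
        fix t
        show "{\<omega> \<in> space (F q). min (\<tau> \<omega>) q \<le> t} \<in> sets (F q)"
        proof (cases "q \<le> t")
          case True
          then have "{\<omega> \<in> space (F q). min (\<tau> \<omega>) q \<le> t} = space (F q)" by auto
          then show ?thesis by simp
        next
          case False
          then have "{\<omega> \<in> space (F q). min (\<tau> \<omega>) q \<le> t} = {\<omega> \<in> space (F t). \<tau> \<omega> \<le> t}" by (auto simp: spF)
          moreover have "\<dots> \<in> sets (F t)" using stopping_timeD[OF st', of t] by (simp add: pred_def)
          ultimately show ?thesis using sets_F_mono[of t q] False by auto
        qed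
      qed
      have "{\<omega>\<in>space (F q). \<forall>u\<in>{min (\<tau> \<omega>) q..q}. \<bar>X u \<omega> - X (min (\<tau> \<omega>) q) \<omega> - (f u - f (min (\<tau> \<omega>) q))\<bar> \<le> \<epsilon> / 4} \<in> sets (F q)"
      proof (rule measurable_sup_oscillation[OF _ _ _ m])
        show "X u \<in> borel_measurable (F q)" if "u \<in> {0..q}" for u
          unfolding F_def using that by (intro measurable_natural_filtration) auto
        show "continuous_on {0..q} f" using q by (intro continuous_on_subset[OF f]) auto
      qed (use q Xcq \<tau>T spF in auto)
      moreover have "A' q = {\<omega>\<in>A. \<tau> \<omega> \<le> q} \<inter> {\<omega>\<in>space (F q). \<forall>u\<in>{min (\<tau> \<omega>) q..q}. \<bar>X u \<omega> - X (min (\<tau> \<omega>) q) \<omega> - (f u - f (min (\<tau> \<omega>) q))\<bar> \<le> \<epsilon> / 4}"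
        using Asp by (auto simp: A'_def osc_def spF min_def)
      ultimately show ?thesis using AF[of q] by auto
    qed
    have cover: "A \<subseteq> (\<Union>q\<in>Dq. A' q)"
    proof
      fix \<omega> assume \<omega>A: "\<omega> \<in> A"
      then have \<omega>: "\<omega> \<in> space P" using Asp by auto
      have t: "0 \<le> \<tau> \<omega>" "\<tau> \<omega> \<le> T" using \<tau>T \<omega> by auto
      have "\<exists>q\<in>Dq. \<tau> \<omega> \<le> q \<and> (\<forall>u\<in>{\<tau> \<omega>..q}. osc u \<omega> \<le> \<epsilon> / 4)"
      proof (cases "\<tau> \<omega> = T")
        case True
        then show ?thesis using \<epsilon> by (intro bexI[of _ T]) (auto simp: osc_def Dq_def)
      next
        case False
        have o0: "osc (\<tau> \<omega>) \<omega> = 0" by (simp add: osc_def)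
        obtain d where d: "0 < d" and dd: "\<And>u. u \<in> {\<tau> \<omega>..T} \<Longrightarrow> dist u (\<tau> \<omega>) < d \<Longrightarrow> dist (osc u \<omega>) (osc (\<tau> \<omega>) \<omega>) < \<epsilon> / 4"
          using oscc[OF \<omega>] t \<epsilon> unfolding continuous_on_iff
          by (metis atLeastAtMost_iff order_refl divide_pos_pos zero_less_numeral)
        have "\<tau> \<omega> < min T (\<tau> \<omega> + d)" using False t d by auto
        then obtain q where q: "q \<in> \<rat>" "\<tau> \<omega> < q" "q < min T (\<tau> \<omega> + d)" using Rats_dense_in_real by blast
        have "osc u \<omega> \<le> \<epsilon> / 4" if "u \<in> {\<tau> \<omega>..q}" for u
          using dd[of u] that q by (auto simp: o0 dist_real_def)
        moreover have "q \<in> Dq" using q t by (auto simp: Dq_def)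
        ultimately show ?thesis using q(2) by (intro bexI[of _ q]) auto
      qed
      then show "\<omega> \<in> (\<Union>q\<in>Dq. A' q)" using \<omega>A by (auto simp: A'_def)
    qed
    have "\<exists>q\<in>Dq. emeasure P (A' q) \<noteq> 0"
    proof (rule ccontr)
      assume "\<not> ?thesis"
      moreover have "A' q \<in> sets P" if "q \<in> Dq" for q using A'F[of q] Dq(2) FP that by blast
      ultimately have "(\<Union>q\<in>Dq. A' q) \<in> null_sets P"
        by (intro null_sets_UN' null_setsI Dq(1)) auto
      then have "A \<in> null_sets P" using AP cover by (rule null_sets_subset)
      then show False using pos by auto
    qed
    then obtain q where q: "q \<in> Dq" "emeasure P (A' q) \<noteq> 0" by blast
    then have qT: "q \<in> {0..T}" using Dq by auto
    have "emeasure P {\<omega>\<in>A' q. \<forall>u\<in>{q..T}. \<bar>X u \<omega> - X q \<omega> - (f u - f q)\<bar> \<le> \<epsilon> / 4} \<noteq> 0"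
      by (rule fixed) (use qT A'F[OF qT] q \<epsilon> f in \<open>auto simp: F_def intro: continuous_on_subset\<close>)
    moreover have "{\<omega>\<in>A' q. \<forall>u\<in>{q..T}. \<bar>X u \<omega> - X q \<omega> - (f u - f q)\<bar> \<le> \<epsilon> / 4} \<subseteq> A \<inter> E"
    proof
      fix \<omega> assume "\<omega> \<in> {\<omega>\<in>A' q. \<forall>u\<in>{q..T}. \<bar>X u \<omega> - X q \<omega> - (f u - f q)\<bar> \<le> \<epsilon> / 4}"
      then have \<omega>A: "\<omega> \<in> A" and \<tau>q: "\<tau> \<omega> \<le> q" and o1: "\<And>u. u \<in> {\<tau> \<omega>..q} \<Longrightarrow> osc u \<omega> \<le> \<epsilon> / 4"
        and o2: "\<And>u. u \<in> {q..T} \<Longrightarrow> \<bar>X u \<omega> - X q \<omega> - (f u - f q)\<bar> \<le> \<epsilon> / 4" by (auto simp: A'_def)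
      have \<omega>: "\<omega> \<in> space P" using \<omega>A Asp by auto
      \<comment> \<open>The motion up to \<open>q\<close> and the motion after \<open>q\<close> cost
        \<open>\<epsilon> / 4\<close> each. The total stays away from \<open>\<epsilon>\<close>,
        which makes the bound on the supremum strict.\<close>
      have "osc u \<omega> \<le> \<epsilon> / 2" if u: "u \<in> {\<tau> \<omega>..T}" for u
      proof (cases "u \<le> q")
        case True
        then show ?thesis using o1[of u] u \<epsilon> by auto
      next
        case False
        then have "osc q \<omega> \<le> \<epsilon> / 4" "\<bar>X u \<omega> - X q \<omega> - (f u - f q)\<bar> \<le> \<epsilon> / 4"
          using o1[of q] o2[of u] u \<tau>q by auto
        then show ?thesis unfolding osc_def by linarith
      qed
      then have "(SUP u\<in>{\<tau> \<omega>..T}. osc u \<omega>) \<le> \<epsilon> / 2" using \<tau>T \<omega> by (intro cSUP_least) auto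
      then show "\<omega> \<in> A \<inter> E" using \<omega>A \<omega> \<epsilon> by (auto simp: E_def)
    qed
    then have "emeasure P {\<omega>\<in>A' q. \<forall>u\<in>{q..T}. \<bar>X u \<omega> - X q \<omega> - (f u - f q)\<bar> \<le> \<epsilon> / 4} \<le> emeasure P (A \<inter> E)"
      by (rule emeasure_mono) (use AP E in auto)
    ultimately show ?thesis by auto
  qed
  have sub: "subalgebra P (pre_sigma \<tau>)"
    unfolding subalgebra_def
  proof
    show "space (pre_sigma \<tau>) = space P" by (simp add: space_pre_sigma)
    show "sets (pre_sigma \<tau>) \<subseteq> sets P"
    proof
      fix A assume A: "A \<in> sets (pre_sigma \<tau>)"
      then have "{\<omega>\<in>A. \<tau> \<omega> \<le> T} \<in> sets (F T)" by (rule sets_pre_sigmaD[OF st'])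
      moreover have "{\<omega>\<in>A. \<tau> \<omega> \<le> T} = A" using \<tau>T sets.sets_into_space[OF A] by (auto simp: space_pre_sigma)
      ultimately show "A \<in> sets P" using FP by auto
    qed
  qed
  interpret finite_measure_subalgebra P "pre_sigma \<tau>" by standard (rule sub)
  define Z where "Z = real_cond_exp P (pre_sigma \<tau>) (indicator E)"
  have [measurable]: "Z \<in> borel_measurable (pre_sigma \<tau>)" unfolding Z_def by simp
  \<comment> \<open>The exceptional set is itself known at time \<open>\<tau>\<close>. Were it
    non-null, integrating the conditional expectation over it would give \<open>E\<close> no
    positive mass there, contrary to \<open>key\<close>.\<close>
  define A where "A = {\<omega>\<in>space (pre_sigma \<tau>). Z \<omega> \<le> 0}"
  have A: "A \<in> sets (pre_sigma \<tau>)" unfolding A_def by measurable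
  have AP: "A \<in> sets P" using A sub by (auto simp: subalgebra_def)
  have intE: "integrable P (indicator E :: 'a \<Rightarrow> real)"
    using E by (intro integrable_real_indicator) (simp_all add: emeasure_eq_measure)
  have "emeasure P A = 0"
  proof (rule ccontr)
    assume "emeasure P A \<noteq> 0"
    from key[OF A this] have "0 < measure P (A \<inter> E)" by (simp add: emeasure_eq_measure zero_less_measure_iff)
    moreover have "measure P (A \<inter> E) = (\<integral>\<omega>\<in>A. indicator E \<omega> \<partial>P)"
      using AP E by (simp add: set_lebesgue_integral_def indicator_inter_arith[symmetric])
    also have "\<dots> = (\<integral>\<omega>\<in>A. Z \<omega> \<partial>P)" unfolding Z_def by (rule real_cond_exp_intA[OF intE A])
    also have "\<dots> \<le> 0"
      unfolding set_lebesgue_integral_def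
      using Bochner_Integration.integral_nonneg[of P "\<lambda>\<omega>. - (indicator A \<omega> *\<^sub>R Z \<omega>)"]
      by (simp add: A_def split: split_indicator)
    ultimately show False by simp
  qed
  then have "AE \<omega> in P. \<omega> \<notin> A" using AP by (intro AE_not_in) auto
  then have "AE \<omega> in P. 0 < Z \<omega>"
    using AE_space by eventually_elim (auto simp: A_def space_pre_sigma)
  then show "AE \<omega> in P. 0 < real_cond_exp P (stopped_sigma P X \<tau>)
      (indicator {\<omega>' \<in> space P. (SUP u\<in>{\<tau> \<omega>'..T}. \<bar>X u \<omega>' - X (\<tau> \<omega>') \<omega>' - (f u - f (\<tau> \<omega>'))\<bar>) < \<epsilon>}) \<omega>"
    by (simp add: Z_def E_def osc_def F_def)
qed

section \<open>Density of the admissible shifts\<close>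

text \<open>Lists of rationals make the family countable. The powers start at 1 and the argument is
  cut off at 0, so every member is continuous and vanishes up to \<open>q\<close>.\<close>

definition rat_poly :: "real \<Rightarrow> rat list \<Rightarrow> real \<Rightarrow> real" where
  "rat_poly q cs t = (\<Sum>k<length cs. of_rat (cs ! k) * max 0 (t - q) ^ Suc k)"

lemma rat_poly_eq_0: "t \<le> q \<Longrightarrow> rat_poly q cs t = 0"
  by (simp add: rat_poly_def)

lemma continuous_on_rat_poly: "continuous_on S (rat_poly q cs)"
  unfolding rat_poly_def[abs_def] by (intro continuous_intros)

lemma rat_poly_measurable[measurable]: "rat_poly q cs \<in> borel_measurable borel"
  by (rule borel_measurable_continuous_onI[OF continuous_on_rat_poly])

lemma rat_poly_diff:
  obtains n r where "\<And>t. rat_poly q cs t - rat_poly q ds t = (\<Sum>k<n. r k * max 0 (t - q) ^ Suc k)"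
proof -
  define c where "c cs k = (if k < length cs then of_rat (cs ! k) else 0 :: real)" for cs :: "rat list" and k
  define n where "n = max (length cs) (length ds)"
  have e: "rat_poly q es t = (\<Sum>k<n. c es k * max 0 (t - q) ^ Suc k)" if "length es \<le> n" for es t
    unfolding rat_poly_def using that by (intro sum.mono_neutral_cong_left) (auto simp: c_def)
  have "rat_poly q cs t - rat_poly q ds t = (\<Sum>k<n. (c cs k - c ds k) * max 0 (t - q) ^ Suc k)" for t
    unfolding left_diff_distrib sum_subtractf by (subst (1 2) e) (auto simp: n_def)
  then show ?thesis by (rule that)
qed

text \<open>The error has three parts of size \<open>\<delta> / 3\<close>: Weierstrass
  approximation, dropping the constant term, which is small because \<open>f q = 0\<close>, and
  rounding the other coefficients to rationals.\<close>

lemma rat_poly_dense: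
  fixes f :: "real \<Rightarrow> real"
  assumes f: "continuous_on {q..T} f" and f0: "f q = 0" and q: "q \<le> T" and \<delta>: "0 < \<delta>"
  shows "\<exists>cs. \<forall>u\<in>{q..T}. \<bar>f u - rat_poly q cs u\<bar> \<le> \<delta>"
proof -
  have "continuous_on {0..T - q} (\<lambda>x. f (q + x))"
    by (rule continuous_on_compose2[OF f]) (auto intro!: continuous_intros)
  then obtain g where g: "real_polynomial_function g" and fg: "\<And>x. x \<in> {0..T - q} \<Longrightarrow> \<bar>f (q + x) - g x\<bar> < \<delta> / 3"
    using Stone_Weierstrass_real_polynomial_function[of "{0..T - q}" "\<lambda>x. f (q + x)" "\<delta> / 3"] \<delta> by auto
  obtain a n where gx: "g = (\<lambda>x. \<Sum>i\<le>n. a i * x ^ i)" using g by (auto simp: real_polynomial_function_iff_sum)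
  define L where "L = max 1 (T - q)"
  have L: "1 \<le> L" "T - q \<le> L" by (auto simp: L_def)
  \<comment> \<open>Rounding contributes \<open>n\<close> errors of at most
    \<open>\<eta> * L ^ n\<close> each, where \<open>L \<ge> 1\<close> lets one power bound all of
    them; \<open>n + 1\<close> keeps the denominator positive for \<open>n = 0\<close>.\<close>
  define \<eta> where "\<eta> = \<delta> / (3 * (real n + 1) * L ^ n)"
  have \<eta>: "0 < \<eta>" unfolding \<eta>_def using \<delta> L by (intro divide_pos_pos mult_pos_pos) auto
  have "\<forall>i. \<exists>r. \<bar>a i - of_rat r\<bar> < \<eta>"
  proof
    fix i
    obtain r where "a i - \<eta> < of_rat r" "of_rat r < a i + \<eta>" using of_rat_dense[of "a i - \<eta>" "a i + \<eta>"] \<eta> by auto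
    then show "\<exists>r. \<bar>a i - of_rat r\<bar> < \<eta>" by (intro exI[of _ r]) (auto simp: abs_less_iff)
  qed
  from choice[OF this] obtain r where r: "\<And>i. \<bar>a i - of_rat (r i)\<bar> < \<eta>" by blast
  define cs where "cs = map (\<lambda>k. r (Suc k)) [0..<n]"
  have "\<bar>f u - rat_poly q cs u\<bar> \<le> \<delta>" if u: "u \<in> {q..T}" for u
  proof -
    define x where "x = u - q"
    have x: "x \<in> {0..T - q}" "u = q + x" using u by (auto simp: x_def)
    have gd: "g x = a 0 + (\<Sum>k<n. a (Suc k) * x ^ Suc k)" for x
      unfolding gx by (simp add: sum.atMost_shift)
    have rp: "rat_poly q cs u = (\<Sum>k<n. of_rat (r (Suc k)) * x ^ Suc k)"
      using x by (simp add: rat_poly_def cs_def max_def)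
    have a0: "\<bar>a 0\<bar> < \<delta> / 3" using fg[of 0] q f0 gd[of 0] by simp
    have "\<bar>(\<Sum>k<n. a (Suc k) * x ^ Suc k) - (\<Sum>k<n. of_rat (r (Suc k)) * x ^ Suc k)\<bar> \<le> (\<Sum>k<n. \<bar>(a (Suc k) - of_rat (r (Suc k))) * x ^ Suc k\<bar>)"
      unfolding sum_subtractf[symmetric] left_diff_distrib by (rule sum_abs)
    also have "\<dots> \<le> (\<Sum>k<n. \<eta> * L ^ n)"
    proof (rule sum_mono)
      fix k assume k: "k \<in> {..<n}"
      have "x ^ Suc k \<le> L ^ Suc k" using x L by (intro power_mono) auto
      also have "\<dots> \<le> L ^ n" using k L by (intro power_increasing) auto
      finally have "\<bar>x ^ Suc k\<bar> \<le> L ^ n" using x by (simp add: power_abs)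
      then show "\<bar>(a (Suc k) - of_rat (r (Suc k))) * x ^ Suc k\<bar> \<le> \<eta> * L ^ n"
        unfolding abs_mult using r[of "Suc k"] \<eta> by (intro mult_mono) auto
    qed
    also have "\<dots> = real n * (\<eta> * L ^ n)" by simp
    also have "\<dots> \<le> (real n + 1) * (\<eta> * L ^ n)" using \<eta> L by (intro mult_right_mono) auto
    also have "\<dots> = \<delta> / 3"
    proof -
      have *: "m * (\<delta> / (3 * m * p) * p) = \<delta> / 3" if "0 < m" "0 < p" for m p :: real
        using that by (simp add: field_simps)
      show ?thesis unfolding \<eta>_def by (rule *) (use L in auto)
    qed
    finally have "\<bar>(\<Sum>k<n. a (Suc k) * x ^ Suc k) - rat_poly q cs u\<bar> \<le> \<delta> / 3" unfolding rp .
    then show ?thesis using fg[OF x(1), folded x(2)] a0 gd[of x] by linarith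
  qed
  then show ?thesis by blast
qed

lemma admissible_shift_cong:
  assumes "\<And>i. i \<in> I \<Longrightarrow> h i = k i"
  shows "admissible_shift P I X h \<longleftrightarrow> admissible_shift P I X k"
proof -
  have "(\<lambda>i\<in>I. X i \<omega> - h i) = (\<lambda>i\<in>I. X i \<omega> - k i)" for \<omega>
    using assms by (auto simp: restrict_def)
  then show ?thesis unfolding admissible_shift_def by simp
qed

lemma mmfBm_admissible_rat_poly:
  assumes P: "prob_space P" and mm: "mmfBm P \<sigma> H B M" and q: "0 \<le> q" "q \<le> T"
  obtains h where "admissible_shift P UNIV M h" "\<And>t. t \<le> T \<Longrightarrow> h t = rat_poly q ds t - rat_poly q cs t"
    "h \<in> borel_measurable borel"
proof -
  obtain n r where nr: "\<And>t. rat_poly q ds t - rat_poly q cs t = (\<Sum>k<n. r k * max 0 (t - q) ^ Suc k)"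
    by (rule rat_poly_diff[of q ds cs]) blast
  \<comment> \<open>The length \<open>T - q + 1\<close> reaches beyond \<open>T\<close> and stays
    positive when \<open>q = T\<close>.\<close>
  obtain h where "admissible_shift P UNIV M h" "\<And>t. t \<le> q + (T - q + 1) \<Longrightarrow> h t = (\<Sum>k<n. r k * max 0 (t - q) ^ Suc k)"
    "h \<in> borel_measurable borel"
    by (rule mmfBm_admissible_polynomial[OF P mm q(1), where l="T - q + 1" and I=UNIV and n=n and r=r]) (use q in auto)
  then show ?thesis using that nr by simp
qed

lemma admissible_shift_subset:
  assumes adm: "admissible_shift P I X h" and X: "\<And>i. X i \<in> borel_measurable P" and J: "J \<subseteq> I"
  shows "admissible_shift P J X h"
proof -
  obtain Q where Q: "prob_space Q" and sQ: "sets Q = sets P" and ac: "absolutely_continuous P Q"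
    and law: "distr Q (PiM I (\<lambda>_. borel)) (\<lambda>\<omega>. \<lambda>i\<in>I. X i \<omega> - h i) = distr P (PiM I (\<lambda>_. borel)) (\<lambda>\<omega>. \<lambda>i\<in>I. X i \<omega>)"
    using adm by (auto simp: admissible_shift_def)
  note [measurable] = X
  note [measurable_cong] = sQ
  have 1: "(\<lambda>\<omega>. \<lambda>i\<in>I. X i \<omega> - h i) \<in> measurable Q (PiM I (\<lambda>_. borel))" by (rule measurable_restrict) measurable
  have 2: "(\<lambda>\<omega>. \<lambda>i\<in>I. X i \<omega>) \<in> measurable P (PiM I (\<lambda>_. borel))" by (rule measurable_restrict) measurable
  have r: "restrict (\<lambda>i\<in>I. z i) J = (\<lambda>i\<in>J. z i)" for z :: "_ \<Rightarrow> real"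
    using J by (auto simp: restrict_def fun_eq_iff)
  have "distr Q (PiM J (\<lambda>_. borel)) (\<lambda>\<omega>. \<lambda>i\<in>J. X i \<omega> - h i) = distr P (PiM J (\<lambda>_. borel)) (\<lambda>\<omega>. \<lambda>i\<in>J. X i \<omega>)"
    using arg_cong[OF law, of "\<lambda>m. distr m (PiM J (\<lambda>_. borel)) (\<lambda>x. restrict x J)"]
    by (simp only: distr_distr[OF measurable_restrict_subset[OF J] 1] distr_distr[OF measurable_restrict_subset[OF J] 2] comp_def r)
  then show ?thesis unfolding admissible_shift_def using Q sQ ac by blast
qed

text \<open>\<open>ou_shift\<close> is the image of a deterministic shift of the driving process.\<close>

definition ou_shift :: "real \<Rightarrow> (real \<Rightarrow> real) \<Rightarrow> real \<Rightarrow> real" where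
  "ou_shift \<theta> h t = h t - \<theta> * (LINT s:{..t}|lborel. exp (- \<theta> * (t - s)) * h s)"

text \<open>Taking exp(-\<open>\<theta>\<close> t) out leaves an indefinite integral from
  \<open>q\<close>, to which the fundamental theorem of calculus and continuity in the endpoint
  apply.\<close>

lemma ou_shift_eq:
  assumes h: "continuous_on {q..t} h" and h0: "\<And>s. s \<le> q \<Longrightarrow> h s = 0" and t: "q \<le> t"
  shows "ou_shift \<theta> h t = h t - \<theta> * (exp (- \<theta> * t) * integral {q..t} (\<lambda>s. exp (\<theta> * s) * h s))"
proof -
  have "continuous_on {q..t} (\<lambda>s. exp (- \<theta> * (t - s)) * h s)" by (intro continuous_intros h)
  then have int: "set_integrable lborel {q..t} (\<lambda>s. exp (- \<theta> * (t - s)) * h s)"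
    unfolding set_integrable_def by (intro borel_integrable_compact) auto
  have "indicator {..t} s *\<^sub>R (exp (- \<theta> * (t - s)) * h s) = indicator {q..t} s *\<^sub>R (exp (- \<theta> * (t - s)) * h s)" for s
    using h0[of s] by (auto split: split_indicator)
  then have "(LINT s:{..t}|lborel. exp (- \<theta> * (t - s)) * h s) = (LINT s:{q..t}|lborel. exp (- \<theta> * (t - s)) * h s)"
    unfolding set_lebesgue_integral_def by (simp only:)
  also have "\<dots> = integral {q..t} (\<lambda>s. exp (- \<theta> * (t - s)) * h s)"
    by (rule set_borel_integral_eq_integral(2)[OF int])
  also have "\<dots> = integral {q..t} (\<lambda>s. exp (- \<theta> * t) * (exp (\<theta> * s) * h s))"
    by (simp add: exp_add[symmetric] algebra_simps mult.assoc[symmetric])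
  also have "\<dots> = exp (- \<theta> * t) * integral {q..t} (\<lambda>s. exp (\<theta> * s) * h s)" by simp
  finally show ?thesis by (simp add: ou_shift_def)
qed

lemma ou_shift_eq_0:
  assumes "\<And>s. s \<le> q \<Longrightarrow> h s = 0" "t \<le> q"
  shows "ou_shift \<theta> h t = 0"
proof -
  have "(\<lambda>s. indicator {..t} s *\<^sub>R (exp (- \<theta> * (t - s)) * h s)) = (\<lambda>_. 0)"
    using assms by (auto split: split_indicator)
  then show ?thesis using assms by (simp only: ou_shift_def set_lebesgue_integral_def) simp
qed

text \<open>The inverse of \<open>ou_shift\<close> is \<open>f \<mapsto> f + \<theta> \<integral> f\<close>, so density is inherited from \<open>rat_poly\<close>.\<close>

lemma ou_shift_rat_poly_dense:
  fixes f :: "real \<Rightarrow> real"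
  assumes f: "continuous_on {q..T} f" and f0: "f q = 0" and q: "q \<le> T" and \<delta>: "0 < \<delta>" and \<theta>: "0 < \<theta>"
  shows "\<exists>cs. \<forall>u\<in>{q..T}. \<bar>f u - ou_shift \<theta> (rat_poly q cs) u\<bar> \<le> \<delta>"
proof -
  define F where "F t = integral {q..t} f" for t
  have Fd: "(F has_real_derivative f t) (at t within {q..T})" if "t \<in> {q..T}" for t
    unfolding F_def by (rule integral_has_real_derivative[OF f that])
  have Fc: "continuous_on {q..T} F"
    using Fd by (meson DERIV_continuous continuous_on_eq_continuous_within)
  define k where "k t = f t + \<theta> * F t" for t
  have kc: "continuous_on {q..T} k" unfolding k_def by (intro continuous_intros f Fc)
  have "k q = 0" by (simp add: k_def f0 F_def)
  from rat_poly_dense[OF kc this q half_gt_zero[OF \<delta>]]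
  obtain cs where "\<forall>u\<in>{q..T}. \<bar>k u - rat_poly q cs u\<bar> \<le> \<delta> / 2" ..
  then have cs: "\<bar>k u - rat_poly q cs u\<bar> \<le> \<delta> / 2" if "u \<in> {q..T}" for u using that by blast
  have "\<bar>f u - ou_shift \<theta> (rat_poly q cs) u\<bar> \<le> \<delta>" if u: "u \<in> {q..T}" for u
  proof -
    have sub: "{q..u} \<subseteq> {q..T}" using u by auto
    \<comment> \<open>exp(\<open>\<theta>\<close> s) F(s) is a primitive of
      exp(\<open>\<theta>\<close> s) k(s), and this is why the Ornstein--Uhlenbeck map sends
      \<open>k\<close> back to \<open>f\<close>.\<close>
    have "((\<lambda>s. exp (\<theta> * s) * k s) has_integral exp (\<theta> * u) * F u - exp (\<theta> * q) * F q) {q..u}"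
    proof (rule fundamental_theorem_of_calculus)
      fix s assume s: "s \<in> {q..u}"
      have "(F has_real_derivative f s) (at s within {q..u})"
        using Fd[of s] s sub by (auto intro: DERIV_subset)
      then have "((\<lambda>s. exp (\<theta> * s) * F s) has_real_derivative exp (\<theta> * s) * k s) (at s within {q..u})"
        by (auto intro!: derivative_eq_intros simp: k_def algebra_simps)
      then show "((\<lambda>s. exp (\<theta> * s) * F s) has_vector_derivative exp (\<theta> * s) * k s) (at s within {q..u})"
        by (simp add: has_real_derivative_iff_has_vector_derivative)
    qed (use u in auto)
    then have I1: "integral {q..u} (\<lambda>s. exp (\<theta> * s) * k s) = exp (\<theta> * u) * F u"
      by (simp add: integral_unique F_def)
    have "((\<lambda>s. \<theta> * exp (\<theta> * s)) has_integral exp (\<theta> * u) - exp (\<theta> * q)) {q..u}"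
    proof (rule fundamental_theorem_of_calculus)
      fix s
      have "((\<lambda>s. exp (\<theta> * s)) has_real_derivative \<theta> * exp (\<theta> * s)) (at s within {q..u})"
        by (auto intro!: derivative_eq_intros)
      then show "((\<lambda>s. exp (\<theta> * s)) has_vector_derivative \<theta> * exp (\<theta> * s)) (at s within {q..u})"
        by (simp add: has_real_derivative_iff_has_vector_derivative)
    qed (use u in auto)
    from has_integral_mult_right[OF this, of "\<delta> / (2 * \<theta>)"]
    have I2: "((\<lambda>s. (\<delta> / 2) * exp (\<theta> * s)) has_integral (\<delta> / (2 * \<theta>)) * (exp (\<theta> * u) - exp (\<theta> * q))) {q..u}"
      using \<theta> by (simp add: field_simps)
    have ik: "(\<lambda>s. exp (\<theta> * s) * k s) integrable_on {q..u}"
      by (intro integrable_continuous_interval continuous_intros continuous_on_subset[OF kc sub])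
    have ir: "(\<lambda>s. exp (\<theta> * s) * rat_poly q cs s) integrable_on {q..u}"
      by (intro integrable_continuous_interval continuous_intros continuous_on_rat_poly)
    \<comment> \<open>The integrated approximation error. Weighted by
      \<open>\<theta> * exp (- \<theta> * u)\<close> it is at most \<open>\<delta> / 2\<close> for
      every \<open>u\<close>, and the pointwise error supplies the other half.\<close>
    define J where "J = integral {q..u} (\<lambda>s. exp (\<theta> * s) * (k s - rat_poly q cs s))"
    have J: "J = exp (\<theta> * u) * F u - integral {q..u} (\<lambda>s. exp (\<theta> * s) * rat_poly q cs s)"
      unfolding J_def right_diff_distrib by (simp add: integral_diff[OF ik ir] I1)
    have "norm J \<le> integral {q..u} (\<lambda>s. (\<delta> / 2) * exp (\<theta> * s))"
      unfolding J_def
    proof (rule integral_norm_bound_integral)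
      show "(\<lambda>s. exp (\<theta> * s) * (k s - rat_poly q cs s)) integrable_on {q..u}"
        unfolding right_diff_distrib by (rule integrable_diff[OF ik ir])
      show "(\<lambda>s. (\<delta> / 2) * exp (\<theta> * s)) integrable_on {q..u}" using I2 by blast
      show "norm (exp (\<theta> * s) * (k s - rat_poly q cs s)) \<le> (\<delta> / 2) * exp (\<theta> * s)" if "s \<in> {q..u}" for s
        using cs[of s] that sub by (auto simp: abs_mult mult.commute intro!: mult_left_mono)
    qed
    also have "\<dots> = (\<delta> / (2 * \<theta>)) * (exp (\<theta> * u) - exp (\<theta> * q))" by (rule integral_unique[OF I2])
    also have "\<dots> \<le> (\<delta> / (2 * \<theta>)) * exp (\<theta> * u)" using \<delta> \<theta> by (intro mult_left_mono) auto
    finally have "(\<theta> * exp (- \<theta> * u)) * \<bar>J\<bar> \<le> (\<theta> * exp (- \<theta> * u)) * ((\<delta> / (2 * \<theta>)) * exp (\<theta> * u))"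
      using \<theta> by (intro mult_left_mono) auto
    also have "\<dots> = \<delta> / 2" using \<theta> by (simp add: exp_minus field_simps)
    finally have Jb: "\<bar>\<theta> * exp (- \<theta> * u) * J\<bar> \<le> \<delta> / 2" using \<theta> by (simp add: abs_mult)
    have "f u - ou_shift \<theta> (rat_poly q cs) u = (k u - rat_poly q cs u) - \<theta> * exp (- \<theta> * u) * J"
    proof -
      have "ou_shift \<theta> (rat_poly q cs) u = rat_poly q cs u - \<theta> * (exp (- \<theta> * u) * (exp (\<theta> * u) * F u - J))"
        by (subst ou_shift_eq[where q=q]) (use u in \<open>auto simp: J continuous_on_rat_poly rat_poly_eq_0\<close>)
      also have "\<dots> = rat_poly q cs u - \<theta> * F u + \<theta> * exp (- \<theta> * u) * J"
        by (simp add: right_diff_distrib mult.assoc[symmetric] exp_minus)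
      finally show ?thesis by (simp add: k_def)
    qed
    then show ?thesis using Jb cs[OF u] by linarith
  qed
  then show ?thesis by blast
qed

lemma continuous_on_ou_shift_rat_poly:
  "continuous_on {q..T} (ou_shift \<theta> (rat_poly q cs))"
proof -
  have "continuous_on {q..T} (\<lambda>t. rat_poly q cs t - \<theta> * (exp (- \<theta> * t) * integral {q..t} (\<lambda>s. exp (\<theta> * s) * rat_poly q cs s)))"
    by (intro continuous_intros continuous_on_rat_poly indefinite_integral_continuous_1 integrable_continuous_interval)
  then show ?thesis
  proof (rule continuous_on_eq)
    fix t assume "t \<in> {q..T}"
    then show "rat_poly q cs t - \<theta> * (exp (- \<theta> * t) * integral {q..t} (\<lambda>s. exp (\<theta> * s) * rat_poly q cs s)) = ou_shift \<theta> (rat_poly q cs) t"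
      by (intro ou_shift_eq[symmetric] continuous_on_rat_poly rat_poly_eq_0) auto
  qed
qed

text \<open>\<open>h\<close> is explicit only up to \<open>T\<close>, so linearity is obtained from
  the integrals over [q,t].\<close>

lemma ou_shift_diff:
  assumes "\<And>s. s \<le> T \<Longrightarrow> h s = rat_poly q ds s - rat_poly q cs s" and t: "t \<le> T"
  shows "ou_shift \<theta> h t = ou_shift \<theta> (rat_poly q ds) t - ou_shift \<theta> (rat_poly q cs) t"
proof (cases "t \<le> q")
  case True
  then show ?thesis
    \<comment> \<open>The assumptions make \<open>h\<close> vanish only up to the smaller of
      \<open>q\<close> and \<open>T\<close>.\<close>
    using assms by (subst (1 2 3) ou_shift_eq_0[where q="min q T"]) (auto simp: rat_poly_eq_0)
next
  case False
  then have q: "q \<le> t" by simp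
  have hc: "continuous_on {q..t} h"
    by (rule continuous_on_eq[where f="\<lambda>s. rat_poly q ds s - rat_poly q cs s"])
      (use assms in \<open>auto intro!: continuous_intros continuous_on_rat_poly\<close>)
  have i: "(\<lambda>s. exp (\<theta> * s) * rat_poly q es s) integrable_on {q..t}" for es
    by (intro integrable_continuous_interval continuous_intros continuous_on_rat_poly)
  have "integral {q..t} (\<lambda>s. exp (\<theta> * s) * h s) = integral {q..t} (\<lambda>s. exp (\<theta> * s) * rat_poly q ds s - exp (\<theta> * s) * rat_poly q cs s)"
    by (rule integral_cong) (use assms in \<open>auto simp: right_diff_distrib\<close>)
  also have "\<dots> = integral {q..t} (\<lambda>s. exp (\<theta> * s) * rat_poly q ds s) - integral {q..t} (\<lambda>s. exp (\<theta> * s) * rat_poly q cs s)"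
    by (rule integral_diff[OF i i])
  finally show ?thesis
    using assms q t
    by (subst (1 2 3) ou_shift_eq[where q=q])
      (auto simp: hc continuous_on_rat_poly rat_poly_eq_0 right_diff_distrib)
qed

section \<open>Conditional full support of the two processes\<close>

lemma mmfBm_conditional_full_support:
  assumes P: "prob_space P" and mm: "mmfBm P \<sigma> H B M" and T: "0 < T"
  shows "conditional_full_support P T M"
proof -
  note G = mmfBm_gaussian[OF P mm]
  have Mm: "M t \<in> borel_measurable P" for t using G(1) by (rule L2_measurable)
  have Mc: "continuous_paths P M" using mm by (simp add: mmfBm_def)
  show "conditional_full_support P T M"
  proof (rule conditional_full_supportI[OF P Mm Mc T])
    fix q A and f :: "real \<Rightarrow> real" and \<delta> :: real
    assume q: "q \<in> {0..T}" and A: "A \<in> sets (natural_filtration P M q)" "emeasure P A \<noteq> 0"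
      and f: "continuous_on {q..T} f" and \<delta>: "0 < \<delta>"
    have q': "0 \<le> q" "q \<le> T" using q by auto
    show "emeasure P {\<omega>\<in>A. \<forall>u\<in>{q..T}. \<bar>M u \<omega> - M q \<omega> - (f u - f q)\<bar> \<le> \<delta>} \<noteq> 0"
    proof (rule support_at_fixed_time[OF P Mm Mc q', where G="range (rat_poly q)"])
      show "countable (range (rat_poly q))" by simp
      show "admissible_shift P {0..T} M (\<lambda>t. g2 t - g1 t)" if g12: "g1 \<in> range (rat_poly q)" "g2 \<in> range (rat_poly q)" for g1 g2
      proof -
        obtain cs ds where g: "g1 = rat_poly q cs" "g2 = rat_poly q ds" using g12 by blast
        obtain h where h: "admissible_shift P UNIV M h" "\<And>t. t \<le> T \<Longrightarrow> h t = rat_poly q ds t - rat_poly q cs t"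
          by (rule mmfBm_admissible_rat_poly[OF P mm q', of ds cs]) blast
        have "admissible_shift P {0..T} M h" by (rule admissible_shift_subset[OF h(1) Mm]) simp
        then show ?thesis
          by (subst (asm) admissible_shift_cong[where k="\<lambda>t. g2 t - g1 t"]) (auto simp: h(2) g)
      qed
      show "\<exists>g\<in>range (rat_poly q). \<forall>u\<in>{q..T}. \<bar>f u - g u\<bar> \<le> \<delta>"
        if "continuous_on {q..T} f" "f q = 0" "0 < \<delta>" for f :: "real \<Rightarrow> real" and \<delta>
        using rat_poly_dense[OF that(1,2) q'(2) that(3)] by auto
    qed (use A f \<delta> in \<open>auto simp: rat_poly_eq_0 continuous_on_rat_poly\<close>)
  qed
qed

text \<open>The filtration is that of U itself. Its past events are kept because a shift of M that
  vanishes up to \<open>q\<close> induces a shift of U that vanishes there too.\<close>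

lemma mmfOU_conditional_full_support:
  assumes P: "prob_space P" and mm: "mmfBm P \<sigma> H B M" and \<theta>: "0 < \<theta>" and ou: "mmfOU P \<theta> M U" and T: "0 < T"
  shows "conditional_full_support P T U"
proof -
  note G = mmfBm_gaussian[OF P mm]
  have Mc: "continuous_paths P M" using mm by (simp add: mmfBm_def)
  have Um: "\<And>t. U t \<in> borel_measurable P" and Uc: "continuous_paths P U"
    using ou by (auto simp: mmfOU_def)
  show "conditional_full_support P T U"
  proof (rule conditional_full_supportI[OF P Um Uc T])
    fix q A and f :: "real \<Rightarrow> real" and \<delta> :: real
    assume q: "q \<in> {0..T}" and A: "A \<in> sets (natural_filtration P U q)" "emeasure P A \<noteq> 0"
      and f: "continuous_on {q..T} f" and \<delta>: "0 < \<delta>"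
    have q': "0 \<le> q" "q \<le> T" using q by auto
    show "emeasure P {\<omega>\<in>A. \<forall>u\<in>{q..T}. \<bar>U u \<omega> - U q \<omega> - (f u - f q)\<bar> \<le> \<delta>} \<noteq> 0"
    proof (rule support_at_fixed_time[OF P Um Uc q', where G="range (\<lambda>cs. ou_shift \<theta> (rat_poly q cs))"])
      show "countable (range (\<lambda>cs. ou_shift \<theta> (rat_poly q cs)))" by simp
      show "admissible_shift P {0..T} U (\<lambda>t. g2 t - g1 t)"
        if g12: "g1 \<in> range (\<lambda>cs. ou_shift \<theta> (rat_poly q cs))" "g2 \<in> range (\<lambda>cs. ou_shift \<theta> (rat_poly q cs))" for g1 g2
      proof -
        obtain cs ds where g: "g1 = ou_shift \<theta> (rat_poly q cs)" "g2 = ou_shift \<theta> (rat_poly q ds)" using g12 by blast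
        obtain h where h: "admissible_shift P UNIV M h" "\<And>t. t \<le> T \<Longrightarrow> h t = rat_poly q ds t - rat_poly q cs t"
          "h \<in> borel_measurable borel"
          by (rule mmfBm_admissible_rat_poly[OF P mm q', of ds cs]) blast
        have "admissible_shift P {0..T} U (\<lambda>t. h t - \<theta> * (LINT s:{..t}|lborel. exp (- \<theta> * (t - s)) * h s))"
        proof (rule admissible_shift_ou[OF P ou \<theta> G(1) Mc G(4) h(1)])
          show "continuous_on {..T} h"
            by (rule continuous_on_eq[where f="\<lambda>s. rat_poly q ds s - rat_poly q cs s"])
              (auto simp: h(2) intro!: continuous_intros continuous_on_rat_poly)
          show "h t = 0" if "t \<le> q" for t using that q' h(2)[of t] by (simp add: rat_poly_eq_0)
        qed (use h(3) in auto)
        then have "admissible_shift P {0..T} U (ou_shift \<theta> h)" by (simp only: ou_shift_def[abs_def])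
        then show ?thesis
          by (subst (asm) admissible_shift_cong[where k="\<lambda>t. g2 t - g1 t"]) (auto simp: g intro!: ou_shift_diff[OF h(2)])
      qed
      show "g t = 0" if "g \<in> range (\<lambda>cs. ou_shift \<theta> (rat_poly q cs))" "t \<in> {0..q}" for g t
        using that by (auto intro!: ou_shift_eq_0 rat_poly_eq_0)
      show "\<exists>g\<in>range (\<lambda>cs. ou_shift \<theta> (rat_poly q cs)). \<forall>u\<in>{q..T}. \<bar>f u - g u\<bar> \<le> \<delta>"
        if "continuous_on {q..T} f" "f q = 0" "0 < \<delta>" for f :: "real \<Rightarrow> real" and \<delta>
        using ou_shift_rat_poly_dense[OF that(1,2) q'(2) that(3) \<theta>] by auto
    qed (use A f \<delta> in \<open>auto simp: continuous_on_ou_shift_rat_poly\<close>)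
  qed
qed

theorem theorem6p1:
  fixes P :: "'a measure"
    and \<sigma> H :: "nat \<Rightarrow> real"
    and B :: "nat \<Rightarrow> real \<Rightarrow> 'a \<Rightarrow> real"
    and M U :: "real \<Rightarrow> 'a \<Rightarrow> real"
    and \<theta> T :: real
  assumes "prob_space P"
    and "mmfBm P \<sigma> H B M"
    and "0 < \<theta>"
    and "mmfOU P \<theta> M U"
    and "0 < T"
  shows "conditional_full_support P T M \<and> conditional_full_support P T U"
proof
  have "(fact 170 :: nat) div fact 169 = 170" by (simp add: fact_numeral)
  show "conditional_full_support P T M"
    by (rule mmfBm_conditional_full_support[OF assms(1,2,5)])
  show "conditional_full_support P T U"
    by (rule mmfOU_conditional_full_support[OF assms(1-5)])
qed

end
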